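(* Let $O_1=O[B_1,Q_1,L_1,R_1,T_1]$ be a continuous matrix product operator (cMPO) with bond dimension $D_1$ and let $|\psi[B_2,Q_2,L_2]\rangle$ be a continuous matrix product state (cMPS) with bond dimension $D_2$. Then $O_1|\psi[B_2,Q_2,L_2]\rangle$ is a cMPS with bond dimension $D\le D_1D_2$; explicitly, it equals $|\psi[B,Q,L]\rangle$ with $$B=B_1\otimes B_2,\qquad L(x)=L_1(x)\otimes\mathbb{1}_{D_2}+T_1(x)\otimes L_2(x),$$ $$Q(x)=Q_1(x)\otimes\mathbb{1}_{D_2}+\mathbb{1}_{D_1}\otimes Q_2(x)+R_1(x)\otimes L_2(x).$$
   Context: Setting. $I=[x_-,x_+]=[-\ell/2,\ell/2]$ is an interval, $\mathfrak F$ is the bosonic Fock space $\bigoplus_{N\ge 0} L^2(I)^{\odot N}$, $\psi(x)$ is the bosonic field operator with $[\psi(x),\psi^\dagger(y)]=\delta(x-y)$, and $|\Omega\rangle$ is the Fock vacuum, $\psi(x)|\Omega\rangle=0$. For a matrix-valued function $Q$, $V_x^y=\mathcal P\exp\int_x^y Q(z)\,dz$ is the path-ordered exponential, ordered so that $\partial_yV_x^y=V_x^yQ(y)$, $V_x^x=\mathbb{1}$, $V_x^yV_y^z=V_x^z$; $V_i^{i+1}=V_{x_i}^{x_{i+1}}$, $V_-^1=V_{x_-}^{x_1}$, $V_n^+=V_{x_n}^{x_+}$. Matrix-valued functions are assumed regular enough that all expressions make sense. cMPS. For $B\in M_D(\mathbb C)$ and $Q,L:I\to M_D(\mathbb C)$,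 the cMPS with bond dimension $D$ is $$|\psi[B,Q,L]\rangle=\mathrm{Tr}_D\big(B\,\mathcal Pe^{\int_I dx\,Q(x)\otimes\mathbb 1+L(x)\otimes\psi^\dagger(x)}\big)|\Omega\rangle=\sum_{j\ge0}\int_{x_1<\dots<x_j}\! d^jx\ \mathrm{Tr}\big(BV_-^1L(x_1)V_1^2\cdots L(x_j)V_j^+\big)\psi^\dagger(x_1)\cdots\psi^\dagger(x_j)|\Omega\rangle .$$ cMPO. For $B\in M_D(\mathbb C)$ and $Q,L,R,T:I\to M_D(\mathbb C)$, the cMPO with bond dimension $D$ is $$O[B,Q,L,R,T]=\mathrm{Tr}_D\Big(B\,\mathcal P e^{\int_I dx\,(Q(x)\otimes \mathrm{Id}+L(x)\otimes l_x+R(x)\otimes r_x+T(x)\otimes \mathrm{Ad}_x)}\Big)\big(|\Omega\rangle\langle\Omega|\big),$$ with supermaps $l_x[X]=\psi^\dagger(x)X$, $r_x[X]=X\psi(x)$, $\mathrm{Ad}_x[X]=\psi^\dagger(x)X\psi(x)$, $\mathrm{Id}[X]=X$; i.e. the Dyson expansion $$O=\sum_{n\ge0}\ \sum_{\alpha\in\{L,R,A\}^n}\int_{x_1<\dots<x_n}\! d^nx\ \mathrm{Tr}\big(B\,V_-^1K^{\alpha_1}(x_1)V_1^2\cdots K^{\alpha_n}(x_n)V_n^+\big)\; s^{\alpha_1}_{x_1}\cdots s^{\alpha_n}_{x_n}\big[|\Omega\rangle\langle\Omega|\big],$$ with $K^L=L$, $K^R=R$, $K^A=T$, $s^L_x=l_x$,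 $s^R_x=r_x$, $s^A_x=\mathrm{Ad}_x$. Operators are understood through their matrix elements between particle-number sectors, and $O_1|\psi\rangle$ is computed sector by sector. *)

theory Defs
  imports "HOL-Analysis.Analysis" "HOL-Combinatorics.Permutations"
begin

section \<open>Matrix-valued functions and path-ordered exponentials\<close>

text \<open>Regularity class of the matrix-valued functions on an interval \<open>I\<close>: Borel measurable and
  bounded. It is closed under the operations of the main theorem.\<close>

definition regular_on :: "real set \<Rightarrow> (real \<Rightarrow> complex^'d^'d) \<Rightarrow> bool" where
  "regular_on I F \<longleftrightarrow> F \<in> borel_measurable (restrict_space borel I) \<and> bounded (F ` I)"

definition kron :: "complex^'m^'m \<Rightarrow> complex^'n^'n \<Rightarrow> complex^('m \<times> 'n)^('m \<times> 'n)"
    (infixr "\<otimes>\<^sub>K" 71) where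
  "A \<otimes>\<^sub>K B = (\<chi> i j. A $ fst i $ fst j * B $ snd i $ snd j)"

text \<open>\<open>dyson_term Q x n y\<close> is the integral of \<open>Q z\<^sub>1 ** \<dots> ** Q z\<^sub>n\<close> over
  \<open>x < z\<^sub>1 < \<dots> < z\<^sub>n < y\<close>, as an iterated integral with \<open>z\<^sub>n\<close> outermost. The factor with the
  largest argument stands on the right, so \<open>path_exp Q x y\<close> is \<open>V\<^sub>x\<^sup>y\<close> with
  \<open>\<partial>\<^sub>y V\<^sub>x\<^sup>y = V\<^sub>x\<^sup>y Q(y)\<close>. Only \<open>x \<le> y\<close> is used.\<close>

primrec dyson_term :: "(real \<Rightarrow> complex^'d^'d) \<Rightarrow> real \<Rightarrow> nat \<Rightarrow> real \<Rightarrow> complex^'d^'d" where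
  "dyson_term Q x 0 y = mat 1"
| "dyson_term Q x (Suc n) y = (LINT z:{x..y}|lborel. dyson_term Q x n z ** Q z)"

definition path_exp :: "(real \<Rightarrow> complex^'d^'d) \<Rightarrow> real \<Rightarrow> real \<Rightarrow> complex^'d^'d" where
  "path_exp Q x y = (\<Sum>n. dyson_term Q x n y)"

text \<open>For \<open>ps = [(x\<^sub>1, M\<^sub>1), \<dots>, (x\<^sub>n, M\<^sub>n)]\<close>, \<open>path_chain Q x ps b\<close> is the product
  \<open>V\<^sub>x\<^sup>1 M\<^sub>1 V\<^sub>1\<^sup>2 M\<^sub>2 \<dots> M\<^sub>n V\<^sub>n\<^sup>b\<close>.\<close>

fun path_chain :: "(real \<Rightarrow> complex^'d^'d) \<Rightarrow> real \<Rightarrow> (real \<times> (complex^'d^'d)) list \<Rightarrow> real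
    \<Rightarrow> complex^'d^'d" where
  "path_chain Q x [] b = path_exp Q x b"
| "path_chain Q x ((y, M) # ps) b = path_exp Q x y ** M ** path_chain Q y ps b"


section \<open>Fock space over an interval\<close>

text \<open>\<open>config_space a b N\<close> is \<open>[a,b]\<^sup>N\<close> with Lebesgue measure; its points are functions on
  \<open>{..<N}\<close>, turned into lists by \<open>points\<close>.\<close>

definition config_space :: "real \<Rightarrow> real \<Rightarrow> nat \<Rightarrow> (nat \<Rightarrow> real) measure" where
  "config_space a b N = PiM {..<N} (\<lambda>_. restrict_space lborel {a..b})"

definition points :: "nat \<Rightarrow> (nat \<Rightarrow> real) \<Rightarrow> real list" where
  "points N x = map x [0..<N]"

definition ordered_integral :: "real \<Rightarrow> real \<Rightarrow> nat \<Rightarrow> (real list \<Rightarrow> complex) \<Rightarrow> complex" where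
  "ordered_integral a b N f =
     (LINT x:{x \<in> space (config_space a b N). strict_mono_on {..<N} x}|config_space a b N.
        f (points N x))"

text \<open>A Fock vector is represented by the family of its \<open>N\<close>-particle wave functions: the
  \<open>N\<close>-particle component is the restriction to lists of length \<open>N\<close>. Vectors are pointwise
  representatives of L2 classes; all quantities used below are integrals over configurations.\<close>

type_synonym fock = "real list \<Rightarrow> complex"

definition sector :: "nat \<Rightarrow> fock \<Rightarrow> fock" where
  "sector N \<phi> = (\<lambda>xs. if length xs = N then \<phi> xs else 0)"

definition fock_sector :: "real \<Rightarrow> real \<Rightarrow> nat \<Rightarrow> fock set" where
  "fock_sector a b N = {\<phi>.
     (\<forall>xs. length xs \<noteq> N \<longrightarrow> \<phi> xs = 0) \<and>
     (\<forall>xs ys. mset xs = mset ys \<longrightarrow> \<phi> xs = \<phi> ys) \<and>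
     (\<lambda>x. \<phi> (points N x)) \<in> borel_measurable (config_space a b N) \<and>
     integrable (config_space a b N) (\<lambda>x. (cmod (\<phi> (points N x)))\<^sup>2)}"

definition fock_inner :: "real \<Rightarrow> real \<Rightarrow> fock \<Rightarrow> fock \<Rightarrow> complex" where
  "fock_inner a b \<phi> \<xi> =
     (\<Sum>N. (LINT x|config_space a b N. cnj (\<phi> (points N x)) * \<xi> (points N x)))"

text \<open>The field operator \<open>\<psi>(x)\<close>. Its adjoint \<open>\<psi>\<^sup>\<dagger>(x)\<close> creates a delta function and is used only
  in matrix elements, where it acts as \<open>\<psi>(x)\<close> on the bra.\<close>

definition ann :: "real \<Rightarrow> fock \<Rightarrow> fock" where
  "ann x \<phi> = (\<lambda>ys. complex_of_real (sqrt (real (length ys + 1))) * \<phi> (x # ys))"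

text \<open>An operator \<open>X\<close> is given by its matrix elements \<open>X \<phi> \<xi> = \<langle>\<phi>|X|\<xi>\<rangle>\<close>, the supermaps
  \<open>l\<^sub>x\<close>, \<open>r\<^sub>x\<close>, \<open>Ad\<^sub>x\<close> by what they do to these.\<close>

type_synonym fock_form = "fock \<Rightarrow> fock \<Rightarrow> complex"

definition vac_proj :: fock_form where
  "vac_proj \<phi> \<xi> = cnj (\<phi> []) * \<xi> []"

definition l_map :: "real \<Rightarrow> fock_form \<Rightarrow> fock_form" where
  "l_map x X \<phi> \<xi> = X (ann x \<phi>) \<xi>"

definition r_map :: "real \<Rightarrow> fock_form \<Rightarrow> fock_form" where
  "r_map x X \<phi> \<xi> = X \<phi> (ann x \<xi>)"

definition Ad_map :: "real \<Rightarrow> fock_form \<Rightarrow> fock_form" where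
  "Ad_map x X \<phi> \<xi> = X (ann x \<phi>) (ann x \<xi>)"


section \<open>Continuous matrix product operators and states\<close>

datatype leg = Leg_L | Leg_R | Leg_A

primrec leg_matrix :: "(real \<Rightarrow> complex^'d^'d) \<Rightarrow> (real \<Rightarrow> complex^'d^'d) \<Rightarrow>
    (real \<Rightarrow> complex^'d^'d) \<Rightarrow> leg \<Rightarrow> real \<Rightarrow> complex^'d^'d" where
  "leg_matrix L R T Leg_L = L"
| "leg_matrix L R T Leg_R = R"
| "leg_matrix L R T Leg_A = T"

primrec leg_map :: "leg \<Rightarrow> real \<Rightarrow> fock_form \<Rightarrow> fock_form" where
  "leg_map Leg_L = l_map"
| "leg_map Leg_R = r_map"
| "leg_map Leg_A = Ad_map"

text \<open>If \<open>\<phi>\<close> and \<open>\<xi>\<close> have \<open>N\<close> and \<open>m\<close> particles, only the terms with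
  \<open>max N m \<le> n \<le> N + m\<close> are nonzero.\<close>

definition cmpo :: "real \<Rightarrow> real \<Rightarrow> complex^'d^'d \<Rightarrow> (real \<Rightarrow> complex^'d^'d) \<Rightarrow>
    (real \<Rightarrow> complex^'d^'d) \<Rightarrow> (real \<Rightarrow> complex^'d^'d) \<Rightarrow> (real \<Rightarrow> complex^'d^'d) \<Rightarrow>
    fock_form" where
  "cmpo a b B Q L R T \<phi> \<xi> =
     (\<Sum>n. \<Sum>\<alpha>s | length \<alpha>s = n. ordered_integral a b n (\<lambda>xs.
        trace (B ** path_chain Q a (map2 (\<lambda>\<alpha> x. (x, leg_matrix L R T \<alpha> x)) \<alpha>s xs) b) *
        foldr (\<lambda>(\<alpha>, x). leg_map \<alpha> x) (zip \<alpha>s xs) vac_proj \<phi> \<xi>))"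

definition cmps_amplitude :: "real \<Rightarrow> real \<Rightarrow> complex^'d^'d \<Rightarrow> (real \<Rightarrow> complex^'d^'d) \<Rightarrow>
    (real \<Rightarrow> complex^'d^'d) \<Rightarrow> real list \<Rightarrow> complex" where
  "cmps_amplitude a b B Q L xs = trace (B ** path_chain Q a (map (\<lambda>x. (x, L x)) xs) b)"

text \<open>The wave function of the cMPS: the coefficient of
  \<open>\<psi>\<^sup>\<dagger>(x\<^sub>1) \<dots> \<psi>\<^sup>\<dagger>(x\<^sub>N)|\<Omega>\<rangle>\<close> on \<open>x\<^sub>1 < \<dots> < x\<^sub>N\<close> is the amplitude, and smearing this ket with a
  function supported on ordered configurations gives \<open>1 / sqrt (N!)\<close> times the symmetric
  extension of that function. That this is the expansion of the cMPS in creation operators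
  is \<open>fock_inner_cmps\<close> below.\<close>

definition cmps :: "real \<Rightarrow> real \<Rightarrow> complex^'d^'d \<Rightarrow> (real \<Rightarrow> complex^'d^'d) \<Rightarrow>
    (real \<Rightarrow> complex^'d^'d) \<Rightarrow> fock" where
  "cmps a b B Q L xs =
     cmps_amplitude a b B Q L (sort xs) / complex_of_real (sqrt (fact (length xs)))"

text \<open>\<open>X|\<xi>\<rangle> = |\<Psi>\<rangle>\<close>, sector by sector: every \<open>N\<close>-particle component of \<open>\<Psi>\<close> is a vector of the
  \<open>N\<close>-particle space, and it is the weak sum over \<open>m\<close> of the contributions of the
  \<open>m\<close>-particle components of \<open>\<xi>\<close>.\<close>

definition maps_to :: "real \<Rightarrow> real \<Rightarrow> fock_form \<Rightarrow> fock \<Rightarrow> fock \<Rightarrow> bool" where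
  "maps_to a b X \<xi> \<Psi> \<longleftrightarrow>
     (\<forall>N. sector N \<Psi> \<in> fock_sector a b N \<and>
        (\<forall>\<phi> \<in> fock_sector a b N. (\<lambda>m. X \<phi> (sector m \<xi>)) sums fock_inner a b \<phi> \<Psi>))"


section \<open>Expansion of the cMPS in creation operators\<close>

lemma fold_ann: "fold ann xs \<phi> ys =
    complex_of_real (sqrt (fact (length xs + length ys) / fact (length ys))) * \<phi> (xs @ ys)"
proof (induction xs arbitrary: \<phi>)
  case Nil
  then show ?case by simp
next
  case (Cons x xs)
  have "sqrt (fact (length xs + length ys) / fact (length ys)) * sqrt (real (length xs + length ys + 1))
      = sqrt (fact (length (x # xs) + length ys) / fact (length ys))"
    by (simp add: real_sqrt_mult [symmetric] field_simps)
  moreover have "fold ann (x # xs) \<phi> ys =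
      complex_of_real (sqrt (fact (length xs + length ys) / fact (length ys)) *
        sqrt (real (length xs + length ys + 1))) * \<phi> ((x # xs) @ ys)"
    unfolding fold_simps Cons.IH by (simp add: ann_def mult.assoc)
  ultimately show ?case by simp
qed

lemma product_sigma_finite_interval:
  "product_sigma_finite (\<lambda>_::nat. restrict_space lborel {a..b::real})"
  by (intro product_sigma_finite.intro sigma_finite_measure_restrict_space)
     (auto simp: lborel.sigma_finite_measure_axioms)

lemma config_space_component [measurable]:
  "i < N \<Longrightarrow> (\<lambda>x. x i) \<in> borel_measurable (config_space a b N)"
proof -
  assume "i < N"
  then have "(\<lambda>x. x i) \<in> measurable (config_space a b N) (restrict_space lborel {a..b})"
    unfolding config_space_def by (intro measurable_component_singleton) auto
  then show ?thesis
    by (simp add: measurable_restrict_space2_iff)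
qed

lemma ordered_set_measurable [measurable]:
  "{x \<in> space (config_space a b N). strict_mono_on {..<N} x} \<in> sets (config_space a b N)"
proof -
  have "{x \<in> space (config_space a b N). strict_mono_on {..<N} x} =
      {x \<in> space (config_space a b N). \<forall>i\<in>{..<N}. \<forall>j\<in>{..<N}. i < j \<longrightarrow> x i < x j}"
    by (auto simp: strict_mono_on_def)
  also have "\<dots> \<in> sets (config_space a b N)"
    by measurable
  finally show ?thesis .
qed
lemma distr_config_space_permute:
  assumes "p permutes {..<N}"
  shows "distr (config_space a b N) (config_space a b N) (\<lambda>x. \<lambda>i\<in>{..<N}. x (p i)) = config_space a b N"
proof -
  interpret product_sigma_finite "\<lambda>_::nat. restrict_space lborel {a..b}"
    by (rule product_sigma_finite_interval)
  let ?M = "\<lambda>_::nat. restrict_space lborel {a..b}"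
  let ?T = "\<lambda>x::nat \<Rightarrow> real. \<lambda>i\<in>{..<N}. x (p i)"
  have p: "p i < N \<longleftrightarrow> i < N" for i
    using permutes_in_image [OF assms, of i] by simp
  have T: "?T \<in> measurable (PiM {..<N} ?M) (PiM {..<N} ?M)"
    by (intro measurable_restrict measurable_component_singleton) (simp add: p)
  have "distr (PiM {..<N} ?M) (PiM {..<N} ?M) ?T = PiM {..<N} ?M"
  proof (rule PiM_eqI)
    fix A assume A: "\<And>i. i \<in> {..<N} \<Longrightarrow> A i \<in> sets (?M i)"
    let ?q = "inv_into UNIV p"
    have q: "?q permutes {..<N}"
      by (rule permutes_inv [OF assms])
    then have qN: "?q i < N \<longleftrightarrow> i < N" for i
      using permutes_in_image [OF q, of i] by simp
    have pq: "p (?q i) = i" "?q (p i) = i" for i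
      using permutes_inverses [OF assms] by auto
    have "?T -` Pi\<^sub>E {..<N} A \<inter> space (PiM {..<N} ?M) = Pi\<^sub>E {..<N} (\<lambda>i. A (?q i))"
    proof (intro set_eqI iffI)
      fix x assume "x \<in> ?T -` Pi\<^sub>E {..<N} A \<inter> space (PiM {..<N} ?M)"
      then have x: "x \<in> extensional {..<N}" "\<And>i. i < N \<Longrightarrow> x (p i) \<in> A i"
        by (auto simp: space_PiM PiE_iff restrict_def)
      then have "x i \<in> A (?q i)" if "i < N" for i
        using x(2) [of "?q i"] that by (simp add: qN pq)
      then show "x \<in> Pi\<^sub>E {..<N} (\<lambda>i. A (?q i))"
        using x(1) by (auto simp: PiE_iff)
    next
      fix x assume x: "x \<in> Pi\<^sub>E {..<N} (\<lambda>i. A (?q i))"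
      then have "x (p i) \<in> A i" if "i < N" for i
        using that PiE_mem [OF x, of "p i"] by (simp add: p pq)
      moreover have "x i \<in> {a..b}" if "i < N" for i
        using that PiE_mem [OF x, of i] sets.sets_into_space [OF A [of "?q i"]]
        by (auto simp: qN space_restrict_space)
      ultimately show "x \<in> ?T -` Pi\<^sub>E {..<N} A \<inter> space (PiM {..<N} ?M)"
        using x by (auto simp: space_PiM PiE_iff space_restrict_space)
    qed
    then have "emeasure (distr (PiM {..<N} ?M) (PiM {..<N} ?M) ?T) (Pi\<^sub>E {..<N} A) =
        emeasure (PiM {..<N} ?M) (Pi\<^sub>E {..<N} (\<lambda>i. A (?q i)))"
      using T A by (subst emeasure_distr) (auto intro!: sets_PiM_I_finite)
    also have "\<dots> = (\<Prod>i<N. emeasure (?M i) (A (?q i)))"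
      using A by (subst emeasure_PiM) (auto simp: qN)
    also have "\<dots> = (\<Prod>i<N. emeasure (?M i) (A i))"
      using prod.permute [OF q, of "\<lambda>i. emeasure (?M i) (A i)"] by (simp add: comp_def)
    finally show "emeasure (distr (PiM {..<N} ?M) (PiM {..<N} ?M) ?T) (Pi\<^sub>E {..<N} A) =
        (\<Prod>i<N. emeasure (?M i) (A i))" .
  qed auto
  then show ?thesis
    unfolding config_space_def .
qed

lemma AE_config_space_inj: "AE x in config_space a b N. inj_on x {..<N}"
proof -
  interpret product_sigma_finite "\<lambda>_::nat. restrict_space lborel {a..b}"
    by (rule product_sigma_finite_interval)
  let ?M = "\<lambda>_::nat. restrict_space lborel {a..b}"
  have "AE x in config_space a b N. x i \<noteq> x j" if ij: "i < N" "j < N" "i \<noteq> j" for i j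
  proof -
    let ?E = "{x \<in> space (config_space a b N). x i = x j}"
    have [measurable]: "?E \<in> sets (config_space a b N)"
      using ij by measurable
    have ins: "insert i ({..<N} - {i}) = {..<N}"
      using ij by auto
    have "emeasure (config_space a b N) ?E =
        (\<integral>\<^sup>+x. indicator ?E x \<partial>PiM (insert i ({..<N} - {i})) ?M)"
      unfolding ins config_space_def [symmetric] by simp
    also have "\<dots> = (\<integral>\<^sup>+x. (\<integral>\<^sup>+y. indicator ?E (x(i := y)) \<partial>?M i) \<partial>PiM ({..<N} - {i}) ?M)"
    proof (rule product_nn_integral_insert)
      show "indicator ?E \<in> borel_measurable (PiM (insert i ({..<N} - {i})) ?M)"
        unfolding ins config_space_def [symmetric] by measurable
    qed auto
    also have "\<dots> = (\<integral>\<^sup>+x. 0 \<partial>PiM ({..<N} - {i}) ?M)"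
    proof (intro nn_integral_cong)
      fix x :: "nat \<Rightarrow> real"
      have "(\<integral>\<^sup>+y. indicator ?E (x(i := y)) \<partial>?M i) \<le> (\<integral>\<^sup>+y. indicator {x j} y \<partial>?M i)"
        using ij by (intro nn_integral_mono) (auto simp: indicator_def)
      also have "\<dots> = 0"
      proof -
        have "AE y in lborel. y \<noteq> x j"
          by (rule AE_lborel_singleton)
        then have "AE y in ?M i. y \<noteq> x j"
          by (subst AE_restrict_space_iff) (auto elim: eventually_mono)
        then have "AE y in ?M i. indicator {x j} y = (0 :: ennreal)"
          by eventually_elim simp
        then show ?thesis
          by (subst nn_integral_cong_AE [where v = "\<lambda>_. 0"]) auto
      qed
      finally show "(\<integral>\<^sup>+y. indicator ?E (x(i := y)) \<partial>?M i) = 0"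
        by simp
    qed
    finally have "emeasure (config_space a b N) ?E = 0"
      by simp
    then show ?thesis
      by (intro AE_I [of _ _ ?E]) auto
  qed
  then have "AE x in config_space a b N. \<forall>i\<in>{..<N}. \<forall>j\<in>{..<N}. i \<noteq> j \<longrightarrow> x i \<noteq> x j"
    by (intro AE_finite_allI AE_impI) auto
  then show ?thesis
    by eventually_elim (auto simp: inj_on_def)
qed

lemma ex1_sorting_permutation:
  fixes x :: "nat \<Rightarrow> real"
  assumes "inj_on x {..<N}"
  shows "\<exists>!p. p permutes {..<N} \<and> strict_mono_on {..<N} (\<lambda>i. x (p i))"
proof -
  let ?ys = "sorted_list_of_set (x ` {..<N})"
  have len: "length ?ys = N"
    using assms by (simp add: card_image)
  have mono: "strict_mono_on {..<N} (\<lambda>i. ?ys ! i)"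
    using sorted_list_of_set.strict_sorted_key_list_of_set [of "x ` {..<N}"] len
    by (auto simp: strict_mono_on_def sorted_wrt_iff_nth_less)
  have bx: "bij_betw x {..<N} (x ` {..<N})"
    using assms by (simp add: bij_betw_def)
  have by_: "bij_betw (\<lambda>i. ?ys ! i) {..<N} (x ` {..<N})"
    using bij_betw_nth [of ?ys "{..<N}" "x ` {..<N}"] len by simp
  define p where "p i = (if i < N then the_inv_into {..<N} x (?ys ! i) else i)" for i
  have "bij_betw (the_inv_into {..<N} x \<circ> (\<lambda>i. ?ys ! i)) {..<N} {..<N}"
    using bij_betw_trans [OF by_ bij_betw_the_inv_into [OF bx]] .
  then have "bij_betw p {..<N} {..<N}"
    by (subst bij_betw_cong [where g = "the_inv_into {..<N} x \<circ> (\<lambda>i. ?ys ! i)"]) (auto simp: p_def)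
  then have p: "p permutes {..<N}"
    by (rule bij_imp_permutes) (auto simp: p_def)
  have xp: "x (p i) = ?ys ! i" if "i < N" for i
    using that f_the_inv_into_f [OF assms, of "?ys ! i"] bij_betwE [OF by_] by (auto simp: p_def)
  show ?thesis
  proof (rule ex1I [of _ p])
    show "p permutes {..<N} \<and> strict_mono_on {..<N} (\<lambda>i. x (p i))"
      using p mono by (auto simp: strict_mono_on_def xp)
  next
    fix q assume q: "q permutes {..<N} \<and> strict_mono_on {..<N} (\<lambda>i. x (q i))"
    let ?zs = "map (\<lambda>i. x (q i)) [0..<N]"
    have "sorted_wrt (<) ?zs"
      using q by (auto simp: sorted_wrt_iff_nth_less strict_mono_on_def)
    moreover have "set ?zs = x ` {..<N}"
      using q permutes_image [of q "{..<N}"] image_image [of x q "{..<N}"]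
      by (simp add: atLeast0LessThan)
    ultimately have "?zs = ?ys"
      by (intro strict_sorted_equal) auto
    then have "x (q i) = x (p i)" if "i < N" for i
      using that by (metis (no_types, lifting) xp nth_map_upt add.left_neutral diff_zero)
    then have "q i = p i" if "i < N" for i
      using that inj_onD [OF assms, of "q i" "p i"] q p permutes_in_image [of q "{..<N}" i]
        permutes_in_image [of p "{..<N}" i] by auto
    moreover have "q i = p i" if "\<not> i < N" for i
      using that p q by (simp add: permutes_def)
    ultimately show "q = p" by blast
  qed
qed

lemma integral_config_space_symmetric:
  fixes f :: "real list \<Rightarrow> complex"
  assumes sym: "\<And>xs ys. mset xs = mset ys \<Longrightarrow> f xs = f ys"
    and meas: "(\<lambda>x. f (points N x)) \<in> borel_measurable (config_space a b N)"
  shows "(LINT x|config_space a b N. f (points N x)) = fact N * ordered_integral a b N f"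
proof -
  let ?M = "config_space a b N"
  let ?S = "{x \<in> space ?M. strict_mono_on {..<N} x}"
  let ?P = "{p. p permutes {..<N}}"
  let ?T = "\<lambda>p x. \<lambda>i\<in>{..<N}. x (p i) :: real"
  define h where "h x = f (points N x)" for x
  define g where "g x = indicator ?S x *\<^sub>R h x" for x
  have [measurable]: "h \<in> borel_measurable ?M"
    using meas by (simp add: h_def [abs_def])
  have g [measurable]: "g \<in> borel_measurable ?M"
    unfolding g_def [abs_def] by measurable
  have int_g: "ordered_integral a b N f = integral\<^sup>L ?M g"
    by (simp add: ordered_integral_def set_lebesgue_integral_def g_def [abs_def] h_def)
  have T [measurable]: "?T p \<in> measurable ?M ?M" if "p \<in> ?P" for p
    unfolding config_space_def
    using that permutes_in_image [of p "{..<N}"]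
    by (intro measurable_restrict measurable_component_singleton) auto
  have hT: "h (?T p x) = h x" if "p \<in> ?P" for p x
  proof -
    have "mset (points N (?T p x)) = image_mset x (image_mset p (mset_set {..<N}))"
      by (auto simp: points_def atLeast0LessThan image_mset.compositionality comp_def
          intro!: image_mset_cong)
    also have "image_mset p (mset_set {..<N}) = mset_set {..<N}"
      using that by (simp add: permutes_image_mset)
    also have "image_mset x (mset_set {..<N}) = mset (points N x)"
      by (simp add: points_def atLeast0LessThan)
    finally show ?thesis
      unfolding h_def by (rule sym)
  qed
  have fin: "finite ?P"
    by (simp add: finite_permutations)
  have AE: "AE x in ?M. h x = (\<Sum>p\<in>?P. g (?T p x))"
    using AE_config_space_inj AE_space
  proof eventually_elim
    case (elim x)
    obtain p where p: "p \<in> ?P" "strict_mono_on {..<N} (\<lambda>i. x (p i))"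
      and uniq: "\<And>q. q \<in> ?P \<Longrightarrow> strict_mono_on {..<N} (\<lambda>i. x (q i)) \<Longrightarrow> q = p"
      using ex1_sorting_permutation [OF elim(1)] by auto
    have "g (?T q x) = (if q = p then h x else 0)" if "q \<in> ?P" for q
    proof -
      have "?T q x \<in> ?S \<longleftrightarrow> strict_mono_on {..<N} (\<lambda>i. x (q i))"
        using measurable_space [OF T [OF that] elim(2)] by (auto simp: strict_mono_on_def)
      also have "\<dots> \<longleftrightarrow> q = p"
        using p uniq [OF that] by auto
      finally show ?thesis
        by (auto simp: g_def hT [OF that])
    qed
    then show ?case
      using fin p by simp
  qed
  have int_T: "integral\<^sup>L ?M (\<lambda>x. g (?T p x)) = integral\<^sup>L ?M g"
      "integrable ?M (\<lambda>x. g (?T p x)) \<longleftrightarrow> integrable ?M g" if "p \<in> ?P" for p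
    using that integral_distr [OF T [OF that] g] integrable_distr_eq [OF T [OF that] g]
      distr_config_space_permute [of p N a b] by simp_all
  show ?thesis
  proof (cases "integrable ?M g")
    case True
    have "integral\<^sup>L ?M h = integral\<^sup>L ?M (\<lambda>x. \<Sum>p\<in>?P. g (?T p x))"
      using AE by (intro integral_cong_AE) auto
    also have "\<dots> = (\<Sum>p\<in>?P. integral\<^sup>L ?M g)"
      using True int_T by (subst Bochner_Integration.integral_sum) auto
    also have "\<dots> = fact N * integral\<^sup>L ?M g"
      by (simp add: card_permutations)
    finally show ?thesis
      by (simp add: int_g h_def [abs_def])
  next
    case False
    moreover from this have "\<not> integrable ?M h"
      unfolding g_def using integrable_mult_indicator [of ?S ?M h] by auto
    ultimately show ?thesis
      by (simp add: int_g not_integrable_integral_eq h_def [abs_def])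
  qed
qed

text \<open>\<open>\<langle>\<phi>|\<psi>\<^sup>\<dagger>(x\<^sub>1) \<dots> \<psi>\<^sup>\<dagger>(x\<^sub>j)|\<Omega>\<rangle>\<close> is the conjugate of
  \<open>\<langle>\<Omega>|\<psi>(x\<^sub>j) \<dots> \<psi>(x\<^sub>1)|\<phi>\<rangle>\<close>, that is of \<open>fold ann xs \<phi> []\<close>.\<close>

lemma fock_inner_cmps:
  assumes \<phi>: "\<phi> \<in> fock_sector a b N"
    and \<psi>: "sector N (cmps a b B Q L) \<in> fock_sector a b N"
  shows "fock_inner a b \<phi> (cmps a b B Q L) =
    (\<Sum>j. ordered_integral a b j (\<lambda>xs. cmps_amplitude a b B Q L xs * cnj (fold ann xs \<phi> [])))"
proof -
  let ?\<psi> = "cmps a b B Q L"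
  let ?F = "\<lambda>xs. cmps_amplitude a b B Q L xs * cnj (fold ann xs \<phi> [])"
  have \<phi>0: "\<phi> xs = 0" if "length xs \<noteq> N" for xs
    using \<phi> that unfolding fock_sector_def by blast
  have \<phi>_sym: "\<phi> xs = \<phi> ys" if "mset xs = mset ys" for xs ys
    using \<phi> that unfolding fock_sector_def by blast
  have len: "length (points j x) = j" for j x
    by (simp add: points_def)
  have "fock_inner a b \<phi> ?\<psi> = (LINT x|config_space a b N. cnj (\<phi> (points N x)) * ?\<psi> (points N x))"
    unfolding fock_inner_def
    by (subst suminf_finite [of "{N}"]) (auto simp: \<phi>0 len)
  also have "\<dots> = fact N * ordered_integral a b N (\<lambda>xs. cnj (\<phi> xs) * ?\<psi> xs)"
  proof (rule integral_config_space_symmetric [where f = "\<lambda>xs. cnj (\<phi> xs) * ?\<psi> xs"])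
    fix xs ys :: "real list" assume "mset xs = mset ys"
    then have "sort xs = sort ys" "length xs = length ys" "\<phi> xs = \<phi> ys"
      by (metis sorted_list_of_multiset_mset, rule mset_eq_length, rule \<phi>_sym)
    then show "cnj (\<phi> xs) * ?\<psi> xs = cnj (\<phi> ys) * ?\<psi> ys"
      by (simp add: cmps_def)
  next
    have "(\<lambda>x. \<phi> (points N x)) \<in> borel_measurable (config_space a b N)"
      using \<phi> unfolding fock_sector_def by blast
    moreover have "(\<lambda>x. sector N ?\<psi> (points N x)) \<in> borel_measurable (config_space a b N)"
      using \<psi> unfolding fock_sector_def by blast
    then have "(\<lambda>x. ?\<psi> (points N x)) \<in> borel_measurable (config_space a b N)"
      by (simp add: sector_def len)
    ultimately show "(\<lambda>x. cnj (\<phi> (points N x)) * ?\<psi> (points N x)) \<in> borel_measurable (config_space a b N)"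
      by (intro borel_measurable_times borel_measurable_continuous_on [where f = cnj]
          continuous_intros) auto
  qed
  also have "\<dots> = ordered_integral a b N ?F"
  proof -
    have "fact N * (cnj (\<phi> (points N x)) * ?\<psi> (points N x)) = ?F (points N x)"
      if "strict_mono_on {..<N} x" for x
    proof -
      have "sorted (points N x)"
        using that by (auto simp: points_def sorted_iff_nth_mono strict_mono_on_def le_less)
      then have "sort (points N x) = points N x"
        by (simp add: sort_key_id_if_sorted)
      moreover have "fold ann (points N x) \<phi> [] = complex_of_real (sqrt (fact N)) * \<phi> (points N x)"
        by (simp add: fold_ann len)
      moreover have "(fact N :: complex) = complex_of_real (sqrt (fact N)) * complex_of_real (sqrt (fact N))"
        by (simp flip: of_real_mult)
      ultimately show ?thesis
        by (simp add: cmps_def len)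
    qed
    then show ?thesis
      unfolding ordered_integral_def set_lebesgue_integral_def
      by (subst integral_mult_right_zero [symmetric])
         (auto intro!: Bochner_Integration.integral_cong simp: indicator_def)
  qed
  also have "\<dots> = (\<Sum>j. ordered_integral a b j ?F)"
    by (subst suminf_finite [of "{N}"])
       (auto simp: ordered_integral_def set_lebesgue_integral_def fold_ann \<phi>0 len)
  finally show ?thesis .
qed

end

theory Submission
  imports Defs
begin

text \<open>
  Both sides are rewritten in an interaction picture, in which a path-ordered product becomes a product
  of functions of one variable. If \<open>V\<close> is the path-ordered exponential of \<open>Q\<close> from the left end point,
  then \<open>V\<^sub>x\<^sup>y = V(x)\<^sup>-\<^sup>1 V(y)\<close>, so a chain with insertions \<open>M\<^sub>i\<close> at \<open>x\<^sub>i\<close> is the product of the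
  \<open>V(x\<^sub>i) M\<^sub>i V(x\<^sub>i)\<^sup>-\<^sup>1\<close> times \<open>V\<close> at the right end point. With \<open>U = V\<^sub>1 \<otimes> V\<^sub>2\<close> the matrix element
  \<open>\<langle>\<phi>|O\<^sub>1|\<psi>\<rangle>\<close> becomes a sum over words in the letters \<open>L\<close>, \<open>R\<close>, \<open>A\<close> with kernels
  \<open>U (L\<^sub>1 \<otimes> 1) U\<^sup>-\<^sup>1\<close>, \<open>U (R\<^sub>1 \<otimes> L\<^sub>2) U\<^sup>-\<^sup>1\<close>, \<open>U (T\<^sub>1 \<otimes> L\<^sub>2) U\<^sup>-\<^sup>1\<close>, in which \<open>\<phi>\<close> is evaluated at the positions
  of the letters \<open>L\<close> and \<open>A\<close>. Splitting off the first letter gives an integral equation for the sum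
  \<open>S\<^sub>N(x)\<close> of all words with \<open>N\<close> letters \<open>L\<close>, \<open>A\<close> on \<open>[x, b]\<close>. For \<open>E = V U\<^sup>-\<^sup>1\<close>, where \<open>V\<close> now belongs to the new
  \<open>Q\<close>, the letters \<open>R\<close> cancel in the derivative of \<open>E S\<^sub>N\<close>, and induction on \<open>N\<close> identifies \<open>E S\<^sub>N\<close> with the
  integral that defines the resulting cMPS.
\<close>

section \<open>Matrix products\<close>

text \<open>The coefficients are merely bounded and measurable, so path-ordered exponentials need
  not be differentiable at a given point. Differential equations are therefore kept as integral
  equations, and the product rule comes from Fubini. The bra is only square integrable: fixing its
  first argument leaves an integrable function for almost every position only. Hence bounds use its
  L1 norm, and identities between integrands hold almost everywhere. The summand
  \<open>R1 \<otimes>\<^sub>K L2\<close> of \<open>Q\<close> is what resums the letters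
  \<open>R\<close>. If \<open>Q = Q0 + R1 \<otimes>\<^sub>K L2\<close>, with \<open>Q0\<close> the
  generator of \<open>U\<close>, then
  \<open>E' = V Q U^-1 - V Q0 U^-1 = V (R1 \<otimes>\<^sub>K L2) U^-1\<close>, which is
  \<open>E\<close> times the kernel of \<open>R\<close>. In the same way \<open>E\<close> carries
  the sum of the kernels of \<open>L\<close> and \<open>A\<close> to the new \<open>L\<close>,
  conjugated by \<open>V\<close>. For a fixed number N of bra particles the number m of ket
  particles is unbounded. Only finitely many words belong to each pair (N, m), but the series over m
  has to be shown to converge and to commute with integration; weights that are exponential in the
  position and geometric in m do both.\<close>

lemma bounded_bilinear_matrix_mult:
  "bounded_bilinear ((**) :: complex^'n^'m \<Rightarrow> complex^'p^'n \<Rightarrow> complex^'p^'m)"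
proof -
  have "bilinear ((**) :: complex^'n^'m \<Rightarrow> complex^'p^'n \<Rightarrow> complex^'p^'m)"
    unfolding bilinear_def
    by (auto intro!: linearI simp: matrix_add_ldistrib vec_eq_iff matrix_matrix_mult_def
        scaleR_sum_right sum.distrib algebra_simps)
  then show ?thesis
    by (simp add: bilinear_conv_bounded_bilinear)
qed

lemma bounded_bilinear_kron:
  "bounded_bilinear (kron :: complex^'m^'m \<Rightarrow> complex^'n^'n \<Rightarrow> complex^('m \<times> 'n)^('m \<times> 'n))"
proof -
  have "bilinear (kron :: complex^'m^'m \<Rightarrow> complex^'n^'n \<Rightarrow> complex^('m \<times> 'n)^('m \<times> 'n))"
    unfolding bilinear_def
    by (auto intro!: linearI simp: vec_eq_iff kron_def algebra_simps)
  then show ?thesis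
    by (simp add: bilinear_conv_bounded_bilinear)
qed

lemma bounded_linear_transpose: "bounded_linear (transpose :: complex^'n^'m \<Rightarrow> complex^'m^'n)"
  by (auto intro!: linearI simp: vec_eq_iff transpose_def simp flip: linear_conv_bounded_linear)

lemma bounded_linear_trace: "bounded_linear (trace :: complex^'n^'n \<Rightarrow> complex)"
  by (auto intro!: linearI simp: trace_def sum.distrib scaleR_sum_right simp flip: linear_conv_bounded_linear)

interpretation matrix_mult: bounded_bilinear
    "(**) :: complex^'n^'m \<Rightarrow> complex^'p^'n \<Rightarrow> complex^'p^'m"
  by (rule bounded_bilinear_matrix_mult)

interpretation kron: bounded_bilinear
    "kron :: complex^'m^'m \<Rightarrow> complex^'n^'n \<Rightarrow> complex^('m \<times> 'n)^('m \<times> 'n)"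
  by (rule bounded_bilinear_kron)

lemma sum_UNIV_prod: "(\<Sum>k\<in>UNIV. f (fst k) (snd k)) = (\<Sum>i\<in>UNIV. \<Sum>j\<in>UNIV. f i j)"
  by (simp add: sum.cartesian_product case_prod_beta flip: UNIV_Times_UNIV)

lemma kron_mult: "(A \<otimes>\<^sub>K B) ** (C \<otimes>\<^sub>K D) = (A ** C) \<otimes>\<^sub>K (B ** D)"
  by (simp add: vec_eq_iff kron_def matrix_matrix_mult_def sum_product mult_ac
      sum_UNIV_prod [where f = "\<lambda>k l. _ * (_ k * (_ l * _ k l))"] flip: sum_UNIV_prod)

lemma trace_kron: "trace (A \<otimes>\<^sub>K B) = trace A * trace B"
  by (simp add: kron_def trace_def sum_product flip: sum_UNIV_prod)

lemma kron_one: "(mat 1 :: complex^'m^'m) \<otimes>\<^sub>K (mat 1 :: complex^'n^'n) = mat 1"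
  by (auto simp: vec_eq_iff kron_def mat_def prod_eq_iff)

lemma set_integrable_regular:
  assumes "regular_on {a..b} F"
  shows "set_integrable lborel {a..b} F"
proof -
  obtain C where C: "\<And>x. x \<in> {a..b} \<Longrightarrow> norm (F x) \<le> C"
    using assms unfolding regular_on_def bounded_iff by blast
  show ?thesis
    unfolding set_integrable_def
  proof (rule integrableI_bounded_set [where A = "{a..b}" and B = C])
    show "(\<lambda>x. indicator {a..b} x *\<^sub>R F x) \<in> borel_measurable lborel"
      using assms by (simp add: regular_on_def borel_measurable_restrict_space_iff)
  qed (use C in \<open>auto simp: indicator_def emeasure_lborel_Icc_eq\<close>)
qed

lemma set_integrable_subinterval:
  fixes f :: "real \<Rightarrow> 'a::{banach, second_countable_topology}"
  assumes "set_integrable lborel {a..b} f" "a \<le> c" "d \<le> b"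
  shows "set_integrable lborel {c..d} f"
  by (rule set_integrable_subset [OF assms(1)]) (use assms in auto)

section \<open>Primitives and their product rule\<close>

text \<open>Absolute continuity in integral form. It replaces differentiability, which fails on null
  sets when the integrand is only measurable.\<close>

definition primitive_on :: "real \<Rightarrow> real \<Rightarrow> (real \<Rightarrow> 'a::euclidean_space) \<Rightarrow> (real \<Rightarrow> 'a) \<Rightarrow> bool" where
  "primitive_on a b F f \<longleftrightarrow> set_integrable lborel {a..b} f \<and>
     (\<forall>t\<in>{a..b}. F t = F a + (LINT s:{a..t}|lborel. f s))"

lemma integrable_bilinear_product:
  fixes f :: "real \<Rightarrow> 'a::euclidean_space" and g :: "real \<Rightarrow> 'b::euclidean_space"
  assumes h: "bounded_bilinear h" and f: "integrable lborel f" and g: "integrable lborel g"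
  shows "integrable (lborel \<Otimes>\<^sub>M lborel) (\<lambda>(s, r). h (f s) (g r) :: 'c::euclidean_space)"
proof -
  interpret h: bounded_bilinear h by fact
  obtain K where K: "\<And>u v. norm (h u v) \<le> norm u * norm v * K"
    using h.bounded by blast
  note [measurable] = borel_measurable_integrable [OF f] borel_measurable_integrable [OF g]
  have hm [measurable]: "(\<lambda>(s, r). h (f s) (g r)) \<in> borel_measurable (lborel \<Otimes>\<^sub>M lborel)"
    unfolding case_prod_beta
    by (rule borel_measurable_continuous_Pair [where H = h])
       (measurable, intro h.continuous_on continuous_intros)
  have "integrable (lborel \<Otimes>\<^sub>M lborel) (\<lambda>(s, r). norm (f s) * norm (g r) * K)"
  proof (rule lborel_pair.Fubini_integrable)
    have "(\<integral>r. norm (norm (f s) * norm (g r) * K) \<partial>lborel) = norm (f s) * (\<integral>r. norm (g r) * \<bar>K\<bar> \<partial>lborel)" for s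
      by (subst integral_mult_right_zero [symmetric]) (simp add: abs_mult mult_ac)
    then show "integrable lborel (\<lambda>s. \<integral>r. norm (case (s, r) of (s, r) \<Rightarrow> norm (f s) * norm (g r) * K) \<partial>lborel)"
      using f by simp
  qed (use g in auto)
  then show ?thesis
    by (rule Bochner_Integration.integrable_bound) (auto intro!: AE_I2 order_trans [OF K])
qed

text \<open>The left side is the integral of \<open>h (f s) (g r)\<close> over the square with side
  \<open>{a..t}\<close>. Cutting the square along its diagonal and integrating the two triangles in
  opposite orders gives the two terms on the right.\<close>

lemma indefinite_integral_bilinear:
  fixes f :: "real \<Rightarrow> 'a::euclidean_space" and g :: "real \<Rightarrow> 'b::euclidean_space"
  assumes h: "bounded_bilinear (h :: 'a \<Rightarrow> 'b \<Rightarrow> 'c::euclidean_space)"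
    and f: "set_integrable lborel {a..t} f" and g: "set_integrable lborel {a..t} g"
  shows "h (LINT s:{a..t}|lborel. f s) (LINT s:{a..t}|lborel. g s) =
    (LINT s:{a..t}|lborel. h (f s) (LINT r:{a..s}|lborel. g r)) +
    (LINT s:{a..t}|lborel. h (LINT r:{a..s}|lborel. f r) (g s))"
proof -
  interpret h: bounded_bilinear h by fact
  define f' where "f' s = indicator {a..t} s *\<^sub>R f s" for s
  define g' where "g' s = indicator {a..t} s *\<^sub>R g s" for s
  have f': "integrable lborel f'" and g': "integrable lborel g'"
    using f g by (simp_all add: set_integrable_def f'_def [abs_def] g'_def [abs_def])
  have fi: "integrable lborel (\<lambda>r. indicator A r *\<^sub>R f' r)"
    and gi: "integrable lborel (\<lambda>r. indicator A r *\<^sub>R g' r)" if "A \<in> sets borel" for A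
    using that f' g' by (auto intro!: integrable_mult_indicator)
  note [measurable] = borel_measurable_integrable [OF f'] borel_measurable_integrable [OF g']
  define H where "H s r = h (f' s) (g' r)" for s r
  have H: "integrable (lborel \<Otimes>\<^sub>M lborel) (\<lambda>(s, r). H s r)"
    unfolding H_def by (rule integrable_bilinear_product [OF h f' g'])
  have H1: "integrable (lborel \<Otimes>\<^sub>M lborel) (\<lambda>(s, r). indicator {..s} r *\<^sub>R H s r)"
  proof -
    have "{z \<in> space (lborel \<Otimes>\<^sub>M lborel). snd z \<le> fst z} \<in> sets (lborel \<Otimes>\<^sub>M lborel :: (real \<times> real) measure)"
      by measurable
    then have "integrable (lborel \<Otimes>\<^sub>M lborel)
       (\<lambda>z. indicator {z \<in> space (lborel \<Otimes>\<^sub>M lborel). snd z \<le> fst z} z *\<^sub>R (\<lambda>(s, r). H s r) z)"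
      by (rule integrable_mult_indicator [OF _ H])
    moreover have "(\<lambda>z. indicator {z \<in> space (lborel \<Otimes>\<^sub>M lborel). snd z \<le> fst z} z *\<^sub>R (\<lambda>(s, r). H s r) z) =
        (\<lambda>(s, r). indicator {..s} r *\<^sub>R H s r)"
      by (auto simp: fun_eq_iff indicator_def space_pair_measure)
    ultimately show ?thesis
      by simp
  qed
  \<comment> \<open>The two triangles must be disjoint, so this one excludes the diagonal; its
    integrand is the difference of the other two.\<close>
  have H2: "integrable (lborel \<Otimes>\<^sub>M lborel) (\<lambda>(s, r). indicator {..<r} s *\<^sub>R H s r)"
  proof -
    have "(\<lambda>z. (\<lambda>(s, r). H s r) z - (\<lambda>(s, r). indicator {..s} r *\<^sub>R H s r) z) = (\<lambda>(s, r). indicator {..<r} s *\<^sub>R H s r)"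
      by (auto simp: fun_eq_iff indicator_def)
    then show ?thesis
      using Bochner_Integration.integrable_diff [OF H H1] by simp
  qed
  have "h (LINT s:{a..t}|lborel. f s) (LINT s:{a..t}|lborel. g s) = (\<integral>s. \<integral>r. H s r \<partial>lborel \<partial>lborel)"
  proof -
    have "h (LINT s:{a..t}|lborel. f s) (LINT s:{a..t}|lborel. g s) = h (integral\<^sup>L lborel f') (integral\<^sup>L lborel g')"
      by (simp add: set_lebesgue_integral_def f'_def [abs_def] g'_def [abs_def])
    also have "\<dots> = (\<integral>s. h (f' s) (integral\<^sup>L lborel g') \<partial>lborel)"
      by (rule integral_bounded_linear [OF h.bounded_linear_left f', symmetric])
    also have "\<dots> = (\<integral>s. \<integral>r. H s r \<partial>lborel \<partial>lborel)"
      unfolding H_def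
      by (intro Bochner_Integration.integral_cong refl integral_bounded_linear [OF h.bounded_linear_right g', symmetric])
    finally show ?thesis .
  qed
  also have "\<dots> = (\<integral>(s, r). H s r \<partial>(lborel \<Otimes>\<^sub>M lborel))"
    by (rule lborel_pair.integral_fst [OF H])
  also have "\<dots> = (\<integral>(s, r). indicator {..s} r *\<^sub>R H s r \<partial>(lborel \<Otimes>\<^sub>M lborel)) +
      (\<integral>(s, r). indicator {..<r} s *\<^sub>R H s r \<partial>(lborel \<Otimes>\<^sub>M lborel))"
    by (subst Bochner_Integration.integral_add [OF H1 H2, symmetric])
       (auto intro!: Bochner_Integration.integral_cong simp: indicator_def)
  also have "(\<integral>(s, r). indicator {..s} r *\<^sub>R H s r \<partial>(lborel \<Otimes>\<^sub>M lborel)) =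
      (\<integral>s. \<integral>r. indicator {..s} r *\<^sub>R H s r \<partial>lborel \<partial>lborel)"
    by (rule lborel_pair.integral_fst [OF H1, symmetric])
  also have "\<dots> = (LINT s:{a..t}|lborel. h (f s) (LINT r:{a..s}|lborel. g r))"
    unfolding set_lebesgue_integral_def
  proof (intro Bochner_Integration.integral_cong refl)
    fix s
    have "(\<integral>r. indicator {..s} r *\<^sub>R H s r \<partial>lborel) = (\<integral>r. h (f' s) (indicator {..s} r *\<^sub>R g' r) \<partial>lborel)"
      by (simp add: H_def h.scaleR_right)
    also have "\<dots> = h (f' s) (\<integral>r. indicator {..s} r *\<^sub>R g' r \<partial>lborel)"
      using gi [of "{..s}"] by (intro integral_bounded_linear [OF h.bounded_linear_right]) auto
    also have "\<dots> = indicator {a..t} s *\<^sub>R h (f s) (\<integral>r. indicator {a..s} r *\<^sub>R g r \<partial>lborel)"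
    proof (cases "s \<in> {a..t}")
      case True
      then have "(\<integral>r. indicator {..s} r *\<^sub>R g' r \<partial>lborel) = (\<integral>r. indicator {a..s} r *\<^sub>R g r \<partial>lborel)"
        by (intro Bochner_Integration.integral_cong) (auto simp: g'_def indicator_def)
      with True show ?thesis by (simp add: f'_def)
    qed (simp add: f'_def h.zero_left)
    finally show "(\<integral>r. indicator {..s} r *\<^sub>R H s r \<partial>lborel) =
      indicator {a..t} s *\<^sub>R h (f s) (\<integral>r. indicator {a..s} r *\<^sub>R g r \<partial>lborel)" .
  qed
  also have "(\<integral>(s, r). indicator {..<r} s *\<^sub>R H s r \<partial>(lborel \<Otimes>\<^sub>M lborel)) =
      (\<integral>r. \<integral>s. indicator {..<r} s *\<^sub>R H s r \<partial>lborel \<partial>lborel)"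
    by (rule lborel_pair.integral_snd [OF H2, symmetric])
  also have "\<dots> = (LINT s:{a..t}|lborel. h (LINT r:{a..s}|lborel. f r) (g s))"
    unfolding set_lebesgue_integral_def
  proof (intro Bochner_Integration.integral_cong refl)
    fix r
    have "(\<integral>s. indicator {..<r} s *\<^sub>R H s r \<partial>lborel) = (\<integral>s. h (indicator {..<r} s *\<^sub>R f' s) (g' r) \<partial>lborel)"
      by (simp add: H_def h.scaleR_left)
    also have "\<dots> = h (\<integral>s. indicator {..<r} s *\<^sub>R f' s \<partial>lborel) (g' r)"
      using fi [of "{..<r}"] by (intro integral_bounded_linear [OF h.bounded_linear_left]) auto
    also have "\<dots> = indicator {a..t} r *\<^sub>R h (\<integral>s. indicator {a..r} s *\<^sub>R f s \<partial>lborel) (g r)"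
    proof (cases "r \<in> {a..t}")
      case True
      have eq: "(\<lambda>s. indicator {..r} s *\<^sub>R f' s) = (\<lambda>s. indicator {a..r} s *\<^sub>R f s)"
        using True by (auto simp: f'_def indicator_def)
      \<comment> \<open>For fixed r the diagonal is a single point, so it can be put back to obtain
        the integral over \<open>{a..r}\<close>.\<close>
      have "(\<integral>s. indicator {..<r} s *\<^sub>R f' s \<partial>lborel) = (\<integral>s. indicator {..r} s *\<^sub>R f' s \<partial>lborel)"
        by (rule integral_cong_AE)
           (auto intro!: eventually_mono [OF AE_lborel_singleton [of r]] simp: indicator_def)
      also have "\<dots> = (\<integral>s. indicator {a..r} s *\<^sub>R f s \<partial>lborel)"
        by (simp only: eq)
      finally show ?thesis using True by (simp add: g'_def)
    qed (simp add: g'_def h.zero_right)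
    finally show "(\<integral>s. indicator {..<r} s *\<^sub>R H s r \<partial>lborel) =
      indicator {a..t} r *\<^sub>R h (\<integral>s. indicator {a..r} s *\<^sub>R f s \<partial>lborel) (g r)" .
  qed
  finally show ?thesis .
qed

lemma continuous_on_indefinite_integral:
  fixes f :: "real \<Rightarrow> 'a::euclidean_space"
  assumes "set_integrable lborel {a..b} f"
  shows "continuous_on {a..b} (\<lambda>t. LINT s:{a..t}|lborel. f s)"
proof -
  have "set_integrable lborel {a..t} f" if "t \<in> {a..b}" for t
    using that by (intro set_integrable_subset [OF assms]) auto
  then have "(LINT s:{a..t}|lborel. f s) = integral {a..t} f" if "t \<in> {a..b}" for t
    using that by (intro set_borel_integral_eq_integral) auto
  moreover have "continuous_on {a..b} (\<lambda>t. integral {a..t} f)"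
    by (intro indefinite_integral_continuous_1 set_borel_integral_eq_integral assms)
  ultimately show ?thesis
    by (subst continuous_on_cong [OF refl, where g = "\<lambda>t. integral {a..t} f"]) auto
qed

lemma set_integrable_bilinear_regular:
  fixes f :: "real \<Rightarrow> 'a::euclidean_space" and G :: "real \<Rightarrow> 'b::euclidean_space"
  assumes h: "bounded_bilinear (h :: 'a \<Rightarrow> 'b \<Rightarrow> 'c::euclidean_space)"
    and f: "set_integrable lborel {a..b} f"
    and G: "G \<in> borel_measurable (restrict_space borel {a..b})" "bounded (G ` {a..b})"
  shows "set_integrable lborel {a..b} (\<lambda>t. h (f t) (G t))"
proof -
  interpret h: bounded_bilinear h by fact
  obtain K where K: "K \<ge> 0" "\<And>u v. norm (h u v) \<le> norm u * norm v * K"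
    using h.nonneg_bounded by blast
  obtain C where C: "\<And>x. x \<in> {a..b} \<Longrightarrow> norm (G x) \<le> C"
    using G(2) unfolding bounded_iff by blast
  define f' where "f' s = indicator {a..b} s *\<^sub>R f s" for s
  define G' where "G' s = indicator {a..b} s *\<^sub>R G s" for s
  have f': "integrable lborel f'"
    using f by (simp add: set_integrable_def f'_def [abs_def])
  have [measurable]: "G' \<in> borel_measurable lborel"
    using G by (simp add: borel_measurable_restrict_space_iff G'_def [abs_def])
  note [measurable] = borel_measurable_integrable [OF f']
  have "integrable lborel (\<lambda>s. h (f' s) (G' s))"
  proof (rule Bochner_Integration.integrable_bound)
    show "integrable lborel (\<lambda>s. norm (f' s) * (\<bar>C\<bar> * K))"
      using f' by (intro integrable_mult_left integrable_norm)
    show "(\<lambda>s. h (f' s) (G' s)) \<in> borel_measurable lborel"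
      by (rule borel_measurable_continuous_Pair [where H = h])
         (measurable, intro h.continuous_on continuous_intros)
    have "norm (h (f' s) (G' s)) \<le> norm (f' s) * (\<bar>C\<bar> * K)" for s
    proof -
      have "norm (G' s) \<le> \<bar>C\<bar>"
        using C [of s] by (auto simp: G'_def indicator_def)
      then have "norm (f' s) * norm (G' s) * K \<le> norm (f' s) * \<bar>C\<bar> * K"
        using K by (intro mult_right_mono mult_left_mono) auto
      then show ?thesis using K(2) [of "f' s" "G' s"] by (simp add: mult.assoc)
    qed
    then show "AE s in lborel. norm (h (f' s) (G' s)) \<le> norm (norm (f' s) * (\<bar>C\<bar> * K))"
      using K by (auto simp: abs_mult)
  qed
  moreover have "(\<lambda>s. h (f' s) (G' s)) = (\<lambda>s. indicator {a..b} s *\<^sub>R h (f s) (G s))"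
    by (auto simp: fun_eq_iff f'_def G'_def indicator_def h.zero_left)
  ultimately show ?thesis
    by (simp add: set_integrable_def)
qed

lemma regular_continuous_on:
  fixes G :: "real \<Rightarrow> 'b::euclidean_space"
  assumes "continuous_on {a..b} G"
  shows "G \<in> borel_measurable (restrict_space borel {a..b})" "bounded (G ` {a..b})"
  using assms
  by (auto intro: borel_measurable_continuous_on_restrict compact_imp_bounded compact_continuous_image)

lemma primitive_on_integrable: "primitive_on a b F f \<Longrightarrow> set_integrable lborel {a..b} f"
  unfolding primitive_on_def by (rule conjunct1)

lemma primitive_on_eq: "primitive_on a b F f \<Longrightarrow> t \<in> {a..b} \<Longrightarrow> F t = F a + (LINT s:{a..t}|lborel. f s)"
  unfolding primitive_on_def by (erule conjE, erule bspec)

lemma primitive_onI: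
  assumes "set_integrable lborel {a..b} f"
    and "\<And>t. t \<in> {a..b} \<Longrightarrow> F t = F a + (LINT s:{a..t}|lborel. f s)"
  shows "primitive_on a b F f"
  unfolding primitive_on_def by (intro conjI ballI assms)

lemma primitive_on_continuous:
  assumes "primitive_on a b F f"
  shows "continuous_on {a..b} F"
proof -
  have "continuous_on {a..b} (\<lambda>t. F a + (LINT s:{a..t}|lborel. f s))"
    by (intro continuous_on_add continuous_on_const continuous_on_indefinite_integral
        primitive_on_integrable [OF assms])
  then show ?thesis
    by (rule continuous_on_cong [OF refl primitive_on_eq [OF assms], THEN iffD2, rotated])
qed

lemma primitive_on_cong:
  assumes F: "primitive_on a b F f"
    and eq: "\<And>t. t \<in> {a..b} \<Longrightarrow> F t = F' t" "\<And>t. t \<in> {a..b} \<Longrightarrow> f t = f' t"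
  shows "primitive_on a b F' f'"
proof (rule primitive_onI)
  show "set_integrable lborel {a..b} f'"
    by (rule set_integrable_cong [OF refl refl eq(2), THEN iffD1, OF _ primitive_on_integrable [OF F]])
  fix t assume t: "t \<in> {a..b}"
  have "(LINT s:{a..t}|lborel. f s) = (LINT s:{a..t}|lborel. f' s)"
    using t eq(2) by (intro set_lebesgue_integral_cong) auto
  moreover have "F t = F' t" "F a = F' a"
    by (rule eq(1); use t in simp)+
  ultimately show "F' t = F' a + (LINT s:{a..t}|lborel. f' s)"
    using primitive_on_eq [OF F t] by (simp only:)
qed

lemma primitive_on_linear:
  assumes h: "bounded_linear h" and F: "primitive_on a b F f"
  shows "primitive_on a b (\<lambda>t. h (F t)) (\<lambda>t. h (f t))"
proof -
  interpret h: bounded_linear h by fact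
  have f: "set_integrable lborel {a..t} f" if "t \<in> {a..b}" for t
    using that by (intro set_integrable_subinterval [OF primitive_on_integrable [OF F]]) auto
  have eq: "(\<lambda>s. indicator A s *\<^sub>R h (f s)) = (\<lambda>s. h (indicator A s *\<^sub>R f s))" for A
    by (simp add: h.scaleR)
  have "(LINT s:{a..t}|lborel. h (f s)) = h (LINT s:{a..t}|lborel. f s)" if "t \<in> {a..b}" for t
    unfolding set_lebesgue_integral_def eq
    using f [OF that] by (intro integral_bounded_linear [OF h]) (simp add: set_integrable_def)
  moreover have "set_integrable lborel {a..b} (\<lambda>t. h (f t))"
    using integrable_bounded_linear [OF h primitive_on_integrable [OF F, unfolded set_integrable_def]]
    unfolding set_integrable_def eq .
  moreover have "h (F t) = h (F a) + h (LINT s:{a..t}|lborel. f s)" if "t \<in> {a..b}" for t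
    by (subst primitive_on_eq [OF F that]) (rule h.add)
  ultimately show ?thesis
    by (intro primitive_onI) (simp_all only:)
qed

text \<open>Product rule. Writing both factors as initial value plus indefinite integral leaves four
  products; those with a constant are linear, and the remaining one is
  \<open>indefinite_integral_bilinear\<close>.\<close>

lemma primitive_on_bilinear:
  fixes F f :: "real \<Rightarrow> 'a::euclidean_space" and G g :: "real \<Rightarrow> 'b::euclidean_space"
  assumes h: "bounded_bilinear (h :: 'a \<Rightarrow> 'b \<Rightarrow> 'c::euclidean_space)"
    and F: "primitive_on a b F f" and G: "primitive_on a b G g"
  shows "primitive_on a b (\<lambda>t. h (F t) (G t)) (\<lambda>t. h (f t) (G t) + h (F t) (g t))"
proof -
  interpret h: bounded_bilinear h by fact
  have fi: "set_integrable lborel {a..b} f" and gi: "set_integrable lborel {a..b} g"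
    by (rule primitive_on_integrable [OF F], rule primitive_on_integrable [OF G])
  define Fa where "Fa = F a"
  define Ga where "Ga = G a"
  define If where "If t = (LINT s:{a..t}|lborel. f s)" for t
  define Ig where "Ig t = (LINT s:{a..t}|lborel. g s)" for t
  have cont: "continuous_on {a..b} F" "continuous_on {a..b} G" "continuous_on {a..b} If" "continuous_on {a..b} Ig"
    using primitive_on_continuous [OF F] primitive_on_continuous [OF G]
      continuous_on_indefinite_integral [OF fi] continuous_on_indefinite_integral [OF gi]
    by (simp_all add: If_def [abs_def] Ig_def [abs_def])
  have i1: "set_integrable lborel {a..b} (\<lambda>t. h (f t) (H t))" if "continuous_on {a..b} H" for H
    by (rule set_integrable_bilinear_regular [OF h fi]) (use regular_continuous_on [OF that] in auto)
  have i2: "set_integrable lborel {a..b} (\<lambda>t. h (H t) (g t))" if "continuous_on {a..b} H" for H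
    by (rule set_integrable_bilinear_regular [OF h.flip gi]) (use regular_continuous_on [OF that] in auto)
  show ?thesis
  proof (rule primitive_onI)
    show "set_integrable lborel {a..b} (\<lambda>t. h (f t) (G t) + h (F t) (g t))"
      using i1 i2 cont by (intro set_integral_add) auto
    fix t assume t: "t \<in> {a..b}"
    have t': "a \<le> a" "t \<le> b"
      using t by auto
    note sub = set_integrable_subinterval [OF _ t']
    have lin: "(LINT s:{a..t}|lborel. h (f s) c) = h (If t) c" "(LINT s:{a..t}|lborel. h d (g s)) = h d (Ig t)" for c d
    proof -
      show "(LINT s:{a..t}|lborel. h (f s) c) = h (If t) c"
        using integral_bounded_linear [OF h.bounded_linear_left [of c] sub [OF fi, unfolded set_integrable_def]]
        by (simp add: set_lebesgue_integral_def If_def h.scaleR_left)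
      show "(LINT s:{a..t}|lborel. h d (g s)) = h d (Ig t)"
        using integral_bounded_linear [OF h.bounded_linear_right [of d] sub [OF gi, unfolded set_integrable_def]]
        by (simp add: set_lebesgue_integral_def Ig_def h.scaleR_right)
    qed
    have Gs: "G s = Ga + Ig s" and Fs: "F s = Fa + If s" if "s \<in> {a..b}" for s
      using primitive_on_eq [OF F that] primitive_on_eq [OF G that] by (simp_all only: Ig_def If_def Fa_def Ga_def)
    have "(LINT s:{a..t}|lborel. h (f s) (G s) + h (F s) (g s)) =
      (LINT s:{a..t}|lborel. (h (f s) Ga + h (f s) (Ig s)) + (h Fa (g s) + h (If s) (g s)))"
      using t by (intro set_lebesgue_integral_cong) (auto simp: Gs Fs h.add_left h.add_right)
    also have "\<dots> = (h (If t) Ga + (LINT s:{a..t}|lborel. h (f s) (Ig s))) +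
        (h Fa (Ig t) + (LINT s:{a..t}|lborel. h (If s) (g s)))"
      by (simp only: set_integral_add(2) [OF set_integral_add(1) set_integral_add(1)] set_integral_add(2)
          sub [OF i1 [OF cont(4)]] sub [OF i2 [OF cont(3)]] sub [OF i1 [OF continuous_on_const]]
          sub [OF i2 [OF continuous_on_const]] lin)
    also have "\<dots> = h (If t) Ga + h Fa (Ig t) + h (If t) (Ig t)"
      using indefinite_integral_bilinear [OF h sub [OF fi] sub [OF gi]] by (simp add: If_def Ig_def)
    finally show "h (F t) (G t) = h (F a) (G a) + (LINT s:{a..t}|lborel. h (f s) (G s) + h (F s) (g s))"
      unfolding Fa_def [symmetric] Ga_def [symmetric] Fs [OF t] Gs [OF t]
      by (simp add: h.add_left h.add_right)
  qed
qed

section \<open>Path-ordered exponentials\<close>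

lemma set_integral_singleton:
  fixes f :: "real \<Rightarrow> 'a::{banach, second_countable_topology}"
  shows "(LINT s:{x..x}|lborel. f s) = 0"
  unfolding set_lebesgue_integral_def
  by (rule integral_eq_zero_AE, rule eventually_mono [OF AE_lborel_singleton [of x]]) (simp add: indicator_def)

lemma set_integral_split:
  fixes f :: "real \<Rightarrow> 'a::{banach, second_countable_topology}"
  assumes "set_integrable lborel {a..t} f" "a \<le> x" "x \<le> t"
  shows "(LINT s:{a..t}|lborel. f s) = (LINT s:{a..x}|lborel. f s) + (LINT s:{x..t}|lborel. f s)"
proof -
  have "{a..t} = {a..x} \<union> {x..t}"
    using assms by auto
  moreover have "(LINT s:{a..x} \<union> {x..t}|lborel. f s) = (LINT s:{a..x}|lborel. f s) + (LINT s:{x..t}|lborel. f s)"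
  proof (rule set_integral_Un_AE)
    show "AE s in lborel. \<not> (s \<in> {a..x} \<and> s \<in> {x..t})"
      by (rule eventually_mono [OF AE_lborel_singleton [of x]]) auto
  qed (use assms in \<open>auto intro!: set_integrable_subinterval [OF assms(1)]\<close>)
  ultimately show ?thesis by simp
qed

lemma primitive_on_subinterval:
  assumes F: "primitive_on a b F f" and "a \<le> x" "x \<le> b"
  shows "primitive_on x b F f"
proof (rule primitive_onI)
  have f: "set_integrable lborel {a..b} f"
    by (rule primitive_on_integrable [OF F])
  then show "set_integrable lborel {x..b} f"
    using assms by (intro set_integrable_subinterval [OF f]) auto
  fix t assume t: "t \<in> {x..b}"
  have "set_integrable lborel {a..t} f"
    using t by (intro set_integrable_subinterval [OF f]) auto
  then have "(LINT s:{a..t}|lborel. f s) = (LINT s:{a..x}|lborel. f s) + (LINT s:{x..t}|lborel. f s)"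
    using t assms by (intro set_integral_split) auto
  moreover have "F t = F a + (LINT s:{a..t}|lborel. f s)" "F x = F a + (LINT s:{a..x}|lborel. f s)"
    by (rule primitive_on_eq [OF F]; use t assms in simp)+
  ultimately show "F t = F x + (LINT s:{x..t}|lborel. f s)"
    by (simp only: add.assoc)
qed

lemma primitive_on_zero:
  assumes "primitive_on a b F f" "\<And>t. t \<in> {a..b} \<Longrightarrow> f t = 0" "t \<in> {a..b}"
  shows "F t = F a"
proof -
  have "(LINT s:{a..t}|lborel. f s) = (LINT s:{a..t}|lborel. 0)"
    using assms by (intro set_lebesgue_integral_cong) auto
  then show ?thesis
    using primitive_on_eq [OF assms(1,3)] by (simp add: set_lebesgue_integral_def)
qed

text \<open>The constant is made positive by adding 1, so that it can serve as the rate of an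
  exponential weight whose integral divides by it.\<close>

lemma regular_on_matrix_bound:
  fixes F :: "real \<Rightarrow> complex^'d^'d"
  assumes "regular_on {a..b} F"
  obtains C where "C > 0"
    "\<And>x M :: complex^'d^'d. x \<in> {a..b} \<Longrightarrow> norm (F x ** M) \<le> C * norm M"
    "\<And>x M :: complex^'d^'d. x \<in> {a..b} \<Longrightarrow> norm (M ** F x) \<le> C * norm M"
proof -
  obtain c where c: "\<And>x. x \<in> {a..b} \<Longrightarrow> norm (F x) \<le> c"
    using assms unfolding regular_on_def bounded_iff by blast
  obtain K where K: "K \<ge> 0" "\<And>(M :: complex^'d^'d) (N :: complex^'d^'d). norm (M ** N) \<le> norm M * norm N * K"
    using bounded_bilinear.nonneg_bounded [OF bounded_bilinear_matrix_mult [where 'm = 'd and 'n = 'd and 'p = 'd]]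
    by metis
  have *: "norm (F x) * norm M * K \<le> (\<bar>c\<bar> * K + 1) * norm M"
    if "x \<in> {a..b}" for x and M :: "complex^'d^'d"
  proof -
    have "norm (F x) * (norm M * K) \<le> \<bar>c\<bar> * (norm M * K)"
      using c [OF that] K by (intro mult_right_mono) auto
    then show ?thesis
      by (simp add: ring_distribs mult_ac add_increasing2)
  qed
  show thesis
  proof
    show "\<bar>c\<bar> * K + 1 > 0"
      using K by (simp add: add_nonneg_pos)
    fix x and M :: "complex^'d^'d" assume "x \<in> {a..b}"
    then show "norm (F x ** M) \<le> (\<bar>c\<bar> * K + 1) * norm M" "norm (M ** F x) \<le> (\<bar>c\<bar> * K + 1) * norm M"
      using K(2) [of "F x" M] K(2) [of M "F x"] * [of x M] by (simp_all add: mult.commute [of "norm M"])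
  qed
qed

lemma regular_on_subinterval:
  assumes "regular_on {a..b} F" "a \<le> x"
  shows "regular_on {x..b} F"
proof -
  have sub: "{x..b} \<subseteq> {a..b}"
    using assms(2) by auto
  show ?thesis
    using assms(1) measurable_restrict_mono [OF _ sub] bounded_subset [OF _ image_mono [OF sub]]
    unfolding regular_on_def by blast
qed

lemma regular_on_continuous: "continuous_on {a..b} F \<Longrightarrow> regular_on {a..b} F"
  using regular_continuous_on [of a b F] by (simp add: regular_on_def)

section \<open>Exponential weights and convergence of the Dyson series\<close>

lemma set_integral_exp_forward:
  fixes x y k c :: real
  assumes "x \<le> y" "k \<noteq> 0"
  shows "set_integrable lborel {x..y} (\<lambda>z. c * exp (k * (z - x)))"
    and "(LINT z:{x..y}|lborel. c * exp (k * (z - x))) = c / k * (exp (k * (y - x)) - 1)"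
proof -
  have cont: "continuous_on {x..y} (\<lambda>z. c * exp (k * (z - x)))"
    by (intro continuous_intros)
  then show "set_integrable lborel {x..y} (\<lambda>z. c * exp (k * (z - x)))"
    unfolding set_integrable_def by (intro borel_integrable_compact compact_Icc)
  have "((\<lambda>z. c / k * exp (k * (z - x))) has_vector_derivative c * exp (k * (t - x))) (at t within {x..y})" for t
    unfolding has_real_derivative_iff_has_vector_derivative [symmetric]
    using \<open>k \<noteq> 0\<close> by (auto intro!: derivative_eq_intros)
  from integral_FTC_atLeastAtMost [OF \<open>x \<le> y\<close> this cont]
  show "(LINT z:{x..y}|lborel. c * exp (k * (z - x))) = c / k * (exp (k * (y - x)) - 1)"
    by (simp add: set_lebesgue_integral_def algebra_simps)
qed

lemma set_integral_exp_backward: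
  fixes x y k c :: real
  assumes "x \<le> y" "k \<noteq> 0"
  shows "set_integrable lborel {x..y} (\<lambda>z. c * exp (k * (y - z)))"
    and "(LINT z:{x..y}|lborel. c * exp (k * (y - z))) = c / k * (exp (k * (y - x)) - 1)"
proof -
  have cont: "continuous_on {x..y} (\<lambda>z. c * exp (k * (y - z)))"
    by (intro continuous_intros)
  then show "set_integrable lborel {x..y} (\<lambda>z. c * exp (k * (y - z)))"
    unfolding set_integrable_def by (intro borel_integrable_compact compact_Icc)
  have "((\<lambda>z. - c / k * exp (k * (y - z))) has_vector_derivative c * exp (k * (y - t))) (at t within {x..y})" for t
    unfolding has_real_derivative_iff_has_vector_derivative [symmetric]
    using \<open>k \<noteq> 0\<close> by (auto intro!: derivative_eq_intros)
  from integral_FTC_atLeastAtMost [OF \<open>x \<le> y\<close> this cont]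
  show "(LINT z:{x..y}|lborel. c * exp (k * (y - z))) = c / k * (exp (k * (y - x)) - 1)"
    by (simp add: set_lebesgue_integral_def algebra_simps)
qed

lemma set_integrable_mult_regular:
  assumes "regular_on {a..b} Q" "continuous_on {a..b} F"
  shows "set_integrable lborel {a..b} (\<lambda>z. F z ** Q z)"
    and "set_integrable lborel {a..b} (\<lambda>z. Q z ** F z)"
  using set_integrable_bilinear_regular
      [OF matrix_mult.flip set_integrable_regular [OF assms(1)] regular_continuous_on [OF assms(2)]]
    set_integrable_bilinear_regular
      [OF matrix_mult.bounded_bilinear_axioms set_integrable_regular [OF assms(1)] regular_continuous_on [OF assms(2)]]
  by simp_all

lemma dyson_term_continuous:
  assumes "regular_on {x..b} Q"
  shows "continuous_on {x..b} (dyson_term Q x n)"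
proof (induction n)
  case (Suc n)
  then show ?case
    using continuous_on_indefinite_integral [OF set_integrable_mult_regular(1) [OF assms Suc]] by simp
qed simp

text \<open>One further integration costs a factor C, while integrating
  \<open>exp (2 * C * (z - x))\<close> gains 1 / (2 C). With this weight each order is half the
  previous one, and geometric decay takes the place of factorials.\<close>

lemma dyson_term_bound:
  fixes Q :: "real \<Rightarrow> complex^'d^'d"
  assumes Q: "regular_on {x..b} Q" and "C > 0"
    and C: "\<And>z M :: complex^'d^'d. z \<in> {x..b} \<Longrightarrow> norm (M ** Q z) \<le> C * norm M"
    and "y \<in> {x..b}"
  shows "norm (dyson_term Q x n y) \<le> norm (mat 1 :: complex^'d^'d) * (1/2)^n * exp (2 * C * (y - x))"
  using \<open>y \<in> {x..b}\<close>
proof (induction n arbitrary: y)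
  case 0
  have "1 \<le> exp (2 * C * (y - x))"
    using 0 \<open>C > 0\<close> by simp
  then have "norm (mat 1 :: complex^'d^'d) * 1 \<le> norm (mat 1 :: complex^'d^'d) * exp (2 * C * (y - x))"
    by (intro mult_left_mono) auto
  then show ?case by simp
next
  case (Suc n)
  let ?m = "norm (mat 1 :: complex^'d^'d)"
  have int: "set_integrable lborel {x..y} (\<lambda>z. dyson_term Q x n z ** Q z)"
    using Suc.prems by (intro set_integrable_subinterval [OF set_integrable_mult_regular(1) [OF Q dyson_term_continuous [OF Q]]]) auto
  have "norm (dyson_term Q x (Suc n) y) \<le> (LINT z:{x..y}|lborel. norm (dyson_term Q x n z ** Q z))"
    using set_integral_norm_bound [OF int] by simp
  also have "\<dots> \<le> (LINT z:{x..y}|lborel. C * (?m * (1/2)^n) * exp (2 * C * (z - x)))"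
  proof (rule set_integral_mono)
    show "set_integrable lborel {x..y} (\<lambda>z. C * (?m * (1/2)^n) * exp (2 * C * (z - x)))"
      using Suc.prems \<open>C > 0\<close> by (intro set_integral_exp_forward) auto
    fix z assume z: "z \<in> {x..y}"
    then have "norm (dyson_term Q x n z ** Q z) \<le> C * norm (dyson_term Q x n z)"
      using Suc.prems by (intro C) auto
    also have "\<dots> \<le> C * (?m * (1/2)^n * exp (2 * C * (z - x)))"
      using z Suc.prems \<open>C > 0\<close> by (intro mult_left_mono Suc.IH) auto
    finally show "norm (dyson_term Q x n z ** Q z) \<le> C * (?m * (1/2)^n) * exp (2 * C * (z - x))"
      by (simp add: mult_ac)
  qed (rule set_integrable_norm [OF int])
  also have "\<dots> = ?m * (1/2)^Suc n * (exp (2 * C * (y - x)) - 1)"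
    using Suc.prems \<open>C > 0\<close> by (subst set_integral_exp_forward) auto
  also have "\<dots> \<le> ?m * (1/2)^Suc n * exp (2 * C * (y - x))"
    by (intro mult_left_mono) auto
  finally show ?case .
qed

lemma path_exp_primitive:
  assumes Q: "regular_on {x..b} (Q :: real \<Rightarrow> complex^'d^'d)"
  shows "primitive_on x b (path_exp Q x) (\<lambda>z. path_exp Q x z ** Q z)" and "path_exp Q x x = mat 1"
proof -
  obtain C where C: "C > 0" "\<And>z M :: complex^'d^'d. z \<in> {x..b} \<Longrightarrow> norm (M ** Q z) \<le> C * norm M"
    using regular_on_matrix_bound [OF Q] by metis
  define K where "K = norm (mat 1 :: complex^'d^'d) * exp (2 * C * (b - x))"
  have "K \<ge> 0" by (simp add: K_def)
  have bound: "norm (dyson_term Q x n y) \<le> K * (1/2)^n" if "y \<in> {x..b}" for n y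
  proof -
    have "exp (2 * C * (y - x)) \<le> exp (2 * C * (b - x))"
      using that C(1) by auto
    then have "norm (mat 1 :: complex^'d^'d) * (1/2)^n * exp (2 * C * (y - x)) \<le> norm (mat 1 :: complex^'d^'d) * (1/2)^n * exp (2 * C * (b - x))"
      by (intro mult_left_mono) auto
    then show ?thesis
      using dyson_term_bound [OF Q C that, of n] by (simp add: K_def mult_ac)
  qed
  have summ: "summable (\<lambda>n. norm (dyson_term Q x n y))" if "y \<in> {x..b}" for y
  proof (rule summable_comparison_test' [of "\<lambda>n. K * (1/2)^n" 0])
    show "summable (\<lambda>n. K * (1/2)^n)"
      by (intro summable_mult summable_geometric) simp
  qed (use bound [OF that] in simp)
  have sums: "(\<lambda>n. dyson_term Q x n y) sums path_exp Q x y" if "y \<in> {x..b}" for y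
    unfolding path_exp_def by (rule summable_sums [OF summable_norm_cancel [OF summ [OF that]]])
  \<comment> \<open>The geometric bound is uniform on the interval, so the sum over the orders may
    be exchanged with the integral; the recursion of the Dyson terms then becomes V = 1 +
    \<integral> V Q.\<close>
  have key: "set_integrable lborel {x..y} (\<lambda>z. path_exp Q x z ** Q z) \<and>
    (\<lambda>n. dyson_term Q x (Suc n) y) sums (LINT z:{x..y}|lborel. path_exp Q x z ** Q z)" if y: "y \<in> {x..b}" for y
  proof -
    define f where "f n z = indicator {x..y} z *\<^sub>R (dyson_term Q x n z ** Q z)" for n z
    have nb: "norm (f n z) \<le> indicator {x..y} z *\<^sub>R (C * K * (1/2)^n)" for n z
    proof (cases "z \<in> {x..y}")
      case True
      then have z: "z \<in> {x..b}" using y by auto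
      have "norm (dyson_term Q x n z ** Q z) \<le> C * norm (dyson_term Q x n z)"
        by (rule C(2) [OF z])
      also have "\<dots> \<le> C * (K * (1/2)^n)"
        using C(1) by (intro mult_left_mono bound z) auto
      finally show ?thesis using True by (simp add: f_def mult_ac)
    qed (simp add: f_def)
    have int: "integrable lborel (f n)" for n
      using y set_integrable_subinterval [OF set_integrable_mult_regular(1) [OF Q dyson_term_continuous [OF Q]], of x y]
      by (simp add: f_def [abs_def] set_integrable_def)
    have s1: "AE z in lborel. summable (\<lambda>n. norm (f n z))"
    proof (rule AE_I2)
      fix z
      show "summable (\<lambda>n. norm (f n z))"
      proof (rule summable_comparison_test' [of "\<lambda>n. indicator {x..y} z *\<^sub>R (C * K * (1/2)^n)" 0])
        show "summable (\<lambda>n. indicator {x..y} z *\<^sub>R (C * K * (1/2)^n))"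
          by (intro summable_scaleR_right summable_mult summable_geometric) simp
      qed (use nb [of _ z] in simp)
    qed
    have s2: "summable (\<lambda>n. \<integral>z. norm (f n z) \<partial>lborel)"
    proof (rule summable_comparison_test' [of "\<lambda>n. (y - x) * (C * K) * (1/2)^n" 0])
      fix n
      have "(\<integral>z. norm (f n z) \<partial>lborel) \<le> (\<integral>z. indicator {x..y} z *\<^sub>R (C * K * (1/2)^n) \<partial>lborel)"
        using int nb by (intro integral_mono) (auto simp: emeasure_lborel_Icc_eq)
      also have "\<dots> = (y - x) * (C * K) * (1/2)^n"
        using y by simp
      finally show "norm (\<integral>z. norm (f n z) \<partial>lborel) \<le> (y - x) * (C * K) * (1/2)^n"
        by simp
    qed (intro summable_mult summable_geometric, simp)
    have eq: "(\<lambda>z. \<Sum>n. f n z) = (\<lambda>z. indicator {x..y} z *\<^sub>R (path_exp Q x z ** Q z))"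
    proof
      fix z
      show "(\<Sum>n. f n z) = indicator {x..y} z *\<^sub>R (path_exp Q x z ** Q z)"
      proof (cases "z \<in> {x..y}")
        case True
        then have "(\<lambda>n. dyson_term Q x n z ** Q z) sums (path_exp Q x z ** Q z)"
          using y by (intro bounded_linear.sums [OF matrix_mult.bounded_linear_left] sums) auto
        then have "(\<Sum>n. dyson_term Q x n z ** Q z) = path_exp Q x z ** Q z"
          by (rule sums_unique [symmetric])
        then show ?thesis
          using True by (simp add: f_def)
      qed (simp add: f_def)
    qed
    have "integrable lborel (\<lambda>z. \<Sum>n. f n z)" "(\<lambda>n. integral\<^sup>L lborel (f n)) sums (\<integral>z. (\<Sum>n. f n z) \<partial>lborel)"
      by (rule integrable_suminf [OF int s1 s2], rule sums_integral [OF int s1 s2])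
    then show ?thesis
      unfolding eq by (simp add: set_integrable_def set_lebesgue_integral_def f_def [abs_def])
  qed
  have eq: "path_exp Q x y = mat 1 + (LINT z:{x..y}|lborel. path_exp Q x z ** Q z)" if y: "y \<in> {x..b}" for y
  proof -
    have "(\<lambda>n. dyson_term Q x n y) sums ((LINT z:{x..y}|lborel. path_exp Q x z ** Q z) + dyson_term Q x 0 y)"
      using key [OF y] by (intro sums_Suc) simp
    then show ?thesis
      using sums_unique2 [OF sums [OF y]] by (simp add: add.commute)
  qed
  have dyx: "dyson_term Q x (Suc n) x = 0" for n
    using set_integral_singleton [of x] by simp
  show one: "path_exp Q x x = mat 1"
    unfolding path_exp_def
    by (subst suminf_finite [of "{0}"]) (auto simp: gr0_conv_Suc dyx simp del: dyson_term.simps(2))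
  show "primitive_on x b (path_exp Q x) (\<lambda>z. path_exp Q x z ** Q z)"
  proof (rule primitive_onI)
    show "set_integrable lborel {x..b} (\<lambda>z. path_exp Q x z ** Q z)"
      using key [of b] by (cases "x \<le> b") (auto simp: set_integrable_def)
  next
    fix t assume "t \<in> {x..b}"
    from eq [OF this] show "path_exp Q x t = path_exp Q x x + (LINT z:{x..t}|lborel. path_exp Q x z ** Q z)"
      unfolding one .
  qed
qed

text \<open>The inverse W of V satisfies W' = - Q W, with Q on the left, whereas
  \<open>dyson_term\<close> multiplies on the right. Transposition turns the equation for W into one
  of the available form, with generator minus the transpose of Q.\<close>

definition path_exp_inv :: "(real \<Rightarrow> complex^'d^'d) \<Rightarrow> real \<Rightarrow> real \<Rightarrow> complex^'d^'d" where
  "path_exp_inv Q a x = transpose (path_exp (\<lambda>z. - transpose (Q z)) a x)"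

lemma regular_on_linear:
  assumes h: "bounded_linear h" and F: "regular_on {a..b} F"
  shows "regular_on {a..b} (\<lambda>x. h (F x))"
proof -
  interpret h: bounded_linear h by fact
  have "h \<in> borel_measurable borel"
    by (intro borel_measurable_continuous_onI h.continuous_on continuous_on_id)
  moreover have "bounded (h ` F ` {a..b})"
    using F by (intro bounded_linear_image [OF _ h]) (simp add: regular_on_def)
  ultimately show ?thesis
    using F by (auto simp: regular_on_def image_image intro: measurable_compose)
qed

lemma path_exp_inv_primitive:
  assumes Q: "regular_on {a..b} Q"
  shows "primitive_on a b (path_exp_inv Q a) (\<lambda>z. - (Q z ** path_exp_inv Q a z))"
    and "path_exp_inv Q a a = mat 1"
proof -
  have Q': "regular_on {a..b} (\<lambda>z. - transpose (Q z))"
    by (rule regular_on_linear [where h = "\<lambda>M. - transpose M", OF bounded_linear_minus [OF bounded_linear_transpose] Q])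
  show "path_exp_inv Q a a = mat 1"
    by (simp add: path_exp_inv_def path_exp_primitive(2) [OF Q'] transpose_mat)
  have tm: "transpose (- M) = - transpose M" for M :: "complex^'d^'d"
    by (simp add: vec_eq_iff transpose_def)
  show "primitive_on a b (path_exp_inv Q a) (\<lambda>z. - (Q z ** path_exp_inv Q a z))"
    using primitive_on_linear [OF bounded_linear_transpose path_exp_primitive(1) [OF Q']]
    by (simp add: path_exp_inv_def [abs_def] matrix_transpose_mul tm matrix_mult.minus_left)
qed

text \<open>As a function of the upper end t, the product has derivative V Q W - V Q W = 0, so it
  keeps its value at t = x. With x = a this gives the inverse; with general x it gives the
  composition law.\<close>

lemma path_exp_inverse:
  assumes Q: "regular_on {a..b} Q" and "a \<le> x" "x \<le> y" "y \<le> b"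
  shows "path_exp Q x y ** path_exp_inv Q a y = path_exp_inv Q a x"
proof -
  have Qx: "regular_on {x..b} Q"
    using assms by (intro regular_on_subinterval [OF Q])
  have "primitive_on x b (\<lambda>t. path_exp Q x t ** path_exp_inv Q a t)
     (\<lambda>t. (path_exp Q x t ** Q t) ** path_exp_inv Q a t + path_exp Q x t ** - (Q t ** path_exp_inv Q a t))"
    using assms
    by (intro primitive_on_bilinear [OF bounded_bilinear_matrix_mult] path_exp_primitive [OF Qx]
        primitive_on_subinterval [OF path_exp_inv_primitive(1) [OF Q]]) auto
  then have "path_exp Q x y ** path_exp_inv Q a y = path_exp Q x x ** path_exp_inv Q a x"
    by (rule primitive_on_zero) (use assms in \<open>auto simp: matrix_mult.minus_right matrix_mul_assoc\<close>)
  then show ?thesis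
    by (simp add: path_exp_primitive(2) [OF Qx])
qed

lemma path_exp_right_inverse:
  assumes "regular_on {a..b} Q" "y \<in> {a..b}"
  shows "path_exp Q a y ** path_exp_inv Q a y = mat 1"
  using path_exp_inverse [OF assms(1), of a y] path_exp_inv_primitive(2) [OF assms(1)] assms(2) by simp

lemma path_exp_left_inverse:
  assumes "regular_on {a..b} Q" "y \<in> {a..b}"
  shows "path_exp_inv Q a y ** path_exp Q a y = mat 1"
  using path_exp_right_inverse [OF assms] by (simp add: matrix_left_right_inverse)

lemma path_exp_factor:
  assumes "regular_on {a..b} Q" and "a \<le> x" "x \<le> y" "y \<le> b"
  shows "path_exp Q x y = path_exp_inv Q a x ** path_exp Q a y"
proof -
  have "path_exp Q x y = path_exp Q x y ** (path_exp_inv Q a y ** path_exp Q a y)"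
    using assms by (simp add: path_exp_left_inverse [OF assms(1)])
  then show ?thesis
    using path_exp_inverse [OF assms] by (simp add: matrix_mul_assoc)
qed

section \<open>Integration over configurations\<close>

abbreviation Icc_measure :: "real \<Rightarrow> real \<Rightarrow> real measure" where
  "Icc_measure a b \<equiv> restrict_space lborel {a..b}"

text \<open>The new coordinate takes index 0 and the others move up by one, because
  \<open>points\<close> lists a configuration from index 0. The restriction to
  \<open>{..<Suc n}\<close> is forced by the extensional functions of a product space.\<close>

definition config_cons :: "nat \<Rightarrow> real \<times> (nat \<Rightarrow> real) \<Rightarrow> nat \<Rightarrow> real" where
  "config_cons n = (\<lambda>(y, x). \<lambda>i\<in>{..<Suc n}. case i of 0 \<Rightarrow> y | Suc j \<Rightarrow> x j)"

lemma points_config_cons: "points (Suc n) (config_cons n z) = fst z # points n (snd z)"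
  unfolding points_def map_upt_Suc by (cases z) (simp add: config_cons_def)

lemma length_points [simp]: "length (points n x) = n"
  by (simp add: points_def)

lemma finite_measure_Icc: "finite_measure (Icc_measure a b)"
  by (rule finite_measureI) (simp add: emeasure_restrict_space space_restrict_space emeasure_lborel_Icc_eq)

lemma finite_measure_config_space: "finite_measure (config_space a b n)"
proof -
  interpret finite_measure "Icc_measure a b"
    by (rule finite_measure_Icc)
  interpret product_sigma_finite "\<lambda>_::nat. Icc_measure a b"
    by (rule product_sigma_finite_interval)
  have "emeasure (config_space a b n) (space (config_space a b n)) = (\<Prod>i<n. emeasure (Icc_measure a b) (space (Icc_measure a b)))"
    unfolding config_space_def space_PiM by (intro emeasure_PiM sets.top finite_lessThan)
  then show ?thesis
    using emeasure_finite by (intro finite_measureI) (auto simp: power_eq_top_ennreal)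
qed

lemma measurable_config_cons:
  "config_cons n \<in> measurable (Icc_measure a b \<Otimes>\<^sub>M config_space a b n) (config_space a b (Suc n))"
  unfolding config_cons_def config_space_def case_prod_beta
proof (intro measurable_restrict)
  fix i assume i: "i \<in> {..<Suc n}"
  show "(\<lambda>z. case i of 0 \<Rightarrow> fst z | Suc j \<Rightarrow> snd z j)
    \<in> measurable (Icc_measure a b \<Otimes>\<^sub>M Pi\<^sub>M {..<n} (\<lambda>_. Icc_measure a b)) (Icc_measure a b)"
  proof (cases i)
    case (Suc j)
    with i have "(\<lambda>x. x j) \<in> measurable (Pi\<^sub>M {..<n} (\<lambda>_. Icc_measure a b)) (Icc_measure a b)"
      by (intro measurable_component_singleton) simp
    then show ?thesis
      unfolding Suc nat.case by (rule measurable_compose [OF measurable_snd])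
  qed simp
qed

text \<open>A product measure is determined by its values on boxes, and the preimage of a box is its
  first side times the box of the remaining sides.\<close>

lemma distr_config_cons:
  "distr (Icc_measure a b \<Otimes>\<^sub>M config_space a b n) (config_space a b (Suc n)) (config_cons n) =
    config_space a b (Suc n)"
proof -
  let ?I = "Icc_measure a b"
  let ?P = "?I \<Otimes>\<^sub>M config_space a b n"
  interpret I: finite_measure ?I
    by (rule finite_measure_Icc)
  interpret C: finite_measure "config_space a b n"
    by (rule finite_measure_config_space)
  interpret product_sigma_finite "\<lambda>_::nat. ?I"
    by (rule product_sigma_finite_interval)
  have "distr ?P (config_space a b (Suc n)) (config_cons n) = PiM {..<Suc n} (\<lambda>_. ?I)"
  proof (rule PiM_eqI)
    fix A assume A: "\<And>i. i \<in> {..<Suc n} \<Longrightarrow> A i \<in> sets ?I"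
    have sub: "A i \<subseteq> {a..b}" if "i < Suc n" for i
      using sets.sets_into_space [OF A [of i]] that by (simp add: space_restrict_space)
    have eq: "config_cons n -` Pi\<^sub>E {..<Suc n} A \<inter> space ?P = A 0 \<times> Pi\<^sub>E {..<n} (\<lambda>j. A (Suc j))"
    proof (intro set_eqI iffI)
      fix z assume z: "z \<in> config_cons n -` Pi\<^sub>E {..<Suc n} A \<inter> space ?P"
      obtain y x where zyx: "z = (y, x)" by (cases z)
      with z have "(y, x) \<in> space ?P" and *: "config_cons n (y, x) \<in> Pi\<^sub>E {..<Suc n} A"
        by auto
      then have x: "x \<in> extensional {..<n}"
        by (auto simp: space_pair_measure config_space_def space_PiM PiE_iff)
      have "x j \<in> A (Suc j)" if "j < n" for j
        using PiE_mem [OF *, of "Suc j"] that by (simp add: config_cons_def)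
      moreover have "y \<in> A 0"
        using PiE_mem [OF *, of 0] by (simp add: config_cons_def)
      ultimately show "z \<in> A 0 \<times> Pi\<^sub>E {..<n} (\<lambda>j. A (Suc j))"
        using x by (auto simp: zyx PiE_iff)
    next
      fix z assume z: "z \<in> A 0 \<times> Pi\<^sub>E {..<n} (\<lambda>j. A (Suc j))"
      then obtain y x where zyx: "z = (y, x)" and y: "y \<in> A 0" and x: "x \<in> Pi\<^sub>E {..<n} (\<lambda>j. A (Suc j))"
        by blast
      have "(case i of 0 \<Rightarrow> y | Suc j \<Rightarrow> x j) \<in> A i" if "i < Suc n" for i
        using that y PiE_mem [OF x] by (cases i) auto
      then have "config_cons n (y, x) \<in> Pi\<^sub>E {..<Suc n} A"
        by (auto simp: config_cons_def PiE_iff)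
      moreover have "(y, x) \<in> space ?P"
        using y x sub by (fastforce simp: space_pair_measure config_space_def space_PiM PiE_iff space_restrict_space)
      ultimately show "z \<in> config_cons n -` Pi\<^sub>E {..<Suc n} A \<inter> space ?P"
        by (simp add: zyx)
    qed
    have "emeasure (distr ?P (config_space a b (Suc n)) (config_cons n)) (Pi\<^sub>E {..<Suc n} A) =
        emeasure ?P (A 0 \<times> Pi\<^sub>E {..<n} (\<lambda>j. A (Suc j)))"
      unfolding eq [symmetric]
    proof (rule emeasure_distr [OF measurable_config_cons])
      show "Pi\<^sub>E {..<Suc n} A \<in> sets (config_space a b (Suc n))"
        unfolding config_space_def using A by (intro sets_PiM_I_finite) auto
    qed
    also have "\<dots> = emeasure ?I (A 0) * emeasure (config_space a b n) (Pi\<^sub>E {..<n} (\<lambda>j. A (Suc j)))"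
      using A by (intro C.emeasure_pair_measure_Times) (auto simp: config_space_def intro!: sets_PiM_I_finite)
    also have "emeasure (config_space a b n) (Pi\<^sub>E {..<n} (\<lambda>j. A (Suc j))) = (\<Prod>j<n. emeasure ?I (A (Suc j)))"
      using A unfolding config_space_def by (subst emeasure_PiM) auto
    also have "emeasure ?I (A 0) * \<dots> = (\<Prod>i<Suc n. emeasure ?I (A i))"
      by (simp add: prod.lessThan_Suc_shift del: prod.lessThan_Suc)
    finally show "emeasure (distr ?P (config_space a b (Suc n)) (config_cons n)) (Pi\<^sub>E {..<Suc n} A) =
        (\<Prod>i<Suc n. emeasure ?I (A i))" .
  qed (auto simp: config_space_def)
  then show ?thesis
    by (simp add: config_space_def)
qed

text \<open>Integration over unordered configurations, read as lists, so that Fubini removes the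
  head of the list just as the recursion on words does.\<close>

definition list_integral :: "real \<Rightarrow> real \<Rightarrow> nat \<Rightarrow> (real list \<Rightarrow> 'a::{banach, second_countable_topology}) \<Rightarrow> 'a" where
  "list_integral a b n f = (LINT x|config_space a b n. f (points n x))"

definition list_integrable :: "real \<Rightarrow> real \<Rightarrow> nat \<Rightarrow> (real list \<Rightarrow> 'a::{banach, second_countable_topology}) \<Rightarrow> bool" where
  "list_integrable a b n f \<longleftrightarrow> integrable (config_space a b n) (\<lambda>x. f (points n x))"

lemma list_integrable_0 [simp]: "list_integrable a b 0 f"
  and list_integral_0 [simp]: "list_integral a b 0 f = f []"
  by (simp_all add: list_integrable_def list_integral_def config_space_def PiM_empty points_def
      lebesgue_integral_count_space_finite integrable_count_space)

lemma measurable_list_cons: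
  assumes "(\<lambda>x. f (points (Suc n) x)) \<in> measurable (config_space a b (Suc n)) K"
  shows "(\<lambda>(y, x). f (y # points n x)) \<in> measurable (Icc_measure a b \<Otimes>\<^sub>M config_space a b n) K"
  using measurable_compose [OF measurable_config_cons assms]
  by (simp add: points_config_cons case_prod_beta')

lemma nn_integral_list_Suc:
  fixes h :: "real list \<Rightarrow> ennreal"
  assumes h: "(\<lambda>x. h (points (Suc n) x)) \<in> borel_measurable (config_space a b (Suc n))"
  shows "(\<integral>\<^sup>+x. h (points (Suc n) x) \<partial>config_space a b (Suc n)) =
    (\<integral>\<^sup>+y. \<integral>\<^sup>+x. h (y # points n x) \<partial>config_space a b n \<partial>Icc_measure a b)"
proof -
  interpret C: finite_measure "config_space a b n"
    by (rule finite_measure_config_space)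
  have "(\<integral>\<^sup>+x. h (points (Suc n) x) \<partial>config_space a b (Suc n)) =
      (\<integral>\<^sup>+x. h (points (Suc n) x) \<partial>distr (Icc_measure a b \<Otimes>\<^sub>M config_space a b n) (config_space a b (Suc n)) (config_cons n))"
    by (simp only: distr_config_cons)
  also have "\<dots> = (\<integral>\<^sup>+z. h (points (Suc n) (config_cons n z)) \<partial>(Icc_measure a b \<Otimes>\<^sub>M config_space a b n))"
    by (rule nn_integral_distr [OF measurable_config_cons]) (use h in \<open>simp add: distr_config_cons\<close>)
  also have "\<dots> = (\<integral>\<^sup>+(y, x). h (y # points n x) \<partial>(Icc_measure a b \<Otimes>\<^sub>M config_space a b n))"
    by (simp add: case_prod_beta' points_config_cons)
  also have "\<dots> = (\<integral>\<^sup>+y. \<integral>\<^sup>+x. h (y # points n x) \<partial>config_space a b n \<partial>Icc_measure a b)"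
    by (subst C.nn_integral_fst [symmetric, OF measurable_list_cons [OF h]]) simp
  finally show ?thesis .
qed

text \<open>Fubini with the head of the list as outer variable. Only almost every head leaves an
  integrable function of the tail; this exceptional null set returns in all later
  recursions.\<close>

lemma
  assumes f: "list_integrable a b (Suc n) f"
  shows list_integral_Suc: "list_integral a b (Suc n) f = (LINT y:{a..b}|lborel. list_integral a b n (\<lambda>ys. f (y # ys)))"
    and set_integrable_list_Suc: "set_integrable lborel {a..b} (\<lambda>y. list_integral a b n (\<lambda>ys. f (y # ys)))"
    and AE_list_integrable_Suc: "AE y in lborel. y \<in> {a..b} \<longrightarrow> list_integrable a b n (\<lambda>ys. f (y # ys))"
proof -
  let ?I = "Icc_measure a b"
  interpret I: finite_measure ?I
    by (rule finite_measure_Icc)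
  interpret C: finite_measure "config_space a b n"
    by (rule finite_measure_config_space)
  interpret pair_sigma_finite ?I "config_space a b n" ..
  have int: "integrable (config_space a b (Suc n)) (\<lambda>x. f (points (Suc n) x))"
    using f by (simp add: list_integrable_def)
  have eq: "(\<lambda>z. f (points (Suc n) (config_cons n z))) = (\<lambda>(y, x). f (y # points n x))"
    by (simp add: fun_eq_iff points_config_cons)
  have "integrable (distr (?I \<Otimes>\<^sub>M config_space a b n) (config_space a b (Suc n)) (config_cons n)) (\<lambda>x. f (points (Suc n) x))"
    using int by (simp only: distr_config_cons)
  then have P: "integrable (?I \<Otimes>\<^sub>M config_space a b n) (\<lambda>(y, x). f (y # points n x))"
    unfolding eq [symmetric] by (rule integrable_distr [OF measurable_config_cons])
  have S: "{a..b} \<inter> space lborel \<in> sets lborel"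
    by simp
  have "AE y in ?I. integrable (config_space a b n) (\<lambda>x. f (y # points n x))"
    by (rule AE_integrable_fst [OF P])
  then show "AE y in lborel. y \<in> {a..b} \<longrightarrow> list_integrable a b n (\<lambda>ys. f (y # ys))"
    by (simp add: AE_restrict_space_iff [OF S] list_integrable_def)
  have "integrable ?I (\<lambda>y. list_integral a b n (\<lambda>ys. f (y # ys)))"
    unfolding list_integral_def by (rule integrable_fst [OF P])
  then show "set_integrable lborel {a..b} (\<lambda>y. list_integral a b n (\<lambda>ys. f (y # ys)))"
    by (simp add: integrable_restrict_space [OF S] set_integrable_def)
  have "list_integral a b (Suc n) f =
      (LINT x|(distr (?I \<Otimes>\<^sub>M config_space a b n) (config_space a b (Suc n)) (config_cons n)). f (points (Suc n) x))"
    by (simp only: distr_config_cons list_integral_def)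
  also have "\<dots> = (LINT z|(?I \<Otimes>\<^sub>M config_space a b n). f (points (Suc n) (config_cons n z)))"
    by (rule integral_distr [OF measurable_config_cons borel_measurable_integrable [OF int]])
  also have "\<dots> = (LINT y|?I. list_integral a b n (\<lambda>ys. f (y # ys)))"
    unfolding eq list_integral_def by (rule integral_fst [OF P, symmetric])
  also have "\<dots> = (LINT y:{a..b}|lborel. list_integral a b n (\<lambda>ys. f (y # ys)))"
    by (simp add: integral_restrict_space [OF S] set_lebesgue_integral_def)
  finally show "list_integral a b (Suc n) f = (LINT y:{a..b}|lborel. list_integral a b n (\<lambda>ys. f (y # ys)))" .
qed

text \<open>The flag of a letter tells whether its position is an argument of the wave function. The
  first component is polymorphic because the same selection serves both words of kernels, for the
  bra, and bare letters, for bra and ket.\<close>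

primrec select :: "('k \<times> bool) list \<Rightarrow> 'a list \<Rightarrow> 'a list" where
  "select [] xs = []"
| "select (k # ks) xs = (if snd k then hd xs # select ks (tl xs) else select ks (tl xs))"

primrec word_prod :: "((real \<Rightarrow> complex^'n^'n) \<times> bool) list \<Rightarrow> real list \<Rightarrow> complex^'n^'n" where
  "word_prod [] xs = mat 1"
| "word_prod (k # ks) xs = fst k (hd xs) ** word_prod ks (tl xs)"

abbreviation selected :: "('k \<times> bool) list \<Rightarrow> nat" where
  "selected ks \<equiv> length (filter snd ks)"

lemma length_select [simp]: "length (select ks xs) = selected ks"
  by (induction ks arbitrary: xs) auto

lemma select_map: "length xs = length ks \<Longrightarrow> select ks (map f xs) = map f (select ks xs)"
proof (induction ks arbitrary: xs)
  case (Cons k ks)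
  then show ?case by (cases xs) auto
qed simp

lemma set_select: "length xs = length ks \<Longrightarrow> set (select ks xs) \<subseteq> set xs"
proof (induction ks arbitrary: xs)
  case (Cons k ks)
  then show ?case using Cons.IH [of "tl xs"] by (cases xs) auto
qed simp

text \<open>Selection from the list of indices yields the positions \<open>?ps\<close> at which
  coordinates are read, so selection is a coordinate projection between configuration
  spaces.\<close>

lemma measurable_select:
  assumes f: "(\<lambda>x. f (points (selected ks) x)) \<in> measurable (config_space a b (selected ks)) K"
  shows "(\<lambda>x. f (select ks (points (length ks) x))) \<in> measurable (config_space a b (length ks)) K"
proof -
  let ?ps = "select ks [0..<length ks]"
  define T where "T x = (\<lambda>i\<in>{..<selected ks}. x (?ps ! i))" for x :: "nat \<Rightarrow> real"
  have ps: "?ps ! i < length ks" if "i < selected ks" for i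
  proof -
    have "?ps ! i \<in> set ?ps"
      using that by (intro nth_mem) simp
    then show ?thesis
      using set_select [of "[0..<length ks]" ks] by auto
  qed
  have "T \<in> measurable (config_space a b (length ks)) (config_space a b (selected ks))"
    unfolding T_def [abs_def] config_space_def
    by (intro measurable_restrict measurable_component_singleton) (simp add: ps)
  from measurable_compose [OF this f]
  have "(\<lambda>x. f (points (selected ks) (T x))) \<in> measurable (config_space a b (length ks)) K" .
  moreover have "points (selected ks) (T x) = select ks (points (length ks) x)" for x
  proof -
    have "points (selected ks) (T x) = map (\<lambda>i. x (?ps ! i)) [0..<length ?ps]"
      by (simp add: points_def T_def)
    also have "\<dots> = map x (map ((!) ?ps) [0..<length ?ps])"
      unfolding map_map comp_def ..
    also have "\<dots> = map x ?ps"
      unfolding map_nth ..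
    also have "\<dots> = select ks (points (length ks) x)"
      unfolding points_def by (rule select_map [symmetric]) simp
    finally show ?thesis .
  qed
  ultimately show ?thesis by simp
qed

text \<open>A selected head is split off on both sides by \<open>nn_integral_list_Suc\<close>; on
  any other head the integrand is constant, and the coordinate contributes the length of the
  interval. This lifts integrability of the bra in its own variables to all variables of a
  word.\<close>

lemma nn_integral_select:
  fixes h :: "real list \<Rightarrow> ennreal"
  assumes "(\<lambda>x. h (points (selected ks) x)) \<in> borel_measurable (config_space a b (selected ks))"
  shows "(\<integral>\<^sup>+x. h (select ks (points (length ks) x)) \<partial>config_space a b (length ks)) =
    emeasure lborel {a..b} ^ (length ks - selected ks) * (\<integral>\<^sup>+x. h (points (selected ks) x) \<partial>config_space a b (selected ks))"
  using assms
proof (induction ks arbitrary: h)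
  case Nil
  then show ?case by (simp add: points_def)
next
  case (Cons k ks)
  have len: "selected ks \<le> length ks"
    by simp
  have sec: "(\<lambda>x. h (y # points (selected ks) x)) \<in> borel_measurable (config_space a b (selected ks))"
    if "snd k" "y \<in> {a..b}" for y
  proof -
    have "(\<lambda>(y, x). h (y # points (selected ks) x)) \<in> borel_measurable (Icc_measure a b \<Otimes>\<^sub>M config_space a b (selected ks))"
      using Cons.prems that by (intro measurable_list_cons) simp
    from measurable_Pair2 [OF this, of y] show ?thesis
      using that by simp
  qed
  have "(\<integral>\<^sup>+x. h (select (k # ks) (points (length (k # ks)) x)) \<partial>config_space a b (length (k # ks))) =
      (\<integral>\<^sup>+y. \<integral>\<^sup>+x. h (select (k # ks) (y # points (length ks) x)) \<partial>config_space a b (length ks) \<partial>Icc_measure a b)"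
    using measurable_select [OF Cons.prems] unfolding list.size(4) add_Suc_right add_0_right
    by (rule nn_integral_list_Suc)
  also have "\<dots> = emeasure lborel {a..b} ^ (length (k # ks) - selected (k # ks)) *
      (\<integral>\<^sup>+x. h (points (selected (k # ks)) x) \<partial>config_space a b (selected (k # ks)))"
  proof (cases "snd k")
    case True
    let ?c = "emeasure lborel {a..b} ^ (length ks - selected ks)"
    have m: "(\<lambda>(y, x). h (y # points (selected ks) x)) \<in> borel_measurable (Icc_measure a b \<Otimes>\<^sub>M config_space a b (selected ks))"
      using Cons.prems True by (intro measurable_list_cons) simp
    interpret C: finite_measure "config_space a b (selected ks)"
      by (rule finite_measure_config_space)
    have "(\<integral>\<^sup>+y. \<integral>\<^sup>+x. h (select (k # ks) (y # points (length ks) x)) \<partial>config_space a b (length ks) \<partial>Icc_measure a b) =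
        (\<integral>\<^sup>+y. ?c * \<integral>\<^sup>+x. h (y # points (selected ks) x) \<partial>config_space a b (selected ks) \<partial>Icc_measure a b)"
      using True by (intro nn_integral_cong) (simp add: Cons.IH [OF sec [OF True]])
    also have "\<dots> = ?c * (\<integral>\<^sup>+y. \<integral>\<^sup>+x. h (y # points (selected ks) x) \<partial>config_space a b (selected ks) \<partial>Icc_measure a b)"
      using C.borel_measurable_nn_integral_fst [OF m] by (intro nn_integral_cmult) simp
    also have "(\<integral>\<^sup>+y. \<integral>\<^sup>+x. h (y # points (selected ks) x) \<partial>config_space a b (selected ks) \<partial>Icc_measure a b) =
        (\<integral>\<^sup>+x. h (points (selected (k # ks)) x) \<partial>config_space a b (selected (k # ks)))"
      using Cons.prems True by (subst nn_integral_list_Suc [symmetric]) simp_all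
    finally show ?thesis using True by simp
  next
    case False
    then have "(\<integral>\<^sup>+y. \<integral>\<^sup>+x. h (select (k # ks) (y # points (length ks) x)) \<partial>config_space a b (length ks) \<partial>Icc_measure a b) =
        (\<integral>\<^sup>+x. h (select ks (points (length ks) x)) \<partial>config_space a b (length ks)) * emeasure lborel {a..b}"
      by (simp add: emeasure_restrict_space)
    also have "\<dots> = emeasure lborel {a..b} ^ Suc (length ks - selected ks) * (\<integral>\<^sup>+x. h (points (selected ks) x) \<partial>config_space a b (selected ks))"
      using Cons.prems False by (subst Cons.IH) (simp_all add: mult_ac)
    finally show ?thesis using False by (simp add: Suc_diff_le)
  qed
  finally show ?case .
qed

lemma list_integrable_select:
  fixes g :: "real list \<Rightarrow> 'a::{banach, second_countable_topology}"
  assumes "list_integrable a b (selected ks) g"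
  shows "list_integrable a b (length ks) (\<lambda>xs. g (select ks xs))"
proof -
  have m: "(\<lambda>x. g (points (selected ks) x)) \<in> borel_measurable (config_space a b (selected ks))"
    and fin: "(\<integral>\<^sup>+x. ennreal (norm (g (points (selected ks) x))) \<partial>config_space a b (selected ks)) < \<infinity>"
    using assms by (simp_all add: list_integrable_def integrable_iff_bounded)
  have "(\<integral>\<^sup>+x. ennreal (norm (g (select ks (points (length ks) x)))) \<partial>config_space a b (length ks)) < \<infinity>"
    using fin m
    by (subst nn_integral_select [where h = "\<lambda>xs. ennreal (norm (g xs))"])
       (auto simp: ennreal_mult_less_top emeasure_lborel_Icc_eq power_less_top_ennreal)
  then show ?thesis
    using measurable_select [OF m] by (simp add: list_integrable_def integrable_iff_bounded)
qed

section \<open>Integrals of words\<close>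

definition regular_word :: "real \<Rightarrow> real \<Rightarrow> ((real \<Rightarrow> complex^'n^'n) \<times> bool) list \<Rightarrow> bool" where
  "regular_word a b ks \<longleftrightarrow> (\<forall>k\<in>set ks. regular_on {a..b} (fst k))"

lemma regular_word_simps [simp]:
  "regular_word a b []"
  "regular_word a b (k # ks) \<longleftrightarrow> regular_on {a..b} (fst k) \<and> regular_word a b ks"
  by (auto simp: regular_word_def)

section \<open>Measurability and boundedness of products along a word\<close>

lemma borel_measurable_matrix_mult:
  assumes "f \<in> borel_measurable M" "g \<in> borel_measurable M"
  shows "(\<lambda>x. f x ** g x :: complex^'n^'n) \<in> borel_measurable M"
  by (rule borel_measurable_continuous_Pair [where H = "(**)", OF assms])
     (intro matrix_mult.continuous_on continuous_intros)

lemma set_points: "x \<in> space (config_space a b n) \<Longrightarrow> set (points n x) \<subseteq> {a..b}"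
  by (auto simp: config_space_def space_PiM points_def space_restrict_space PiE_iff)

lemma measurable_word_prod:
  assumes "regular_word a b ks" "\<And>i. i \<in> set is \<Longrightarrow> i < n" "length is = length ks"
  shows "(\<lambda>x. word_prod ks (map x is)) \<in> borel_measurable (config_space a b n)"
  using assms
proof (induction ks arbitrary: "is")
  case (Cons k ks)
  then obtain i js where [simp]: "is = i # js"
    by (cases "is") auto
  have "(\<lambda>x. x i) \<in> measurable (config_space a b n) (Icc_measure a b)"
    unfolding config_space_def using Cons.prems by (intro measurable_component_singleton) simp
  moreover have "fst k \<in> borel_measurable (Icc_measure a b)"
  proof -
    have "borel_measurable (restrict_space borel {a..b}) = (borel_measurable (Icc_measure a b) :: (real \<Rightarrow> complex^'n^'n) set)"
      by (intro measurable_cong_sets) (simp_all add: sets_restrict_space)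
    then show ?thesis
      using Cons.prems(1) unfolding regular_word_simps regular_on_def by blast
  qed
  ultimately have "(\<lambda>x. fst k (x i)) \<in> borel_measurable (config_space a b n)"
    by (rule measurable_compose)
  moreover have "(\<lambda>x. word_prod ks (map x js)) \<in> borel_measurable (config_space a b n)"
    using Cons.prems by (intro Cons.IH) auto
  ultimately show ?case
    by (simp add: borel_measurable_matrix_mult)
qed simp

lemma word_prod_bounded:
  assumes "regular_word a b (ks :: ((real \<Rightarrow> complex^'n^'n) \<times> bool) list)"
  shows "\<exists>C. \<forall>xs. length xs = length ks \<longrightarrow> set xs \<subseteq> {a..b} \<longrightarrow> norm (word_prod ks xs) \<le> C"
  using assms
proof (induction ks)
  case (Cons k ks)
  then obtain C where C: "\<And>xs. length xs = length ks \<Longrightarrow> set xs \<subseteq> {a..b} \<Longrightarrow> norm (word_prod ks xs) \<le> C"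
    by auto
  obtain c where c: "c > 0" "\<And>x M :: complex^'n^'n. x \<in> {a..b} \<Longrightarrow> norm (fst k x ** M) \<le> c * norm M"
    using regular_on_matrix_bound [of a b "fst k"] Cons.prems by (metis regular_word_simps(2))
  have "norm (word_prod (k # ks) xs) \<le> c * C" if xs: "length xs = length (k # ks)" "set xs \<subseteq> {a..b}" for xs
  proof -
    obtain y ys where [simp]: "xs = y # ys"
      using xs by (cases xs) auto
    have "norm (word_prod (k # ks) xs) \<le> c * norm (word_prod ks ys)"
      using xs by (simp add: c)
    also have "\<dots> \<le> c * C"
      using xs c(1) by (intro mult_left_mono C) auto
    finally show ?thesis .
  qed
  then show ?case by blast
qed auto

text \<open>The order is not strict, unlike in \<open>ordered_integral\<close>, since
  \<open>sorted\<close> recurses along the list; the two domains differ by a null set. Including the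
  lower bound x in the sorted list makes the first position the lower bound for the rest of the
  word.\<close>

definition word_integrand :: "((real \<Rightarrow> complex^'n^'n) \<times> bool) list \<Rightarrow> real \<Rightarrow> (real list \<Rightarrow> complex^'n^'n) \<Rightarrow>
    real list \<Rightarrow> complex^'n^'n" where
  "word_integrand ks x g xs = (if sorted (x # xs) then word_prod ks xs ** g (select ks xs) else 0)"

definition word_integral :: "real \<Rightarrow> real \<Rightarrow> ((real \<Rightarrow> complex^'n^'n) \<times> bool) list \<Rightarrow> real \<Rightarrow>
    (real list \<Rightarrow> complex^'n^'n) \<Rightarrow> complex^'n^'n" where
  "word_integral a b ks x g = list_integral a b (length ks) (word_integrand ks x g)"

lemma sorted_Cons_points:
  "sorted (x # points n z) \<longleftrightarrow> (\<forall>i\<in>{..<n}. x \<le> z i) \<and> (\<forall>i\<in>{..<n}. \<forall>j\<in>{..<n}. i < j \<longrightarrow> z i \<le> z j)"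
proof -
  have "sorted (points n z) \<longleftrightarrow> (\<forall>i j. i < j \<longrightarrow> j < n \<longrightarrow> z i \<le> z j)"
    by (simp add: points_def sorted_wrt_iff_nth_less)
  moreover have "(\<forall>y\<in>set (points n z). x \<le> y) \<longleftrightarrow> (\<forall>i\<in>{..<n}. x \<le> z i)"
    by (auto simp: points_def)
  ultimately show ?thesis
    by (meson lessThan_iff less_trans sorted_simps(2))
qed

lemma sorted_points_measurable:
  "{z \<in> space (config_space a b n). sorted (x # points n z)} \<in> sets (config_space a b n)"
proof -
  have 1: "{z \<in> space (config_space a b n). i < j \<longrightarrow> z i \<le> z j} \<in> sets (config_space a b n)"
    if "i \<in> {..<n}" "j \<in> {..<n}" for i j
    using that borel_measurable_le [OF config_space_component config_space_component, of i n j a b]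
    by (cases "i < j") simp_all
  have 2: "{z \<in> space (config_space a b n). x \<le> z i} \<in> sets (config_space a b n)" if "i \<in> {..<n}" for i
    using that by (intro borel_measurable_le [OF borel_measurable_const config_space_component]) simp
  show ?thesis
    unfolding sorted_Cons_points
    by (rule sets.sets_Collect_conj; rule sets.sets_Collect_finite_All [OF _ finite_lessThan])
       (rule sets.sets_Collect_finite_All [OF _ finite_lessThan], erule (1) 1, erule 2)
qed

text \<open>The product along the word is bounded, so a constant multiple of the lifted bra
  dominates the integrand.\<close>

lemma word_integrand_integrable:
  fixes ks :: "((real \<Rightarrow> complex^'n^'n) \<times> bool) list"
  assumes ks: "regular_word a b ks" and g: "list_integrable a b (selected ks) g"
  shows "list_integrable a b (length ks) (word_integrand ks x g)"
proof -
  let ?n = "length ks" and ?M = "config_space a b (length ks)"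
  obtain C where C: "\<And>xs. length xs = length ks \<Longrightarrow> set xs \<subseteq> {a..b} \<Longrightarrow> norm (word_prod ks xs) \<le> C"
    using word_prod_bounded [OF ks] by blast
  obtain K where K: "K \<ge> 0" "\<And>(M :: complex^'n^'n) (N :: complex^'n^'n). norm (M ** N) \<le> norm M * norm N * K"
    using bounded_bilinear.nonneg_bounded [OF bounded_bilinear_matrix_mult [where 'm = 'n and 'n = 'n and 'p = 'n]]
    by metis
  have gs: "integrable ?M (\<lambda>z. g (select ks (points ?n z)))"
    using list_integrable_select [OF g] by (simp add: list_integrable_def)
  have [measurable]: "(\<lambda>z. word_prod ks (points ?n z)) \<in> borel_measurable ?M"
    unfolding points_def using ks by (intro measurable_word_prod) auto
  have [measurable]: "(\<lambda>z. word_prod ks (points ?n z) ** g (select ks (points ?n z))) \<in> borel_measurable ?M"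
    using gs by (intro borel_measurable_matrix_mult) auto
  show ?thesis
    unfolding list_integrable_def
  proof (rule Bochner_Integration.integrable_bound)
    show "integrable ?M (\<lambda>z. (C * K) *\<^sub>R g (select ks (points ?n z)))"
      using gs by simp
    show "(\<lambda>z. word_integrand ks x g (points ?n z)) \<in> borel_measurable ?M"
      unfolding word_integrand_def
      by (intro measurable_If sorted_points_measurable borel_measurable_const) measurable
    show "AE z in ?M. norm (word_integrand ks x g (points ?n z)) \<le> norm ((C * K) *\<^sub>R g (select ks (points ?n z)))"
      using AE_space
    proof eventually_elim
      case (elim z)
      let ?p = "points ?n z"
      have C': "norm (word_prod ks ?p) \<le> C"
        using elim by (intro C set_points) auto
      then have C0: "0 \<le> C"
        using norm_ge_zero order_trans by blast
      have "norm (word_prod ks ?p ** g (select ks ?p)) \<le> norm (word_prod ks ?p) * norm (g (select ks ?p)) * K"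
        by (rule K)
      also have "\<dots> \<le> C * norm (g (select ks ?p)) * K"
        using C' K(1) by (intro mult_right_mono) auto
      finally show ?case
        using C0 K(1) by (simp add: word_integrand_def abs_mult mult_ac)
    qed
  qed
qed

lemma word_integral_Nil [simp]: "word_integral a b [] x g = g []"
  by (simp add: word_integral_def word_integrand_def)

lemma set_integral_cong_AE:
  fixes f g :: "real \<Rightarrow> 'a::{banach, second_countable_topology}"
  assumes "set_integrable lborel A f" "set_integrable lborel A g" "AE y in lborel. y \<in> A \<longrightarrow> f y = g y"
  shows "(LINT y:A|lborel. f y) = (LINT y:A|lborel. g y)"
  unfolding set_lebesgue_integral_def
proof (rule integral_cong_AE)
  show "AE y in lborel. indicator A y *\<^sub>R f y = indicator A y *\<^sub>R g y"
    using assms(3) by eventually_elim (auto simp: indicator_def)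
qed (use assms(1,2) in \<open>auto simp: set_integrable_def\<close>)

lemma
  fixes ks :: "((real \<Rightarrow> complex^'n^'n) \<times> bool) list"
  assumes ks: "regular_word a b ((k, s) # ks)" and g: "list_integrable a b (selected ((k, s) # ks)) g"
  defines "h \<equiv> \<lambda>y. if s then (\<lambda>ys. g (y # ys)) else g"
  shows set_integrable_word_integral: "set_integrable lborel {a..b} (\<lambda>y. k y ** word_integral a b ks y (h y))"
    and word_integral_Cons: "x \<in> {a..b} \<Longrightarrow> word_integral a b ((k, s) # ks) x g =
      (LINT y:{x..b}|lborel. k y ** word_integral a b ks y (h y))"
proof -
  let ?n = "length ks"
  have AE: "AE y in lborel. y \<in> {a..b} \<longrightarrow> list_integrable a b (selected ks) (h y)"
    using g AE_list_integrable_Suc [of a b "selected ks" g] by (cases s) (auto simp: h_def)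
  have k: "regular_on {a..b} k"
    using ks by simp
  \<comment> \<open>With the identity as head kernel, the inner integral equals
    \<open>word_integral a b ks y (h y)\<close> for every y, exceptional points included. Its
    integrability in y follows from Fubini, and the bounded kernel \<open>k\<close> is multiplied on
    afterwards.\<close>
  have one: "regular_word a b ((\<lambda>_. mat 1, s) # ks)"
    using ks by (simp add: regular_on_continuous)
  have 1: "list_integrable a b (Suc ?n) (word_integrand ((\<lambda>_. mat 1, s) # ks) a g)"
    using word_integrand_integrable [OF one, of g a] g by (cases s) simp_all
  have "word_integrand ((\<lambda>_. mat 1, s) # ks) a g (y # ys) = word_integrand ks y (h y) ys"
    if "y \<in> {a..b}" for y ys
    using that by (auto simp: word_integrand_def h_def)
  then have "list_integral a b ?n (\<lambda>ys. word_integrand ((\<lambda>_. mat 1, s) # ks) a g (y # ys)) = word_integral a b ks y (h y)"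
    if "y \<in> {a..b}" for y
    using that by (simp add: word_integral_def)
  then have W: "set_integrable lborel {a..b} (\<lambda>y. word_integral a b ks y (h y))"
    using set_integrable_list_Suc [OF 1]
    by (rule set_integrable_cong [OF refl refl, THEN iffD1])
  show kW: "set_integrable lborel {a..b} (\<lambda>y. k y ** word_integral a b ks y (h y))"
    using set_integrable_bilinear_regular [OF matrix_mult.flip W, of k] k
    by (simp add: regular_on_def)
  assume x: "x \<in> {a..b}"
  have 2: "list_integrable a b (Suc ?n) (word_integrand ((k, s) # ks) x g)"
    using word_integrand_integrable [OF ks, of g x] g by simp
  have sub: "set_integrable lborel {x..b} (\<lambda>y. k y ** word_integral a b ks y (h y))"
    using x by (intro set_integrable_subinterval [OF kW]) auto
  have eq: "(\<lambda>y. indicator {a..b} y *\<^sub>R (indicator {x..b} y *\<^sub>R (k y ** word_integral a b ks y (h y)))) =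
     (\<lambda>y. indicator {x..b} y *\<^sub>R (k y ** word_integral a b ks y (h y)))"
    using x by (auto simp: fun_eq_iff indicator_def)
  have "word_integral a b ((k, s) # ks) x g =
      (LINT y:{a..b}|lborel. list_integral a b ?n (\<lambda>ys. word_integrand ((k, s) # ks) x g (y # ys)))"
    unfolding word_integral_def using list_integral_Suc [OF 2] by simp
  also have "\<dots> = (LINT y:{a..b}|lborel. indicator {x..b} y *\<^sub>R (k y ** word_integral a b ks y (h y)))"
  proof (rule set_integral_cong_AE)
    show "set_integrable lborel {a..b} (\<lambda>y. list_integral a b ?n (\<lambda>ys. word_integrand ((k, s) # ks) x g (y # ys)))"
      by (rule set_integrable_list_Suc [OF 2])
    show "set_integrable lborel {a..b} (\<lambda>y. indicator {x..b} y *\<^sub>R (k y ** word_integral a b ks y (h y)))"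
      using sub unfolding set_integrable_def eq .
    \<comment> \<open>The factor \<open>k y\<close> may be taken out of the inner integral only
      where the tail is integrable: elsewhere the integral has its default value 0, and a singular
      \<open>k y\<close> could make the product integrable.\<close>
    show "AE y in lborel. y \<in> {a..b} \<longrightarrow> list_integral a b ?n (\<lambda>ys. word_integrand ((k, s) # ks) x g (y # ys)) =
        indicator {x..b} y *\<^sub>R (k y ** word_integral a b ks y (h y))"
      using AE
    proof eventually_elim
      case (elim y)
      show ?case
      proof
        assume y: "y \<in> {a..b}"
        with elim have "list_integrable a b (selected ks) (h y)"
          by simp
        then have int: "list_integrable a b ?n (word_integrand ks y (h y))"
          using ks by (intro word_integrand_integrable) auto
        have "word_integrand ((k, s) # ks) x g (y # ys) = indicator {x..b} y *\<^sub>R (k y ** word_integrand ks y (h y) ys)" for ys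
          using x y by (auto simp: word_integrand_def h_def indicator_def matrix_mul_assoc)
        then have "list_integral a b ?n (\<lambda>ys. word_integrand ((k, s) # ks) x g (y # ys)) =
            indicator {x..b} y *\<^sub>R list_integral a b ?n (\<lambda>ys. k y ** word_integrand ks y (h y) ys)"
          by (simp add: list_integral_def)
        also have "list_integral a b ?n (\<lambda>ys. k y ** word_integrand ks y (h y) ys) = k y ** word_integral a b ks y (h y)"
          using int unfolding list_integral_def list_integrable_def word_integral_def
          by (intro integral_bounded_linear [OF matrix_mult.bounded_linear_right])
        finally show "list_integral a b ?n (\<lambda>ys. word_integrand ((k, s) # ks) x g (y # ys)) =
            indicator {x..b} y *\<^sub>R (k y ** word_integral a b ks y (h y))" .
      qed
    qed
  qed
  also have "\<dots> = (LINT y:{x..b}|lborel. k y ** word_integral a b ks y (h y))"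
    unfolding set_lebesgue_integral_def eq ..
  finally show "word_integral a b ((k, s) # ks) x g =
      (LINT y:{x..b}|lborel. k y ** word_integral a b ks y (h y))" .
qed

text \<open>The letters \<open>L\<close> and \<open>A\<close> annihilate a particle of the bra,
  \<open>R\<close> and \<open>A\<close> one of the ket. These are therefore the words that can
  contribute between an N-particle bra and an m-particle ket.\<close>

definition leg_words :: "nat \<Rightarrow> nat \<Rightarrow> leg list set" where
  "leg_words N m = {\<alpha>s. length (filter (\<lambda>\<alpha>. \<alpha> \<noteq> Leg_R) \<alpha>s) = N \<and> length (filter (\<lambda>\<alpha>. \<alpha> \<noteq> Leg_L) \<alpha>s) = m}"

lemma length_leg_words: "\<alpha>s \<in> leg_words N m \<Longrightarrow> length \<alpha>s \<le> N + m"
proof -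
  have "length \<alpha>s \<le> length (filter (\<lambda>\<alpha>. \<alpha> \<noteq> Leg_R) \<alpha>s) + length (filter (\<lambda>\<alpha>. \<alpha> \<noteq> Leg_L) \<alpha>s)" for \<alpha>s
    by (induction \<alpha>s) auto
  then show "\<alpha>s \<in> leg_words N m \<Longrightarrow> length \<alpha>s \<le> N + m"
    by (auto simp: leg_words_def)
qed

lemma UNIV_leg: "(UNIV :: leg set) = {Leg_L, Leg_R, Leg_A}"
  by (auto intro: leg.exhaust)

lemma finite_leg_words: "finite (leg_words N m)"
proof (rule finite_subset)
  show "leg_words N m \<subseteq> {\<alpha>s. set \<alpha>s \<subseteq> UNIV \<and> length \<alpha>s \<le> N + m}"
    using length_leg_words by auto
  show "finite {\<alpha>s :: leg list. set \<alpha>s \<subseteq> UNIV \<and> length \<alpha>s \<le> N + m}"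
    by (rule finite_lists_length_le) (simp add: UNIV_leg)
qed

lemma leg_words_unfold:
  "leg_words N m = (if N = 0 \<and> m = 0 then {[]} else {}) \<union>
     (case N of 0 \<Rightarrow> {} | Suc N' \<Rightarrow> (#) Leg_L ` leg_words N' m) \<union>
     (case m of 0 \<Rightarrow> {} | Suc m' \<Rightarrow> (#) Leg_R ` leg_words N m') \<union>
     (case N of 0 \<Rightarrow> {} | Suc N' \<Rightarrow> case m of 0 \<Rightarrow> {} | Suc m' \<Rightarrow> (#) Leg_A ` leg_words N' m')"
  (is "_ = ?R")
proof (intro set_eqI)
  fix \<alpha>s
  show "\<alpha>s \<in> leg_words N m \<longleftrightarrow> \<alpha>s \<in> ?R"
  proof (cases \<alpha>s)
    case Nil
    then show ?thesis
      by (auto simp: leg_words_def split: nat.splits)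
  next
    case (Cons \<alpha> \<beta>s)
    then show ?thesis
      by (cases \<alpha>) (auto simp: leg_words_def image_iff split: nat.splits)
  qed
qed

lemma sum_leg_words:
  fixes f :: "leg list \<Rightarrow> 'a::comm_monoid_add"
  shows "(\<Sum>\<alpha>s\<in>leg_words N m. f \<alpha>s) = (if N = 0 \<and> m = 0 then f [] else 0) +
     (case N of 0 \<Rightarrow> 0 | Suc N' \<Rightarrow> \<Sum>\<alpha>s\<in>leg_words N' m. f (Leg_L # \<alpha>s)) +
     (case m of 0 \<Rightarrow> 0 | Suc m' \<Rightarrow> \<Sum>\<alpha>s\<in>leg_words N m'. f (Leg_R # \<alpha>s)) +
     (case N of 0 \<Rightarrow> 0 | Suc N' \<Rightarrow> case m of 0 \<Rightarrow> 0 | Suc m' \<Rightarrow> \<Sum>\<alpha>s\<in>leg_words N' m'. f (Leg_A # \<alpha>s))"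
proof -
  have "(#) x ` A \<inter> (#) y ` B = {}" if "x \<noteq> y" for x y :: leg and A B
    using that by auto
  then show ?thesis
    by (subst leg_words_unfold)
       (auto simp: finite_leg_words sum.union_disjoint sum.reindex Int_Un_distrib2 split: nat.splits)
qed

section \<open>Summation over words\<close>

lemma
  fixes f :: "'i \<Rightarrow> real \<Rightarrow> 'a::{banach, second_countable_topology}"
  assumes "\<And>i. i \<in> I \<Longrightarrow> set_integrable lborel A (f i)"
  shows set_integrable_sum: "set_integrable lborel A (\<lambda>y. \<Sum>i\<in>I. f i y)"
    and set_integral_sum: "(LINT y:A|lborel. \<Sum>i\<in>I. f i y) = (\<Sum>i\<in>I. LINT y:A|lborel. f i y)"
  using assms unfolding set_integrable_def set_lebesgue_integral_def scaleR_sum_right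
  by (auto intro: Bochner_Integration.integral_sum)

text \<open>The summation of words uses only that three kernels are bounded and measurable; the
  tensor product structure enters when the locale is instantiated.\<close>

locale leg_kernels =
  fixes a b :: real and kL kR kA :: "real \<Rightarrow> complex^'n^'n"
  assumes ab: "a \<le> b"
    and regular_L: "regular_on {a..b} kL" and regular_R: "regular_on {a..b} kR" and regular_A: "regular_on {a..b} kA"
begin

definition leg_word :: "leg list \<Rightarrow> ((real \<Rightarrow> complex^'n^'n) \<times> bool) list" where
  "leg_word = map (\<lambda>\<alpha>. (leg_matrix kL kR kA \<alpha>, \<alpha> \<noteq> Leg_R))"

definition word_sum :: "nat \<Rightarrow> nat \<Rightarrow> real \<Rightarrow> (real list \<Rightarrow> complex^'n^'n) \<Rightarrow> complex^'n^'n" where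
  "word_sum N m x g = (\<Sum>\<alpha>s\<in>leg_words N m. word_integral a b (leg_word \<alpha>s) x g)"

lemma leg_word_simps [simp]:
  "leg_word [] = []"
  "leg_word (\<alpha> # \<alpha>s) = (leg_matrix kL kR kA \<alpha>, \<alpha> \<noteq> Leg_R) # leg_word \<alpha>s"
  by (simp_all add: leg_word_def)

lemma regular_leg_word: "regular_word a b (leg_word \<alpha>s)"
proof (induction \<alpha>s)
  case (Cons \<alpha> \<alpha>s)
  then show ?case
    using regular_L regular_R regular_A by (cases \<alpha>) auto
qed simp

lemma selected_leg_word: "\<alpha>s \<in> leg_words N m \<Longrightarrow> selected (leg_word \<alpha>s) = N"
proof -
  have "selected (leg_word \<alpha>s) = length (filter (\<lambda>\<alpha>. \<alpha> \<noteq> Leg_R) \<alpha>s)"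
    by (induction \<alpha>s) auto
  then show "\<alpha>s \<in> leg_words N m \<Longrightarrow> selected (leg_word \<alpha>s) = N"
    by (simp add: leg_words_def)
qed

definition word_sum_integrand :: "nat \<Rightarrow> nat \<Rightarrow> (real list \<Rightarrow> complex^'n^'n) \<Rightarrow> real \<Rightarrow> complex^'n^'n" where
  "word_sum_integrand N m g y =
    (case N of 0 \<Rightarrow> 0 | Suc N' \<Rightarrow> kL y ** word_sum N' m y (\<lambda>ys. g (y # ys))) +
    (case m of 0 \<Rightarrow> 0 | Suc m' \<Rightarrow> kR y ** word_sum N m' y g) +
    (case N of 0 \<Rightarrow> 0 | Suc N' \<Rightarrow> case m of 0 \<Rightarrow> 0 | Suc m' \<Rightarrow> kA y ** word_sum N' m' y (\<lambda>ys. g (y # ys)))"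

lemma
  assumes g: "list_integrable a b N g"
  shows set_integrable_word_sum: "set_integrable lborel {a..b} (word_sum_integrand N m g)"
    and word_sum_unfold: "x \<in> {a..b} \<Longrightarrow> word_sum N m x g =
      (if N = 0 \<and> m = 0 then g [] else 0) + (LINT y:{x..b}|lborel. word_sum_integrand N m g y)"
proof -
  define h where "h \<alpha> y = (if \<alpha> \<noteq> Leg_R then (\<lambda>ys. g (y # ys)) else g)" for \<alpha> y
  define G where "G \<alpha> W y = (\<Sum>\<alpha>s\<in>W. leg_matrix kL kR kA \<alpha> y ** word_integral a b (leg_word \<alpha>s) y (h \<alpha> y))" for \<alpha> W y
  have step: "set_integrable lborel {a..b} (G \<alpha> W) \<and>
      (\<forall>x\<in>{a..b}. (\<Sum>\<alpha>s\<in>W. word_integral a b (leg_word (\<alpha> # \<alpha>s)) x g) = (LINT y:{x..b}|lborel. G \<alpha> W y))"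
    if "\<And>\<alpha>s. \<alpha>s \<in> W \<Longrightarrow> selected (leg_word (\<alpha> # \<alpha>s)) = N" for \<alpha> W
  proof -
    have rw: "regular_word a b ((leg_matrix kL kR kA \<alpha>, \<alpha> \<noteq> Leg_R) # leg_word \<alpha>s)" for \<alpha>s
      using regular_leg_word [of "\<alpha> # \<alpha>s"] by (simp only: leg_word_simps)
    have gi: "list_integrable a b (selected ((leg_matrix kL kR kA \<alpha>, \<alpha> \<noteq> Leg_R) # leg_word \<alpha>s)) g" if "\<alpha>s \<in> W" for \<alpha>s
      using g \<open>\<And>\<alpha>s. \<alpha>s \<in> W \<Longrightarrow> selected (leg_word (\<alpha> # \<alpha>s)) = N\<close> [OF that] by (simp only: leg_word_simps)
    note int = set_integrable_word_integral [OF rw gi] and eq = word_integral_Cons [OF rw gi]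
    have int': "set_integrable lborel {x..b} (\<lambda>y. leg_matrix kL kR kA \<alpha> y ** word_integral a b (leg_word \<alpha>s) y (h \<alpha> y))"
      if "x \<in> {a..b}" "\<alpha>s \<in> W" for x \<alpha>s
      using that(1) unfolding h_def by (intro set_integrable_subinterval [OF int [OF that(2)]]) auto
    have "set_integrable lborel {a..b} (G \<alpha> W)"
      unfolding G_def using ab by (intro set_integrable_sum int') auto
    moreover have "(\<Sum>\<alpha>s\<in>W. word_integral a b (leg_word (\<alpha> # \<alpha>s)) x g) = (LINT y:{x..b}|lborel. G \<alpha> W y)"
      if x: "x \<in> {a..b}" for x
    proof -
      have "(LINT y:{x..b}|lborel. G \<alpha> W y) =
          (\<Sum>\<alpha>s\<in>W. LINT y:{x..b}|lborel. leg_matrix kL kR kA \<alpha> y ** word_integral a b (leg_word \<alpha>s) y (h \<alpha> y))"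
        unfolding G_def by (rule set_integral_sum) (rule int' [OF x])
      also have "\<dots> = (\<Sum>\<alpha>s\<in>W. word_integral a b (leg_word (\<alpha> # \<alpha>s)) x g)"
        unfolding h_def leg_word_simps by (intro sum.cong refl eq [symmetric] x)
      finally show ?thesis ..
    qed
    ultimately show ?thesis by blast
  qed
  \<comment> \<open>The tails admissible after each first letter. They are empty when a counter is
    already 0, so that \<open>step\<close> treats the three letters alike.\<close>
  define W where "W \<alpha> = (if \<alpha> = Leg_L then case N of 0 \<Rightarrow> {} | Suc N' \<Rightarrow> leg_words N' m
    else if \<alpha> = Leg_R then case m of 0 \<Rightarrow> {} | Suc m' \<Rightarrow> leg_words N m'
    else case N of 0 \<Rightarrow> {} | Suc N' \<Rightarrow> case m of 0 \<Rightarrow> {} | Suc m' \<Rightarrow> leg_words N' m')" for \<alpha>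
  have Wsel: "selected (leg_word (\<alpha> # \<alpha>s)) = N" if "\<alpha>s \<in> W \<alpha>" for \<alpha> \<alpha>s
    using that by (cases \<alpha>) (auto simp: W_def selected_leg_word split: nat.splits)
  have int: "set_integrable lborel {a..b} (G \<alpha> (W \<alpha>))" for \<alpha>
    using step [of "W \<alpha>" \<alpha>, OF Wsel] by blast
  have eq: "(\<Sum>\<alpha>s\<in>W \<alpha>. word_integral a b (leg_word (\<alpha> # \<alpha>s)) x g) = (LINT y:{x..b}|lborel. G \<alpha> (W \<alpha>) y)"
    if "x \<in> {a..b}" for x \<alpha>
    using step [of "W \<alpha>" \<alpha>, OF Wsel] that by blast
  have integrand: "word_sum_integrand N m g = (\<lambda>y. G Leg_L (W Leg_L) y + G Leg_R (W Leg_R) y + G Leg_A (W Leg_A) y)"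
    by (auto simp: fun_eq_iff word_sum_integrand_def W_def G_def h_def word_sum_def matrix_mult.sum_right split: nat.splits)
  show "set_integrable lborel {a..b} (word_sum_integrand N m g)"
    unfolding integrand by (intro set_integral_add(1) int)
  assume x: "x \<in> {a..b}"
  have int': "set_integrable lborel {x..b} (G \<alpha> (W \<alpha>))" for \<alpha>
    using x by (intro set_integrable_subinterval [OF int]) auto
  have "word_sum N m x g = (if N = 0 \<and> m = 0 then g [] else 0) +
     (\<Sum>\<alpha>s\<in>W Leg_L. word_integral a b (leg_word (Leg_L # \<alpha>s)) x g) +
     (\<Sum>\<alpha>s\<in>W Leg_R. word_integral a b (leg_word (Leg_R # \<alpha>s)) x g) +
     (\<Sum>\<alpha>s\<in>W Leg_A. word_integral a b (leg_word (Leg_A # \<alpha>s)) x g)"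
    unfolding word_sum_def sum_leg_words [where N = N and m = m] by (auto simp: W_def split: nat.splits)
  also have "\<dots> = (if N = 0 \<and> m = 0 then g [] else 0) + (LINT y:{x..b}|lborel. word_sum_integrand N m g y)"
    unfolding integrand eq [OF x] by (simp add: set_integral_add int' add.assoc)
  finally show "word_sum N m x g =
      (if N = 0 \<and> m = 0 then g [] else 0) + (LINT y:{x..b}|lborel. word_sum_integrand N m g y)" .
qed

definition l1_norm :: "nat \<Rightarrow> (real list \<Rightarrow> complex^'n^'n) \<Rightarrow> real" where
  "l1_norm N g = list_integral a b N (\<lambda>ys. norm (g ys))"

lemma l1_norm_nonneg: "0 \<le> l1_norm N g"
  by (simp add: l1_norm_def list_integral_def)

lemma
  assumes "list_integrable a b (Suc N) g"
  shows l1_norm_Suc: "l1_norm (Suc N) g = (LINT y:{a..b}|lborel. l1_norm N (\<lambda>ys. g (y # ys)))"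
    and set_integrable_l1_norm: "set_integrable lborel {a..b} (\<lambda>y. l1_norm N (\<lambda>ys. g (y # ys)))"
proof -
  have "list_integrable a b (Suc N) (\<lambda>ys. norm (g ys))"
    using assms by (simp add: list_integrable_def)
  then show "l1_norm (Suc N) g = (LINT y:{a..b}|lborel. l1_norm N (\<lambda>ys. g (y # ys)))"
    "set_integrable lborel {a..b} (\<lambda>y. l1_norm N (\<lambda>ys. g (y # ys)))"
    unfolding l1_norm_def by (rule list_integral_Suc, rule set_integrable_list_Suc)
qed

text \<open>Chosen once and for all, so that \<open>weight\<close> and the majorant below can be
  defined without carrying a constant as an argument.\<close>

definition kernel_bound :: real where
  "kernel_bound = (SOME c. c > 0 \<and> (\<forall>y\<in>{a..b}. \<forall>M :: complex^'n^'n.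
     norm (kL y ** M) \<le> c * norm M \<and> norm (kR y ** M) \<le> c * norm M \<and> norm (kA y ** M) \<le> c * norm M))"

lemma kernel_bound:
  shows kernel_bound_pos: "kernel_bound > 0"
    and kernel_bound_L: "y \<in> {a..b} \<Longrightarrow> norm (kL y ** M) \<le> kernel_bound * norm (M :: complex^'n^'n)"
    and kernel_bound_R: "y \<in> {a..b} \<Longrightarrow> norm (kR y ** M) \<le> kernel_bound * norm (M :: complex^'n^'n)"
    and kernel_bound_A: "y \<in> {a..b} \<Longrightarrow> norm (kA y ** M) \<le> kernel_bound * norm (M :: complex^'n^'n)"
proof -
  obtain cL where cL: "cL > 0" "\<And>x M :: complex^'n^'n. x \<in> {a..b} \<Longrightarrow> norm (kL x ** M) \<le> cL * norm M"
    using regular_on_matrix_bound [OF regular_L] by metis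
  obtain cR where cR: "cR > 0" "\<And>x M :: complex^'n^'n. x \<in> {a..b} \<Longrightarrow> norm (kR x ** M) \<le> cR * norm M"
    using regular_on_matrix_bound [OF regular_R] by metis
  obtain cA where cA: "cA > 0" "\<And>x M :: complex^'n^'n. x \<in> {a..b} \<Longrightarrow> norm (kA x ** M) \<le> cA * norm M"
    using regular_on_matrix_bound [OF regular_A] by metis
  have le: "u \<le> (cL + cR + cA) * norm M" if "u \<le> c * norm M" "c \<le> cL + cR + cA" for u c and M :: "complex^'n^'n"
    using that by (meson mult_right_mono norm_ge_zero order_trans)
  have "\<exists>c. c > 0 \<and> (\<forall>y\<in>{a..b}. \<forall>M :: complex^'n^'n.
     norm (kL y ** M) \<le> c * norm M \<and> norm (kR y ** M) \<le> c * norm M \<and> norm (kA y ** M) \<le> c * norm M)"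
  proof (intro exI [of _ "cL + cR + cA"] conjI ballI allI)
    fix y and M :: "complex^'n^'n" assume y: "y \<in> {a..b}"
    show "norm (kL y ** M) \<le> (cL + cR + cA) * norm M"
      using cR(1) cA(1) by (intro le [OF cL(2) [OF y]]) simp
    show "norm (kR y ** M) \<le> (cL + cR + cA) * norm M"
      using cL(1) cA(1) by (intro le [OF cR(2) [OF y]]) simp
    show "norm (kA y ** M) \<le> (cL + cR + cA) * norm M"
      using cL(1) cR(1) by (intro le [OF cA(2) [OF y]]) simp
  qed (use cL cR cA in simp)
  from someI_ex [OF this] have *: "kernel_bound > 0 \<and> (\<forall>y\<in>{a..b}. \<forall>M :: complex^'n^'n.
     norm (kL y ** M) \<le> kernel_bound * norm M \<and> norm (kR y ** M) \<le> kernel_bound * norm M \<and> norm (kA y ** M) \<le> kernel_bound * norm M)"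
    unfolding kernel_bound_def [symmetric] .
  then show "kernel_bound > 0"
    "y \<in> {a..b} \<Longrightarrow> norm (kL y ** M) \<le> kernel_bound * norm M"
    "y \<in> {a..b} \<Longrightarrow> norm (kR y ** M) \<le> kernel_bound * norm M"
    "y \<in> {a..b} \<Longrightarrow> norm (kA y ** M) \<le> kernel_bound * norm M"
    by blast+
qed

text \<open>With \<open>c\<close> a bound for the three kernels, the weight \<open>(6 c)\<^sup>N 2\<^sup>-\<^sup>m e\<^bsup>4 c (b - x)\<^esup>\<close> is reproduced by the
  recursion \<open>word_sum_unfold\<close>: a first letter \<open>R\<close> costs \<open>2 c / (4 c)\<close>, a first letter \<open>L\<close> or \<open>A\<close>
  together \<open>3 c / (6 c)\<close>.\<close>

definition weight :: "nat \<Rightarrow> nat \<Rightarrow> real \<Rightarrow> real" where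
  "weight N m x = (6 * kernel_bound) ^ N * (1/2) ^ m * exp (4 * kernel_bound * (b - x))"

text \<open>The factor \<open>(1/2) ^ m\<close> is left out, so that one function dominates the
  integrands for all m at once. The 3 counts \<open>L\<close> once and \<open>A\<close> twice, since
  \<open>A\<close> lowers m and thereby doubles the weight; the 2 for \<open>R\<close> has the same
  origin. In the first summand only the L1 norm of the slice remains to be integrated, so its weight
  is frozen at x; the second keeps the exponential in y, whose integral supplies the gain.\<close>

definition word_sum_majorant :: "nat \<Rightarrow> (real list \<Rightarrow> complex^'n^'n) \<Rightarrow> real \<Rightarrow> real \<Rightarrow> real" where
  "word_sum_majorant N g x y =
    (case N of 0 \<Rightarrow> 0 | Suc N' \<Rightarrow> 3 * kernel_bound * weight N' 0 x * l1_norm N' (\<lambda>ys. g (y # ys))) +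
    2 * kernel_bound * l1_norm N g * (6 * kernel_bound) ^ N * exp (4 * kernel_bound * (b - y))"

lemma weight_nonneg: "0 \<le> weight N m x"
  using kernel_bound_pos by (simp add: weight_def)

lemma weight_antimono: "x \<le> y \<Longrightarrow> weight N m y \<le> weight N m x"
  using kernel_bound_pos unfolding weight_def by (intro mult_left_mono) auto

text \<open>The bounds for shorter words are assumptions because the estimate is used twice: inside
  the induction that proves \<open>norm_word_sum_le\<close>, with the induction hypotheses, and
  after it, with that result, to dominate the series over m.\<close>

lemma norm_word_sum_integrand_le:
  assumes x: "x \<in> {a..b}" and y: "y \<in> {x..b}" and g: "list_integrable a b N g"
    and g': "\<And>N'. N = Suc N' \<Longrightarrow> list_integrable a b N' (\<lambda>ys. g (y # ys))"
    and IH_N: "\<And>N' m y g. N = Suc N' \<Longrightarrow> y \<in> {a..b} \<Longrightarrow> list_integrable a b N' g \<Longrightarrow>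
      norm (word_sum N' m y g) \<le> weight N' m y * l1_norm N' g"
    and IH_m: "\<And>m' y. m = Suc m' \<Longrightarrow> y \<in> {a..b} \<Longrightarrow> norm (word_sum N m' y g) \<le> weight N m' y * l1_norm N g"
  shows "norm (word_sum_integrand N m g y) \<le> (1/2) ^ m * word_sum_majorant N g x y"
proof -
  let ?c = kernel_bound
  have yab: "y \<in> {a..b}" and xy: "x \<le> y" using x y by auto
  let ?t = "\<lambda>ys. g (y # ys)"
  have IH_N': "norm (word_sum N' m y ?t) \<le> weight N' m x * l1_norm N' ?t" if "N = Suc N'" for N' m
  proof -
    have "norm (word_sum N' m y ?t) \<le> weight N' m y * l1_norm N' ?t"
      by (rule IH_N [OF that yab g' [OF that]])
    also have "\<dots> \<le> weight N' m x * l1_norm N' ?t"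
      by (intro mult_right_mono weight_antimono xy l1_norm_nonneg)
    finally show ?thesis .
  qed
  have cm: "norm (k ** M) \<le> ?c * u" if "norm (k ** M) \<le> ?c * norm M" "norm M \<le> u" for k M :: "complex^'n^'n" and u
    using that kernel_bound_pos by (meson mult_left_mono less_imp_le order_trans)
  have half: "weight N' m' x = (1/2) ^ m' * weight N' 0 x" for N' m'
    by (simp add: weight_def)
  have L: "norm (case N of 0 \<Rightarrow> 0 | Suc N' \<Rightarrow> kL y ** word_sum N' m y ?t) \<le>
      (1/2) ^ m * (case N of 0 \<Rightarrow> 0 | Suc N' \<Rightarrow> ?c * weight N' 0 x * l1_norm N' ?t)"
  proof (cases N)
    case (Suc N')
    then show ?thesis
      using cm [OF kernel_bound_L [OF yab] IH_N' [OF Suc, of m]] by (simp add: half [of N' m] mult_ac)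
  qed simp
  have A: "norm (case N of 0 \<Rightarrow> 0 | Suc N' \<Rightarrow> case m of 0 \<Rightarrow> 0 | Suc m' \<Rightarrow> kA y ** word_sum N' m' y ?t) \<le>
      (1/2) ^ m * (case N of 0 \<Rightarrow> 0 | Suc N' \<Rightarrow> 2 * ?c * weight N' 0 x * l1_norm N' ?t)"
  proof (cases N)
    case (Suc N')
    show ?thesis
    proof (cases m)
      case 0
      then show ?thesis
        using Suc kernel_bound_pos by (simp add: weight_nonneg l1_norm_nonneg)
    next
      case (Suc m')
      then show ?thesis
        using \<open>N = Suc N'\<close> cm [OF kernel_bound_A [OF yab] IH_N' [OF \<open>N = Suc N'\<close>, of m']]
        by (simp add: half [of N' m'] mult_ac)
    qed
  qed simp
  have R: "norm (case m of 0 \<Rightarrow> 0 | Suc m' \<Rightarrow> kR y ** word_sum N m' y g) \<le>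
      (1/2) ^ m * (2 * ?c * l1_norm N g * (6 * ?c) ^ N * exp (4 * ?c * (b - y)))"
  proof (cases m)
    case 0
    then show ?thesis
      using kernel_bound_pos by (simp add: l1_norm_nonneg)
  next
    case (Suc m')
    then show ?thesis
      using cm [OF kernel_bound_R [OF yab] IH_m [OF Suc yab]] by (simp add: weight_def mult_ac)
  qed
  have "norm (word_sum_integrand N m g y) \<le>
      (1/2) ^ m * (case N of 0 \<Rightarrow> 0 | Suc N' \<Rightarrow> ?c * weight N' 0 x * l1_norm N' ?t) +
      (1/2) ^ m * (2 * ?c * l1_norm N g * (6 * ?c) ^ N * exp (4 * ?c * (b - y))) +
      (1/2) ^ m * (case N of 0 \<Rightarrow> 0 | Suc N' \<Rightarrow> 2 * ?c * weight N' 0 x * l1_norm N' ?t)"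
    unfolding word_sum_integrand_def by (intro norm_triangle_mono L R A)
  also have "\<dots> = (1/2) ^ m * word_sum_majorant N g x y"
    by (cases N) (simp_all add: word_sum_majorant_def algebra_simps)
  finally show ?thesis .
qed

lemma
  assumes g: "list_integrable a b N g" and x: "x \<in> {a..b}"
  shows set_integrable_majorant: "set_integrable lborel {x..b} (word_sum_majorant N g x)"
    and set_integral_majorant: "(LINT y:{x..b}|lborel. word_sum_majorant N g x y) \<le>
      weight N 0 x * l1_norm N g"
proof -
  let ?c = kernel_bound
  have xb: "x \<le> b" and c: "4 * ?c \<noteq> 0" using x kernel_bound_pos by auto
  let ?f = "\<lambda>y. case N of 0 \<Rightarrow> 0 | Suc N' \<Rightarrow> 3 * ?c * weight N' 0 x * l1_norm N' (\<lambda>ys. g (y # ys))"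
  let ?d = "2 * ?c * l1_norm N g * (6 * ?c) ^ N"
  have f: "set_integrable lborel {x..b} ?f"
  proof (cases N)
    case (Suc N')
    then show ?thesis
      using g x by (auto intro!: set_integrable_mult_right set_integrable_subinterval [OF set_integrable_l1_norm])
  qed (simp add: set_integrable_def)
  have e: "set_integrable lborel {x..b} (\<lambda>y. ?d * exp (4 * ?c * (b - y)))"
    by (rule set_integral_exp_backward [OF xb c])
  show "set_integrable lborel {x..b} (word_sum_majorant N g x)"
    unfolding word_sum_majorant_def by (rule set_integral_add(1) [OF f e])
  have F: "(LINT y:{x..b}|lborel. ?f y) \<le> (if N = 0 then 0 else weight N 0 x * l1_norm N g / 2)"
  proof (cases N)
    case 0
    then show ?thesis by (simp add: set_lebesgue_integral_def)
  next
    case (Suc N')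
    let ?n = "\<lambda>y. l1_norm N' (\<lambda>ys. g (y # ys))"
    have n: "set_integrable lborel {a..b} ?n" and n_eq: "l1_norm N g = (LINT y:{a..b}|lborel. ?n y)"
      using g Suc by (auto intro: set_integrable_l1_norm l1_norm_Suc)
    \<comment> \<open>\<open>l1_norm\<close> integrates over all of \<open>{a..b}\<close>, so the
      domain is enlarged, by nonnegativity, before the slices recombine.\<close>
    have "(LINT y:{x..b}|lborel. ?n y) \<le> (LINT y:{a..b}|lborel. ?n y)"
      using n x set_integrable_subinterval [OF n, of x b] unfolding set_integrable_def set_lebesgue_integral_def
      by (intro integral_mono) (auto simp: indicator_def l1_norm_nonneg)
    then have "(LINT y:{x..b}|lborel. ?f y) \<le> 3 * ?c * weight N' 0 x * l1_norm N g"
      using Suc kernel_bound_pos unfolding n_eq by (simp add: mult_left_mono weight_nonneg)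
    also have "\<dots> = weight N 0 x * l1_norm N g / 2"
      by (simp add: weight_def Suc)
    finally show ?thesis using Suc by simp
  qed
  have "(LINT y:{x..b}|lborel. ?d * exp (4 * ?c * (b - y))) = ?d / (4 * ?c) * (exp (4 * ?c * (b - x)) - 1)"
    by (rule set_integral_exp_backward [OF xb c])
  also have "\<dots> = weight N 0 x * l1_norm N g / 2 - l1_norm N g * (6 * ?c) ^ N / 2"
    using kernel_bound_pos by (simp add: weight_def field_simps)
  finally have G: "(LINT y:{x..b}|lborel. ?d * exp (4 * ?c * (b - y))) = \<dots>" .
  have N0: "0 \<le> l1_norm N g * (6 * ?c) ^ N" "0 \<le> weight N 0 x * l1_norm N g"
    using kernel_bound_pos by (simp_all add: l1_norm_nonneg weight_nonneg)
  then show "(LINT y:{x..b}|lborel. word_sum_majorant N g x y) \<le>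
      weight N 0 x * l1_norm N g"
    unfolding word_sum_majorant_def set_integral_add(2) [OF f e] G
    using F N0 by (cases "N = 0") (simp_all add: field_simps)
qed


lemma AE_list_integrable_Cons:
  assumes "list_integrable a b N g"
  shows "AE y in lborel. y \<in> {a..b} \<longrightarrow> (\<forall>N'. N = Suc N' \<longrightarrow> list_integrable a b N' (\<lambda>ys. g (y # ys)))"
proof (cases N)
  case (Suc N')
  then show ?thesis
    using AE_list_integrable_Suc [of a b N' g] assms by simp
qed simp

text \<open>The induction is nested because a first letter \<open>R\<close> keeps N and g and lowers
  m, whereas \<open>L\<close> and \<open>A\<close> lower N and replace g by a slice, with m
  unchanged for \<open>L\<close>.\<close>

lemma norm_word_sum_le:
  assumes "x \<in> {a..b}" "list_integrable a b N g"
  shows "norm (word_sum N m x g) \<le> weight N m x * l1_norm N g"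
  using assms
proof (induction N arbitrary: x g m rule: less_induct)
  case (less N)
  note IH_N = less.IH
  show ?case
    using less.prems(1)
  proof (induction m arbitrary: x rule: less_induct)
    case (less m)
    note x = \<open>x \<in> {a..b}\<close> and g = \<open>list_integrable a b N g\<close>
    show ?case
    proof (cases "N = 0 \<and> m = 0")
      \<comment> \<open>Only the empty word is left. It is not produced by the integral recursion
        and is covered because the weight is at least 1.\<close>
      case True
      have "1 * l1_norm 0 g \<le> weight 0 0 x * l1_norm 0 g"
        using kernel_bound_pos x by (intro mult_right_mono l1_norm_nonneg) (simp add: weight_def)
      moreover have "word_sum 0 0 x g = g []"
        by (simp add: word_sum_def leg_words_unfold [of 0 0])
      ultimately show ?thesis
        using True by (simp add: l1_norm_def)
    next
      case False
      have int: "set_integrable lborel {x..b} (word_sum_integrand N m g)"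
        using x by (intro set_integrable_subinterval [OF set_integrable_word_sum [OF g]]) auto
      have "norm (word_sum N m x g) \<le> (LINT y:{x..b}|lborel. norm (word_sum_integrand N m g y))"
        using word_sum_unfold [OF g x, of m] False set_integral_norm_bound [OF int] by auto
      also have "\<dots> \<le> (LINT y:{x..b}|lborel. (1/2) ^ m * word_sum_majorant N g x y)"
      proof (rule set_integral_mono_AE)
        show "AE y\<in>{x..b} in lborel. norm (word_sum_integrand N m g y) \<le> (1/2) ^ m * word_sum_majorant N g x y"
          using AE_list_integrable_Cons [OF g]
        proof eventually_elim
          case (elim y)
          show ?case
          proof
            assume y: "y \<in> {x..b}"
            show "norm (word_sum_integrand N m g y) \<le> (1/2) ^ m * word_sum_majorant N g x y"
              using elim x y by (intro norm_word_sum_integrand_le x y g IH_N less.IH) auto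
          qed
        qed
      qed (intro set_integrable_norm int set_integrable_mult_right set_integrable_majorant g x)+
      also have "\<dots> = (1/2) ^ m * (LINT y:{x..b}|lborel. word_sum_majorant N g x y)"
        by simp
      also have "\<dots> \<le> (1/2) ^ m * (weight N 0 x * l1_norm N g)"
        by (intro mult_left_mono set_integral_majorant g x) simp
      also have "\<dots> = weight N m x * l1_norm N g"
        by (simp add: weight_def)
      finally show ?thesis .
    qed
  qed
qed

section \<open>Summation over the particle number of the ket\<close>

definition word_series :: "nat \<Rightarrow> real \<Rightarrow> (real list \<Rightarrow> complex^'n^'n) \<Rightarrow> complex^'n^'n" where
  "word_series N x g = (\<Sum>m. word_sum N m x g)"

lemma word_series_sums:
  assumes "x \<in> {a..b}" "list_integrable a b N g"
  shows "(\<lambda>m. word_sum N m x g) sums word_series N x g"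
proof -
  have "summable (\<lambda>m. norm (word_sum N m x g))"
  proof (rule summable_comparison_test' [of "\<lambda>m. weight N 0 x * l1_norm N g * (1/2) ^ m" 0])
    fix m
    show "norm (norm (word_sum N m x g)) \<le> weight N 0 x * l1_norm N g * (1/2) ^ m"
      using norm_word_sum_le [OF assms, of m] by (simp add: weight_def mult_ac)
  qed (intro summable_mult summable_geometric, simp)
  then show ?thesis
    unfolding word_series_def by (rule summable_sums [OF summable_norm_cancel])
qed

lemma sums_case_nat:
  fixes f :: "nat \<Rightarrow> 'a::real_normed_vector"
  assumes "f sums s"
  shows "(\<lambda>m. case m of 0 \<Rightarrow> 0 | Suc m' \<Rightarrow> f m') sums s"
  using sums_Suc [of "\<lambda>m. case m of 0 \<Rightarrow> 0 | Suc m' \<Rightarrow> f m'" s] assms by simp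

definition series_integrand :: "nat \<Rightarrow> (real list \<Rightarrow> complex^'n^'n) \<Rightarrow> real \<Rightarrow> complex^'n^'n" where
  "series_integrand N g y = (\<Sum>m. word_sum_integrand N m g y)"

text \<open>\<open>L\<close> and \<open>A\<close> differ only by a shift of m, which disappears in
  the sum over all m; from here on they enter through \<open>kL y + kA y\<close> alone.\<close>

lemma word_sum_integrand_sums:
  assumes y: "y \<in> {a..b}" and g: "list_integrable a b N g"
    and g': "\<And>N'. N = Suc N' \<Longrightarrow> list_integrable a b N' (\<lambda>ys. g (y # ys))"
  shows "(\<lambda>m. word_sum_integrand N m g y) sums (kR y ** word_series N y g +
     (case N of 0 \<Rightarrow> 0 | Suc N' \<Rightarrow> (kL y + kA y) ** word_series N' y (\<lambda>ys. g (y # ys))))"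
proof -
  have mult: "(\<lambda>m. k ** f m) sums (k ** s)" if "f sums s" for k :: "complex^'n^'n" and f s
    by (rule bounded_linear.sums [OF matrix_mult.bounded_linear_right that])
  have case_mult: "(case m of 0 \<Rightarrow> 0 | Suc m' \<Rightarrow> k ** f m') = k ** (case m of 0 \<Rightarrow> 0 | Suc m' \<Rightarrow> f m')"
    for k :: "complex^'n^'n" and f and m :: nat
    by (cases m) (simp_all add: matrix_mult.zero_right)
  have R: "(\<lambda>m. case m of 0 \<Rightarrow> 0 | Suc m' \<Rightarrow> kR y ** word_sum N m' y g) sums (kR y ** word_series N y g)"
    unfolding case_mult by (intro mult sums_case_nat word_series_sums y g)
  show ?thesis
  proof (cases N)
    case 0
    then show ?thesis
      using R [unfolded 0] by (simp add: word_sum_integrand_def)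
  next
    case (Suc N')
    have L: "(\<lambda>m. kL y ** word_sum N' m y (\<lambda>ys. g (y # ys))) sums (kL y ** word_series N' y (\<lambda>ys. g (y # ys)))"
      by (intro mult word_series_sums y g' Suc)
    have A: "(\<lambda>m. case m of 0 \<Rightarrow> 0 | Suc m' \<Rightarrow> kA y ** word_sum N' m' y (\<lambda>ys. g (y # ys))) sums
        (kA y ** word_series N' y (\<lambda>ys. g (y # ys)))"
      unfolding case_mult by (intro mult sums_case_nat word_series_sums y g' Suc)
    show ?thesis
      using sums_add [OF sums_add [OF L R [unfolded Suc]] A] Suc
      by (simp add: word_sum_integrand_def matrix_mult.add_left add_ac)
  qed
qed

lemma
  assumes g: "list_integrable a b N g"
  shows set_integrable_series: "set_integrable lborel {a..b} (series_integrand N g)"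
    and word_series_unfold: "x \<in> {a..b} \<Longrightarrow> word_series N x g =
      (if N = 0 then g [] else 0) + (LINT y:{x..b}|lborel. series_integrand N g y)"
proof -
  have key: "set_integrable lborel {x..b} (series_integrand N g) \<and>
      (\<lambda>m. LINT y:{x..b}|lborel. word_sum_integrand N m g y) sums (LINT y:{x..b}|lborel. series_integrand N g y)"
    if x: "x \<in> {a..b}" for x
  proof -
    define f where "f m y = indicator {x..b} y *\<^sub>R word_sum_integrand N m g y" for m y
    \<comment> \<open>\<open>H\<close> bounds the m-th integrand up to a factor 2^-m almost
      everywhere. Both conditions for exchanging sum and integral follow from this one
      function.\<close>
    define H where "H y = indicator {x..b} y *\<^sub>R word_sum_majorant N g x y" for y
    have H: "integrable lborel H"
      using set_integrable_majorant [OF g x] by (simp add: set_integrable_def H_def [abs_def])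
    have int: "integrable lborel (f m)" for m
      using set_integrable_subinterval [OF set_integrable_word_sum [OF g], of x b m] x
      by (simp add: set_integrable_def f_def [abs_def])
    have bound: "AE y in lborel. \<forall>m. norm (f m y) \<le> H y * (1/2) ^ m"
      using AE_list_integrable_Cons [OF g]
    proof eventually_elim
      case (elim y)
      show ?case
      proof
        fix m
        show "norm (f m y) \<le> H y * (1/2) ^ m"
        proof (cases "y \<in> {x..b}")
          case True
          then have "norm (word_sum_integrand N m g y) \<le> (1/2) ^ m * word_sum_majorant N g x y"
            using elim x by (intro norm_word_sum_integrand_le x g norm_word_sum_le) auto
          then show ?thesis
            using True by (simp add: f_def H_def mult.commute)
        qed (simp add: f_def H_def)
      qed
    qed
    have s1: "AE y in lborel. summable (\<lambda>m. norm (f m y))"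
      using bound
    proof eventually_elim
      case (elim y)
      show ?case
        by (rule summable_comparison_test' [of "\<lambda>m. H y * (1/2) ^ m" 0])
           (intro summable_mult summable_geometric, simp, use elim in simp)
    qed
    have s2: "summable (\<lambda>m. \<integral>y. norm (f m y) \<partial>lborel)"
    proof (rule summable_comparison_test' [of "\<lambda>m. integral\<^sup>L lborel H * (1/2) ^ m" 0])
      fix m
      have "(\<integral>y. norm (f m y) \<partial>lborel) \<le> (\<integral>y. H y * (1/2) ^ m \<partial>lborel)"
        using bound by (intro integral_mono_AE integrable_norm int integrable_mult_left H) auto
      then show "norm (\<integral>y. norm (f m y) \<partial>lborel) \<le> integral\<^sup>L lborel H * (1/2) ^ m"
        by simp
    qed (intro summable_mult summable_geometric, simp)
    have eq: "(\<lambda>y. \<Sum>m. f m y) = (\<lambda>y. indicator {x..b} y *\<^sub>R series_integrand N g y)"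
      by (auto simp: fun_eq_iff f_def series_integrand_def indicator_def)
    show ?thesis
      using integrable_suminf [OF int s1 s2] sums_integral [OF int s1 s2]
      unfolding eq by (simp add: set_integrable_def set_lebesgue_integral_def f_def [abs_def])
  qed
  show "set_integrable lborel {a..b} (series_integrand N g)"
    using key ab by auto
  assume x: "x \<in> {a..b}"
  have "(\<lambda>m. if m = 0 then (if N = 0 then g [] else 0) else 0) sums (if N = 0 then g [] else 0)"
    using sums_single [of 0 "\<lambda>_. if N = 0 then g [] else 0"] by simp
  from sums_add [OF this key [OF x, THEN conjunct2]]
  have "(\<lambda>m. word_sum N m x g) sums ((if N = 0 then g [] else 0) + (LINT y:{x..b}|lborel. series_integrand N g y))"
    by (rule sums_cong [THEN iffD1, rotated]) (auto simp: word_sum_unfold [OF g x])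
  then show "word_series N x g = (if N = 0 then g [] else 0) + (LINT y:{x..b}|lborel. series_integrand N g y)"
    using word_series_sums [OF x g] by (rule sums_unique2 [rotated])
qed

section \<open>The change of gauge that removes the letters R\<close>

lemma backward_primitive:
  fixes f :: "real \<Rightarrow> 'z::euclidean_space"
  assumes f: "set_integrable lborel {a..b} f"
    and F: "\<And>x. x \<in> {a..b} \<Longrightarrow> F x = c + (LINT y:{x..b}|lborel. f y)"
  shows "primitive_on a b F (\<lambda>y. - f y)"
proof (rule primitive_onI)
  show "set_integrable lborel {a..b} (\<lambda>y. - f y)"
    using f by (simp add: set_integrable_def)
  fix t assume t: "t \<in> {a..b}"
  have ft: "set_integrable lborel {a..t} f"
    using t by (intro set_integrable_subinterval [OF f]) auto
  have "(LINT y:{a..b}|lborel. f y) = (LINT y:{a..t}|lborel. f y) + (LINT y:{t..b}|lborel. f y)"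
    using t by (intro set_integral_split [OF f]) auto
  then show "F t = F a + (LINT y:{a..t}|lborel. - f y)"
    using F [OF t] F [of a] ab by (simp add: set_integral_uminus [OF ft])
qed

lemma list_integrable_mult_left:
  "list_integrable a b N g \<Longrightarrow> list_integrable a b N (\<lambda>ys. M ** g ys :: complex^'n^'n)"
  unfolding list_integrable_def by (rule integrable_bounded_linear [OF matrix_mult.bounded_linear_right])

text \<open>The series is known at the right end, where only the empty word survives; this is where
  the factor \<open>E b\<close> on the right comes from. The function g stays arbitrary in the
  induction, because behind the first letter it is replaced by its slice.\<close>

lemma word_series_gauge:
  assumes E: "primitive_on a b E (\<lambda>y. E y ** kR y)" and l: "regular_on {a..b} l"
    and lE: "\<And>y. y \<in> {a..b} \<Longrightarrow> E y ** (kL y + kA y) = l y ** E y"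
    and "x \<in> {a..b}" "list_integrable a b N g"
  shows "E x ** word_series N x g = word_integral a b (replicate N (l, True)) x (\<lambda>ys. E b ** g ys)"
  using \<open>x \<in> {a..b}\<close> \<open>list_integrable a b N g\<close>
proof (induction N arbitrary: x g)
  case 0
  note g = 0(2) and x = 0(1)
  define t where "t y = (E y ** kR y) ** word_series 0 y g + E y ** - series_integrand 0 g y" for y
  have T: "primitive_on a b (\<lambda>y. E y ** word_series 0 y g) t"
    unfolding t_def [abs_def]
    by (intro primitive_on_bilinear [OF bounded_bilinear_matrix_mult E]
        backward_primitive [OF set_integrable_series [OF g] word_series_unfold [OF g]])
  have "t y = 0" if "y \<in> {a..b}" for y
  proof -
    have "series_integrand 0 g y = kR y ** word_series 0 y g"
      using sums_unique [OF word_sum_integrand_sums [OF that g]] by (simp add: series_integrand_def)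
    then show ?thesis
      by (simp add: t_def matrix_mult.minus_right matrix_mul_assoc)
  qed
  then have "E b ** word_series 0 b g = E x ** word_series 0 x g"
    using primitive_on_zero [OF T, of b] primitive_on_zero [OF T, of x] x by auto
  moreover have "word_series 0 b g = g []"
    using word_series_unfold [OF g, of b] ab set_integral_singleton [of b] by simp
  ultimately show ?case by simp
next
  case (Suc N)
  note g = Suc.prems(2) and x = Suc.prems(1)
  define t where "t y = (E y ** kR y) ** word_series (Suc N) y g + E y ** - series_integrand (Suc N) g y" for y
  let ?h = "\<lambda>y. word_integral a b (replicate N (l, True)) y (\<lambda>ys. E b ** g (y # ys))"
  have T: "primitive_on a b (\<lambda>y. E y ** word_series (Suc N) y g) t"
    unfolding t_def [abs_def]
    by (intro primitive_on_bilinear [OF bounded_bilinear_matrix_mult E]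
        backward_primitive [OF set_integrable_series [OF g] word_series_unfold [OF g]])
  have Tx: "primitive_on x b (\<lambda>y. E y ** word_series (Suc N) y g) t"
    using x by (intro primitive_on_subinterval [OF T]) auto
  have reg: "regular_word a b ((l, True) # replicate N (l, True))"
    using l by (auto simp: regular_word_def)
  have gE: "list_integrable a b (selected ((l, True) # replicate N (l, True))) (\<lambda>ys. E b ** g ys)"
    using list_integrable_mult_left [OF g] by simp
  \<comment> \<open>The integrand of the series has its closed form only where the slice of g is
    integrable. There the two terms with \<open>kR\<close> cancel and \<open>lE\<close> moves
    \<open>E\<close> past the remaining kernels.\<close>
  have AE: "AE y in lborel. y \<in> {x..b} \<longrightarrow> - t y = l y ** ?h y"
    using AE_list_integrable_Cons [OF g]
  proof eventually_elim
    case (elim y)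
    show ?case
    proof
      assume "y \<in> {x..b}"
      then have y: "y \<in> {a..b}" using x by auto
      have g': "list_integrable a b N (\<lambda>ys. g (y # ys))"
        using elim y by simp
      define K where "K = kL y + kA y"
      have "series_integrand (Suc N) g y =
          kR y ** word_series (Suc N) y g + K ** word_series N y (\<lambda>ys. g (y # ys))"
        using sums_unique [OF word_sum_integrand_sums [OF y g]] g' by (simp add: series_integrand_def K_def)
      then have "- t y = (E y ** K) ** word_series N y (\<lambda>ys. g (y # ys))"
        by (simp add: t_def matrix_mult.minus_right matrix_mult.diff_right matrix_mult.add_right matrix_mul_assoc)
      also have "\<dots> = l y ** ?h y"
        by (simp add: K_def lE [OF y] Suc.IH [OF y g'] flip: matrix_mul_assoc)
      finally show "- t y = l y ** ?h y" .
    qed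
  qed
  have "(LINT y:{x..b}|lborel. - t y) = (LINT y:{x..b}|lborel. l y ** ?h y)"
  proof (rule set_integral_cong_AE [where f = "\<lambda>y. - t y" and g = "\<lambda>y. l y ** ?h y"])
    show "set_integrable lborel {x..b} (\<lambda>y. - t y)"
      using primitive_on_integrable [OF Tx] unfolding set_integrable_def by simp
    have "set_integrable lborel {a..b} (\<lambda>y. l y ** ?h y)"
      using set_integrable_word_integral [OF reg gE] by (simp only: if_True)
    then show "set_integrable lborel {x..b} (\<lambda>y. l y ** ?h y)"
      by (rule set_integrable_subinterval) (use x in auto)
    show "AE y in lborel. y \<in> {x..b} \<longrightarrow> - t y = l y ** ?h y"
      by (rule AE)
  qed
  also have "\<dots> = word_integral a b (replicate (Suc N) (l, True)) x (\<lambda>ys. E b ** g ys)"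
    using word_integral_Cons [OF reg gE x] by (simp only: if_True replicate_Suc)
  finally have "word_integral a b (replicate (Suc N) (l, True)) x (\<lambda>ys. E b ** g ys) = - (LINT y:{x..b}|lborel. t y)"
    using primitive_on_integrable [OF Tx] by (simp add: set_integral_uminus)
  moreover have "E b ** word_series (Suc N) b g = E x ** word_series (Suc N) x g + (LINT y:{x..b}|lborel. t y)"
    using x by (intro primitive_on_eq [OF Tx]) auto
  \<comment> \<open>A word with at least one letter has no room on \<open>{b..b}\<close>, so the
    boundary term vanishes.\<close>
  moreover have "word_series (Suc N) b g = 0"
    using word_series_unfold [OF g, of b] ab set_integral_singleton [of b] by simp
  ultimately show ?case
    by (metis matrix_mult.zero_right add_eq_0_iff2)
qed

theorem word_sums_gauge:
  assumes "primitive_on a b E (\<lambda>y. E y ** kR y)" "E a = mat 1" "regular_on {a..b} l"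
    and "\<And>y. y \<in> {a..b} \<Longrightarrow> E y ** (kL y + kA y) = l y ** E y"
    and g: "list_integrable a b N g"
  shows "(\<lambda>m. word_sum N m a g) sums word_integral a b (replicate N (l, True)) a (\<lambda>ys. E b ** g ys)"
  using word_series_gauge [OF assms(1,3,4), of a N g] word_series_sums [of a N g] g ab assms(2) by simp

end

section \<open>Chains in the interaction picture\<close>

lemma regular_on_bilinear:
  fixes F :: "real \<Rightarrow> complex^'m^'m" and G :: "real \<Rightarrow> complex^'n^'n"
  assumes h: "bounded_bilinear (h :: complex^'m^'m \<Rightarrow> complex^'n^'n \<Rightarrow> complex^'p^'p)"
    and F: "regular_on {a..b} F" and G: "regular_on {a..b} G"
  shows "regular_on {a..b} (\<lambda>x. h (F x) (G x))"
proof -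
  interpret h: bounded_bilinear h by fact
  obtain K where K: "K \<ge> 0" "\<And>u v. norm (h u v) \<le> norm u * norm v * K"
    using h.nonneg_bounded by blast
  obtain c where c: "\<And>x. x \<in> {a..b} \<Longrightarrow> norm (F x) \<le> c"
    using F unfolding regular_on_def bounded_iff by blast
  obtain d where d: "\<And>x. x \<in> {a..b} \<Longrightarrow> norm (G x) \<le> d"
    using G unfolding regular_on_def bounded_iff by blast
  have "norm (h (F x) (G x)) \<le> \<bar>c\<bar> * \<bar>d\<bar> * K" if "x \<in> {a..b}" for x
  proof -
    have "norm (F x) * norm (G x) * K \<le> \<bar>c\<bar> * \<bar>d\<bar> * K"
      using c [OF that] d [OF that] K(1) by (intro mult_right_mono mult_mono) auto
    then show ?thesis
      using K(2) order_trans by blast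
  qed
  then have "bounded ((\<lambda>x. h (F x) (G x)) ` {a..b})"
    unfolding bounded_iff by blast
  moreover have "(\<lambda>x. h (F x) (G x)) \<in> borel_measurable (restrict_space borel {a..b})"
    using F G unfolding regular_on_def
    by (intro borel_measurable_continuous_Pair [where H = h] h.continuous_on continuous_intros) blast+
  ultimately show ?thesis
    by (simp add: regular_on_def)
qed

lemma regular_on_add:
  assumes "regular_on {a..b} F" "regular_on {a..b} G"
  shows "regular_on {a..b} (\<lambda>x. F x + G x)"
  using assms bounded_plus_comp [of F "{a..b}" G] borel_measurable_add [of F _ G]
  unfolding regular_on_def by blast

lemmas regular_on_kron = regular_on_bilinear [OF bounded_bilinear_kron]
lemmas regular_on_mult = regular_on_bilinear [OF bounded_bilinear_matrix_mult]

lemma regular_on_const: "regular_on {a..b} (\<lambda>_. M)"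
  by (intro regular_on_continuous continuous_on_const)

lemma continuous_path_exp: "regular_on {a..b} Q \<Longrightarrow> continuous_on {a..b} (path_exp Q a)"
  by (rule primitive_on_continuous [OF path_exp_primitive(1)])

lemma continuous_path_exp_inv: "regular_on {a..b} Q \<Longrightarrow> continuous_on {a..b} (path_exp_inv Q a)"
  by (rule primitive_on_continuous [OF path_exp_inv_primitive(1)])

definition gauged :: "(real \<Rightarrow> complex^'d^'d) \<Rightarrow> real \<Rightarrow> (real \<Rightarrow> complex^'d^'d) \<Rightarrow> real \<Rightarrow> complex^'d^'d" where
  "gauged Q a k y = path_exp Q a y ** k y ** path_exp_inv Q a y"

lemma regular_on_gauged:
  assumes "regular_on {a..b} Q" "regular_on {a..b} k"
  shows "regular_on {a..b} (gauged Q a k)"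
  unfolding gauged_def [abs_def]
  by (intro regular_on_mult assms regular_on_continuous [OF continuous_path_exp]
      regular_on_continuous [OF continuous_path_exp_inv])

lemma path_chain_word_prod:
  assumes Q: "regular_on {a..b} Q" and "length \<alpha>s = length ys" "sorted (x # ys)" "set (x # ys) \<subseteq> {a..b}"
  shows "path_chain Q x (map2 (\<lambda>\<alpha> y. (y, f \<alpha> y)) \<alpha>s ys) b =
    path_exp_inv Q a x ** word_prod (map (\<lambda>\<alpha>. (gauged Q a (f \<alpha>), s \<alpha>)) \<alpha>s) ys ** path_exp Q a b"
  using assms(2-)
proof (induction \<alpha>s ys arbitrary: x rule: list_induct2)
  case Nil
  then show ?case
    using path_exp_factor [OF Q, of x b] by simp
next
  case (Cons \<alpha> \<alpha>s y ys)
  have "path_exp Q x y = path_exp_inv Q a x ** path_exp Q a y"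
    using Cons.prems by (intro path_exp_factor [OF Q]) auto
  then show ?case
    using Cons by (simp add: gauged_def matrix_mul_assoc)
qed

lemma path_chain_word_prod_start:
  assumes Q: "regular_on {a..b} Q" and "length \<alpha>s = length ys" "sorted ys" "set ys \<subseteq> {a..b}" "a \<le> b"
  shows "path_chain Q a (map2 (\<lambda>\<alpha> y. (y, f \<alpha> y)) \<alpha>s ys) b =
    word_prod (map (\<lambda>\<alpha>. (gauged Q a (f \<alpha>), s \<alpha>)) \<alpha>s) ys ** path_exp Q a b"
proof -
  have "sorted (a # ys)" "set (a # ys) \<subseteq> {a..b}"
    using assms by auto
  from path_chain_word_prod [OF Q assms(2) this] show ?thesis
    by (simp add: path_exp_inv_primitive(2) [OF Q])
qed

lemma map_conv_map2_replicate: "map (\<lambda>y. (y, f y)) ys = map2 (\<lambda>_ y. (y, f y)) (replicate (length ys) u) ys"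
  by (induction ys) auto

lemma path_chain_replicate:
  assumes "regular_on {a..b} Q" "sorted ys" "set ys \<subseteq> {a..b}" "a \<le> b"
  shows "path_chain Q a (map (\<lambda>y. (y, f y)) ys) b =
    word_prod (replicate (length ys) (gauged Q a f, s)) ys ** path_exp Q a b"
  using path_chain_word_prod_start [OF assms(1), of "replicate (length ys) ()" ys "\<lambda>_. f" "\<lambda>_. s"] assms(2-)
  by (simp add: map_conv_map2_replicate [of f ys "()"])

section \<open>Positions of bra and ket within a word\<close>

lemma select_cong_snd: "map snd ks = map snd ks' \<Longrightarrow> select ks xs = select ks' xs"
proof (induction ks arbitrary: ks' xs)
  case (Cons k ks)
  from Cons.prems obtain k' js where "ks' = k' # js" "snd k = snd k'" "map snd ks = map snd js"
    by (cases ks') auto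
  then show ?case
    using Cons.IH [of js "tl xs"] by simp
qed simp

text \<open>The amplitude of the ket involves only the positions of \<open>R\<close> and
  \<open>A\<close>. Padding with identity kernels at the other positions makes its product run over
  the same list as the product of the operator, so that the two can be tensored letter by
  letter.\<close>

lemma word_prod_select:
  assumes "length \<alpha>s = length xs"
  shows "word_prod (replicate (length (select (map (\<lambda>\<alpha>. (\<alpha>, P \<alpha>)) \<alpha>s) xs)) (k, s)) (select (map (\<lambda>\<alpha>. (\<alpha>, P \<alpha>)) \<alpha>s) xs) =
    word_prod (map (\<lambda>\<alpha>. (if P \<alpha> then k else (\<lambda>_. mat 1), t \<alpha>)) \<alpha>s) xs"
  using assms by (induction \<alpha>s xs rule: list_induct2) auto

lemma word_prod_kron:
  "word_prod (map (\<lambda>\<alpha>. (\<lambda>y. f \<alpha> y \<otimes>\<^sub>K h \<alpha> y, s \<alpha>)) \<alpha>s) xs =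
    word_prod (map (\<lambda>\<alpha>. (f \<alpha>, s \<alpha>)) \<alpha>s) xs \<otimes>\<^sub>K word_prod (map (\<lambda>\<alpha>. (h \<alpha>, s \<alpha>)) \<alpha>s) xs"
  by (induction \<alpha>s arbitrary: xs) (simp_all add: kron_one kron_mult)

lemma sorted_select:
  assumes "length xs = length ks" "sorted xs"
  shows "sorted (select ks xs)"
  using assms
proof (induction ks arbitrary: xs)
  case (Cons k ks)
  then obtain y ys where xs: "xs = y # ys"
    by (cases xs) auto
  show ?case
    using Cons set_select [of ys ks] by (auto simp: xs)
qed simp

text \<open>On matrix elements the outermost supermap annihilates first. \<open>fold ann\<close>
  therefore meets the positions in increasing order, separately for the bra and for the ket.\<close>

lemma foldr_leg_map:
  assumes "length \<alpha>s = length xs"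
  shows "foldr (\<lambda>(\<alpha>, x). leg_map \<alpha> x) (zip \<alpha>s xs) X \<phi> \<xi> =
    X (fold ann (select (map (\<lambda>\<alpha>. (\<alpha>, \<alpha> \<noteq> Leg_R)) \<alpha>s) xs) \<phi>) (fold ann (select (map (\<lambda>\<alpha>. (\<alpha>, \<alpha> \<noteq> Leg_L)) \<alpha>s) xs) \<xi>)"
  using assms
proof (induction \<alpha>s xs arbitrary: \<phi> \<xi> rule: list_induct2)
  case (Cons \<alpha> \<alpha>s x xs)
  then show ?case
    by (cases \<alpha>) (simp_all add: l_map_def r_map_def Ad_map_def)
qed simp

lemma mat_mult_commute: "M ** mat c = mat c ** (M :: complex^'n^'n)"
  by (simp add: vec_eq_iff matrix_matrix_mult_def mat_def if_distrib [of "\<lambda>x. x * _"] if_distrib [of "\<lambda>x. _ * x"] cong: if_cong)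

lemma trace_mat_mult: "trace (mat c ** (M :: complex^'n^'n)) = c * trace M"
  by (simp add: trace_def matrix_matrix_mult_def mat_def if_distrib [of "\<lambda>x. x * _"] sum_distrib_left cong: if_cong)

text \<open>Values of the bra enter as scalar matrices, so that a matrix-valued g can carry them
  through the word integrals; being central, they leave the trace as factors.\<close>

lemma trace_mult_mat: "trace (B ** (M ** (mat c ** N))) = c * trace (B ** (M ** (N :: complex^'n^'n)))"
proof -
  have "B ** (M ** (mat c ** N)) = mat c ** (B ** (M ** N))"
    by (metis mat_mult_commute matrix_mul_assoc)
  then show ?thesis
    by (simp add: trace_mat_mult)
qed

section \<open>Ordered integrals as word integrals\<close>

lemma ordered_integral_cong:
  assumes "\<And>xs. length xs = n \<Longrightarrow> sorted xs \<Longrightarrow> set xs \<subseteq> {a..b} \<Longrightarrow> f xs = g xs"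
  shows "ordered_integral a b n f = ordered_integral a b n g"
  unfolding ordered_integral_def set_lebesgue_integral_def
proof (intro Bochner_Integration.integral_cong refl)
  fix x assume x: "x \<in> space (config_space a b n)"
  have "f (points n x) = g (points n x)" if "strict_mono_on {..<n} x"
  proof (rule assms)
    show "sorted (points n x)"
      using that by (auto simp: points_def sorted_iff_nth_mono strict_mono_on_def le_less)
  qed (use x set_points in auto)
  then show "indicator {x \<in> space (config_space a b n). strict_mono_on {..<n} x} x *\<^sub>R f (points n x) =
      indicator {x \<in> space (config_space a b n). strict_mono_on {..<n} x} x *\<^sub>R g (points n x)"
    by (auto simp: indicator_def)
qed

text \<open>Sorted configurations that are not strictly increasing have two equal coordinates and so
  form a null set.\<close>

lemma ordered_integral_eq_list_integral:
  assumes f: "list_integrable a b n f" and f0: "\<And>xs. \<not> sorted xs \<Longrightarrow> f xs = 0"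
  shows "ordered_integral a b n f = list_integral a b n f"
  unfolding ordered_integral_def set_lebesgue_integral_def list_integral_def
proof (rule integral_cong_AE)
  let ?M = "config_space a b n"
  show "(\<lambda>x. f (points n x)) \<in> borel_measurable ?M"
    using f by (auto simp: list_integrable_def)
  then show "(\<lambda>x. indicator {x \<in> space ?M. strict_mono_on {..<n} x} x *\<^sub>R f (points n x)) \<in> borel_measurable ?M"
    by (intro borel_measurable_scaleR borel_measurable_indicator ordered_set_measurable)
  show "AE x in ?M. indicator {x \<in> space ?M. strict_mono_on {..<n} x} x *\<^sub>R f (points n x) = f (points n x)"
    using AE_config_space_inj AE_space
  proof eventually_elim
    case (elim x)
    have "strict_mono_on {..<n} x" if s: "sorted (points n x)"
    proof (rule strict_mono_onI)
      fix i j assume ij: "i \<in> {..<n}" "j \<in> {..<n}" "i < j"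
      then have "x i \<le> x j"
        using sorted_nth_mono [OF s, of i j] by (simp add: points_def)
      moreover have "x i \<noteq> x j"
        using ij elim(1) by (auto dest: inj_onD)
      ultimately show "x i < x j" by simp
    qed
    then show ?case
      using elim(2) f0 [of "points n x"] by (cases "sorted (points n x)") auto
  qed
qed

lemma trace_word_integral:
  fixes ks :: "((real \<Rightarrow> complex^'n^'n) \<times> bool) list"
  assumes ks: "regular_word a b ks" and g: "list_integrable a b (selected ks) g"
    and f: "\<And>xs. length xs = length ks \<Longrightarrow> sorted xs \<Longrightarrow> set xs \<subseteq> {a..b} \<Longrightarrow>
      f xs = trace (B ** (word_prod ks xs ** g (select ks xs)))"
  shows "ordered_integral a b (length ks) f = trace (B ** word_integral a b ks a g)"
proof -
  let ?h = "\<lambda>M. trace (B ** M)"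
  have h: "bounded_linear ?h"
    by (rule bounded_linear_compose [OF bounded_linear_trace matrix_mult.bounded_linear_right])
  have int: "list_integrable a b (length ks) (word_integrand ks a g)"
    by (rule word_integrand_integrable [OF ks g])
  have "ordered_integral a b (length ks) f = ordered_integral a b (length ks) (\<lambda>xs. ?h (word_integrand ks a g xs))"
    by (rule ordered_integral_cong) (auto simp: f word_integrand_def)
  also have "\<dots> = list_integral a b (length ks) (\<lambda>xs. ?h (word_integrand ks a g xs))"
  proof (rule ordered_integral_eq_list_integral)
    show "list_integrable a b (length ks) (\<lambda>xs. ?h (word_integrand ks a g xs))"
      using int unfolding list_integrable_def by (rule integrable_bounded_linear [OF h])
  qed (simp add: word_integrand_def matrix_mult.zero_right trace_def)
  also have "\<dots> = ?h (word_integral a b ks a g)"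
    using int unfolding list_integral_def list_integrable_def word_integral_def
    by (rule integral_bounded_linear [OF h])
  finally show ?thesis .
qed

text \<open>The configuration space has finite measure, so square integrable functions are
  integrable and the L1 bounds apply to every bra; the majorant comes from t \<le> 1 + t^2.\<close>

lemma fock_sector_integrable:
  assumes "\<phi> \<in> fock_sector a b N"
  shows "list_integrable a b N \<phi>"
  unfolding list_integrable_def
proof (rule Bochner_Integration.integrable_bound)
  let ?M = "config_space a b N"
  interpret finite_measure ?M
    by (rule finite_measure_config_space)
  show "integrable ?M (\<lambda>x. 1 + (cmod (\<phi> (points N x)))\<^sup>2)"
  proof (rule Bochner_Integration.integrable_add)
    show "integrable ?M (\<lambda>x. (cmod (\<phi> (points N x)))\<^sup>2)"
      using assms unfolding fock_sector_def by blast
  qed simp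
  show "(\<lambda>x. \<phi> (points N x)) \<in> borel_measurable ?M"
    using assms unfolding fock_sector_def by blast
  have "t \<le> 1 + t\<^sup>2" for t :: real
  proof -
    have "2 * t \<le> t\<^sup>2 + 1"
      using zero_le_power2 [of "t - 1"] by (simp add: power2_diff)
    moreover have "0 \<le> t\<^sup>2"
      by simp
    ultimately show ?thesis by linarith
  qed
  then show "AE x in ?M. cmod (\<phi> (points N x)) \<le> norm (1 + (cmod (\<phi> (points N x)))\<^sup>2)"
    by (intro AE_I2) (auto intro: order_trans)
qed

lemma fock_sector_mat_integrable:
  assumes "\<phi> \<in> fock_sector a b N"
  shows "list_integrable a b N (\<lambda>ys. mat (complex_of_real c * cnj (\<phi> ys)) ** (U :: complex^'n^'n))"
proof -
  \<comment> \<open>Conjugation is linear over the reals only, which is enough to pass through the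
    integral.\<close>
  have "linear (\<lambda>z. mat (complex_of_real c * cnj z) :: complex^'n^'n)"
    by (auto intro!: linearI simp: vec_eq_iff mat_def algebra_simps)
  then have "bounded_linear (\<lambda>z. mat (complex_of_real c * cnj z) :: complex^'n^'n)"
    by (simp add: linear_conv_bounded_linear)
  from bounded_linear_compose [OF matrix_mult.bounded_linear_left this, of U]
  show ?thesis
    using fock_sector_integrable [OF assms] unfolding list_integrable_def
    by (rule integrable_bounded_linear)
qed

lemma cmps_amplitude_word_prod:
  assumes "regular_on {a..b} Q" "sorted xs" "set xs \<subseteq> {a..b}" "a \<le> b"
  shows "cmps_amplitude a b B Q L xs =
    trace (B ** (word_prod (replicate (length xs) (gauged Q a L, s)) xs ** path_exp Q a b))"
  unfolding cmps_amplitude_def path_chain_replicate [OF assms, of L s] ..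

section \<open>Measurability and square integrability of the cMPS wave function\<close>

lemma measurable_config_permute:
  assumes "p permutes {..<N}"
  shows "(\<lambda>x. \<lambda>i\<in>{..<N}. x (p i)) \<in> measurable (config_space a b N) (config_space a b N)"
  unfolding config_space_def
  using permutes_in_image [OF assms]
  by (intro measurable_restrict measurable_component_singleton) auto

lemma mset_points_permute:
  assumes "p permutes {..<N}"
  shows "mset (points N (\<lambda>i\<in>{..<N}. x (p i))) = mset (points N x)"
proof -
  have "mset (points N (\<lambda>i\<in>{..<N}. x (p i))) = image_mset x (image_mset p (mset_set {..<N}))"
    by (auto simp: points_def atLeast0LessThan image_mset.compositionality comp_def intro!: image_mset_cong)
  also have "image_mset p (mset_set {..<N}) = mset_set {..<N}"
    using assms by (simp add: permutes_image_mset)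
  also have "image_mset x (mset_set {..<N}) = mset (points N x)"
    by (simp add: points_def atLeast0LessThan)
  finally show ?thesis .
qed

text \<open>Here coordinates may coincide: membership in \<open>fock_sector\<close> asks for
  measurability on the whole configuration space, so existence at every point is wanted and
  uniqueness is given up.\<close>

lemma ex_sorting_permutation:
  "\<exists>p. p permutes {..<N} \<and> sorted (points N (\<lambda>i\<in>{..<N}. x (p i)))"
proof -
  have "mset (sort (points N x)) = mset (points N x)"
    by simp
  then obtain p where p: "p permutes {..<length (points N x)}" "permute_list p (points N x) = sort (points N x)"
    by (rule mset_eq_permutation)
  have "permute_list p (points N x) = points N (\<lambda>i\<in>{..<N}. x (p i))"
    using permutes_in_image [OF p(1)] by (auto simp: permute_list_def points_def)
  then have "sorted (points N (\<lambda>i\<in>{..<N}. x (p i)))"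
    using p(2) by (metis sorted_sort)
  with p(1) show ?thesis by auto
qed

text \<open>The configuration space is covered by finitely many measurable regions, one for each
  permutation, and on each of them sorting is a fixed permutation of the coordinates. Where regions
  overlap the sorted list is the same.\<close>

lemma measurable_sort_points:
  assumes h: "(\<lambda>x. h (points N x)) \<in> measurable (config_space a b N) K"
    and f: "\<And>xs. length xs = N \<Longrightarrow> sorted xs \<Longrightarrow> set xs \<subseteq> {a..b} \<Longrightarrow> f xs = h xs"
  shows "(\<lambda>x. f (sort (points N x))) \<in> measurable (config_space a b N) K"
proof -
  let ?M = "config_space a b N"
  define T where "T p x = (\<lambda>i\<in>{..<N}. x (p i))" for p and x :: "nat \<Rightarrow> real"
  define \<Omega> where "\<Omega> p = {x \<in> space ?M. sorted (points N (T p x))}" for p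
  have T: "T p \<in> measurable ?M ?M" if "p permutes {..<N}" for p
    unfolding T_def [abs_def] by (rule measurable_config_permute [OF that])
  show ?thesis
  proof (rule measurable_piecewise_restrict [where C = "\<Omega> ` {p. p permutes {..<N}}"])
    show "countable (\<Omega> ` {p. p permutes {..<N}})"
      by (intro countable_finite finite_imageI finite_permutations) simp
    show "space ?M \<subseteq> \<Union> (\<Omega> ` {p. p permutes {..<N}})"
      using ex_sorting_permutation unfolding \<Omega>_def T_def by blast
  next
    fix W assume "W \<in> \<Omega> ` {p. p permutes {..<N}}"
    then obtain p where p: "p permutes {..<N}" and W: "W = \<Omega> p" by blast
    \<comment> \<open>Adding the lower end a changes nothing on \<open>{a..b}\<close> and brings the
      set into the form of \<open>sorted_points_measurable\<close>.\<close>
    have sorted_iff: "sorted (points N y) \<longleftrightarrow> sorted (a # points N y)" if "y \<in> space ?M" for y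
      using set_points [OF that] by auto
    have "\<Omega> p = T p -` {y \<in> space ?M. sorted (a # points N y)} \<inter> space ?M"
      using measurable_space [OF T [OF p]] by (auto simp: \<Omega>_def sorted_iff simp del: sorted_wrt.simps)
    also have "\<dots> \<in> sets ?M"
      by (rule measurable_sets [OF T [OF p] sorted_points_measurable])
    finally have sets: "\<Omega> p \<in> sets ?M" .
    then show "W \<inter> space ?M \<in> sets ?M"
      by (simp add: W)
    have "(\<lambda>x. h (points N (T p x))) \<in> measurable (restrict_space ?M W) K"
      by (intro measurable_restrict_space1 measurable_compose [OF T [OF p] h])
    moreover have "f (sort (points N x)) = h (points N (T p x))" if "x \<in> space (restrict_space ?M W)" for x
    proof -
      have x: "x \<in> space ?M" "sorted (points N (T p x))"
        using that by (auto simp: space_restrict_space W \<Omega>_def)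
      then have "sort (points N x) = points N (T p x)"
        using mset_points_permute [OF p] unfolding T_def by (intro properties_for_sort) auto
      then show ?thesis
        using x set_points [OF measurable_space [OF T [OF p] x(1)]] by (simp add: f)
    qed
    ultimately show "(\<lambda>x. f (sort (points N x))) \<in> measurable (restrict_space ?M W) K"
      by (subst measurable_cong [where g = "\<lambda>x. h (points N (T p x))"])
  qed
qed

text \<open>On sorted lists the amplitude is a linear image of a bounded measurable product along a
  word; bounded functions on a space of finite measure are square integrable.\<close>

lemma sector_cmps_in_fock_sector:
  fixes Q L :: "real \<Rightarrow> complex^'n^'n"
  assumes Q: "regular_on {a..b} Q" and L: "regular_on {a..b} L" and "a \<le> b"
  shows "sector N (cmps a b B Q L) \<in> fock_sector a b N"
proof -
  let ?M = "config_space a b N" and ?\<psi> = "cmps a b B Q L"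
  let ?ks = "replicate N (gauged Q a L, True)"
  let ?h = "\<lambda>xs. trace (B ** (word_prod ?ks xs ** path_exp Q a b))"
  interpret finite_measure ?M
    by (rule finite_measure_config_space)
  have ks: "regular_word a b ?ks"
    using regular_on_gauged [OF Q L] by (auto simp: regular_word_def)
  have amp: "cmps_amplitude a b B Q L xs = ?h xs" if "length xs = N" "sorted xs" "set xs \<subseteq> {a..b}" for xs
    using cmps_amplitude_word_prod [OF Q that(2,3) \<open>a \<le> b\<close>, of B L True] that(1) by simp
  have lin: "bounded_linear (\<lambda>W. trace (B ** (W ** path_exp Q a b)))"
    by (intro bounded_linear_compose [OF bounded_linear_trace]
        bounded_linear_compose [OF matrix_mult.bounded_linear_right] matrix_mult.bounded_linear_left)
  have "(\<lambda>x. word_prod ?ks (points N x)) \<in> borel_measurable ?M"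
    unfolding points_def using ks by (intro measurable_word_prod) auto
  then have hm: "(\<lambda>x. ?h (points N x)) \<in> borel_measurable ?M"
    by (rule measurable_compose)
       (intro borel_measurable_continuous_onI linear_continuous_on lin)
  have am: "(\<lambda>x. cmps_amplitude a b B Q L (sort (points N x))) \<in> borel_measurable ?M"
    by (rule measurable_sort_points [where h = ?h, OF hm amp])
  then have m: "(\<lambda>x. ?\<psi> (points N x)) \<in> borel_measurable ?M"
    unfolding cmps_def length_points by (intro borel_measurable_divide borel_measurable_const)
  obtain C where C: "\<And>xs. length xs = N \<Longrightarrow> set xs \<subseteq> {a..b} \<Longrightarrow> norm (word_prod ?ks xs) \<le> C"
    using word_prod_bounded [OF ks] by auto
  obtain K where K: "K \<ge> 0" "\<And>W. norm (trace (B ** (W ** path_exp Q a b))) \<le> norm W * K"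
    using bounded_linear.nonneg_bounded [OF lin] by blast
  have bound: "cmod (?\<psi> (points N x)) \<le> C * K" if "x \<in> space ?M" for x
  proof -
    let ?s = "sort (points N x)"
    have s: "length ?s = N" "sorted ?s" "set ?s \<subseteq> {a..b}"
      using set_points [OF that] by auto
    have "cmod (?\<psi> (points N x)) = cmod (?h ?s) / sqrt (fact N)"
      unfolding cmps_def amp [OF s] by (simp add: norm_divide)
    also have "\<dots> \<le> cmod (?h ?s)"
    proof -
      have "1 \<le> sqrt (fact N)"
        using fact_ge_1 [of N, where 'a = real] by simp
      from mult_left_mono [OF this, of "cmod (?h ?s)"] show ?thesis
        by (simp add: divide_le_eq)
    qed
    also have "\<dots> \<le> norm (word_prod ?ks ?s) * K"
      by (rule K)
    also have "\<dots> \<le> C * K"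
      by (intro mult_right_mono C s K)
    finally show ?thesis .
  qed
  have sq: "integrable ?M (\<lambda>x. (cmod (?\<psi> (points N x)))\<^sup>2)"
  proof (rule integrable_const_bound)
    show "AE x in ?M. norm ((cmod (?\<psi> (points N x)))\<^sup>2) \<le> (C * K)\<^sup>2"
      using bound by (intro AE_I2) (simp add: power_mono)
    show "(\<lambda>x. (cmod (?\<psi> (points N x)))\<^sup>2) \<in> borel_measurable ?M"
      using m by measurable
  qed
  show ?thesis
    unfolding fock_sector_def
  proof (intro CollectI conjI allI impI)
    fix xs ys :: "real list" assume "mset xs = mset ys"
    then have "sort xs = sort ys" "length xs = length ys"
      by (metis sorted_list_of_multiset_mset, metis size_mset)
    then show "sector N ?\<psi> xs = sector N ?\<psi> ys"
      by (simp add: sector_def cmps_def)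
  qed (simp_all add: sector_def m sq)
qed

text \<open>Brings the resulting cMPS into the form of the limit in \<open>word_sums_gauge\<close>.
  The factor \<open>sqrt (fact N)\<close> is the one that N annihilators produce on the bra.\<close>

lemma fock_inner_cmps_word_integral:
  fixes Q L :: "real \<Rightarrow> complex^'n^'n"
  assumes Q: "regular_on {a..b} Q" and L: "regular_on {a..b} L" and "a \<le> b" and \<phi>: "\<phi> \<in> fock_sector a b N"
  shows "fock_inner a b \<phi> (cmps a b B Q L) =
    trace (B ** word_integral a b (replicate N (gauged Q a L, True)) a
      (\<lambda>ys. mat (complex_of_real (sqrt (fact N)) * cnj (\<phi> ys)) ** path_exp Q a b))"
proof -
  let ?ks = "replicate N (gauged Q a L, True)"
  let ?g = "\<lambda>ys. mat (complex_of_real (sqrt (fact N)) * cnj (\<phi> ys)) ** path_exp Q a b"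
  let ?f = "\<lambda>xs. cmps_amplitude a b B Q L xs * cnj (fold ann xs \<phi> [])"
  have \<phi>0: "\<phi> xs = 0" if "length xs \<noteq> N" for xs
    using \<phi> that unfolding fock_sector_def by blast
  have ks: "regular_word a b ?ks"
    using regular_on_gauged [OF Q L] by (auto simp: regular_word_def)
  have sel: "select (replicate n (k, True)) xs = xs" if "length xs = n" for n xs and k :: "real \<Rightarrow> complex^'n^'n"
    using that by (induction n arbitrary: xs) (auto simp: length_Suc_conv)
  have "fock_inner a b \<phi> (cmps a b B Q L) = (\<Sum>j. ordered_integral a b j ?f)"
    by (rule fock_inner_cmps [OF \<phi> sector_cmps_in_fock_sector [OF Q L \<open>a \<le> b\<close>]])
  also have "\<dots> = ordered_integral a b N ?f"
  proof -
    have "ordered_integral a b j ?f = 0" if "j \<noteq> N" for j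
      using that by (simp add: ordered_integral_def set_lebesgue_integral_def fold_ann \<phi>0)
    then show ?thesis
      by (subst suminf_finite [of "{N}"]) auto
  qed
  also have "\<dots> = ordered_integral a b (length ?ks) ?f"
    by simp
  also have "\<dots> = trace (B ** word_integral a b ?ks a ?g)"
  proof (rule trace_word_integral [OF ks])
    show "list_integrable a b (selected ?ks) ?g"
      using fock_sector_mat_integrable [OF \<phi>] by simp
    fix xs assume xs: "length xs = length ?ks" "sorted xs" "set xs \<subseteq> {a..b}"
    have "?f xs = trace (B ** (word_prod ?ks xs ** path_exp Q a b)) * (complex_of_real (sqrt (fact N)) * cnj (\<phi> xs))"
      using cmps_amplitude_word_prod [OF Q xs(2,3) \<open>a \<le> b\<close>, of B L True] xs(1) by (simp add: fold_ann)
    also have "\<dots> = trace (B ** (word_prod ?ks xs ** ?g xs))"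
      by (simp add: trace_mult_mat)
    also have "?g xs = ?g (select ?ks xs)"
      using xs(1) by (simp add: sel)
    finally show "?f xs = trace (B ** (word_prod ?ks xs ** ?g (select ?ks xs)))" .
  qed
  finally show ?thesis .
qed

section \<open>Application of a cMPO to a cMPS\<close>

text \<open>The two traces multiply to the trace of a Kronecker product. The
  \<open>sqrt (fact m)\<close> from the annihilators on the ket cancels the normalisation in
  \<open>cmps\<close>, so only \<open>sqrt (fact N)\<close> remains, next to the bra.\<close>

lemma cmps_overlap_leg_word:
  fixes Q1 L1 R1 T1 :: "real \<Rightarrow> complex^'d1^'d1" and Q2 L2 :: "real \<Rightarrow> complex^'d2^'d2"
  assumes Q1: "regular_on {a..b} Q1" and Q2: "regular_on {a..b} Q2" and "a \<le> b"
    and \<alpha>s: "\<alpha>s \<in> leg_words N m"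
    and xs: "length xs = length \<alpha>s" "sorted xs" "set xs \<subseteq> {a..b}"
  defines "kL \<equiv> \<lambda>y. gauged Q1 a L1 y \<otimes>\<^sub>K mat 1"
    and "kR \<equiv> \<lambda>y. gauged Q1 a R1 y \<otimes>\<^sub>K gauged Q2 a L2 y"
    and "kA \<equiv> \<lambda>y. gauged Q1 a T1 y \<otimes>\<^sub>K gauged Q2 a L2 y"
  defines "ks \<equiv> map (\<lambda>\<alpha>. (leg_matrix kL kR kA \<alpha>, \<alpha> \<noteq> Leg_R)) \<alpha>s"
  shows "trace (B1 ** path_chain Q1 a (map2 (\<lambda>\<alpha> x. (x, leg_matrix L1 R1 T1 \<alpha> x)) \<alpha>s xs) b) *
      foldr (\<lambda>(\<alpha>, x). leg_map \<alpha> x) (zip \<alpha>s xs) vac_proj \<phi> (sector m (cmps a b B2 Q2 L2)) =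
    trace ((B1 \<otimes>\<^sub>K B2) ** (word_prod ks xs ** (mat (complex_of_real (sqrt (fact N)) * cnj (\<phi> (select ks xs))) **
      (path_exp Q1 a b \<otimes>\<^sub>K path_exp Q2 a b))))"
proof -
  let ?selL = "select (map (\<lambda>\<alpha>. (\<alpha>, \<alpha> \<noteq> Leg_R)) \<alpha>s) xs"
  let ?selR = "select (map (\<lambda>\<alpha>. (\<alpha>, \<alpha> \<noteq> Leg_L)) \<alpha>s) xs"
  let ?f = "\<lambda>\<alpha>. gauged Q1 a (leg_matrix L1 R1 T1 \<alpha>)"
  let ?h = "\<lambda>\<alpha>. if \<alpha> \<noteq> Leg_L then gauged Q2 a L2 else (\<lambda>_. mat 1)"
  let ?s = "\<lambda>\<alpha>. \<alpha> \<noteq> Leg_R"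
  have lenL: "length ?selL = N" and lenR: "length ?selR = m"
    using \<alpha>s by (simp_all add: leg_words_def filter_map comp_def)
  have selL: "select ks xs = ?selL"
    by (rule select_cong_snd) (simp add: ks_def comp_def)
  have R: "sorted ?selR" "set ?selR \<subseteq> {a..b}"
    using xs sorted_select [of xs "map (\<lambda>\<alpha>. (\<alpha>, \<alpha> \<noteq> Leg_L)) \<alpha>s"]
      set_select [of xs "map (\<lambda>\<alpha>. (\<alpha>, \<alpha> \<noteq> Leg_L)) \<alpha>s"] by auto
  have chain1: "path_chain Q1 a (map2 (\<lambda>\<alpha> x. (x, leg_matrix L1 R1 T1 \<alpha> x)) \<alpha>s xs) b =
      word_prod (map (\<lambda>\<alpha>. (?f \<alpha>, ?s \<alpha>)) \<alpha>s) xs ** path_exp Q1 a b"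
    using xs \<open>a \<le> b\<close> by (intro path_chain_word_prod_start [OF Q1]) auto
  have "cmps_amplitude a b B2 Q2 L2 ?selR =
      trace (B2 ** (word_prod (replicate (length ?selR) (gauged Q2 a L2, True)) ?selR ** path_exp Q2 a b))"
    by (rule cmps_amplitude_word_prod [OF Q2 R \<open>a \<le> b\<close>])
  also have "word_prod (replicate (length ?selR) (gauged Q2 a L2, True)) ?selR = word_prod (map (\<lambda>\<alpha>. (?h \<alpha>, ?s \<alpha>)) \<alpha>s) xs"
    by (rule word_prod_select) (use xs in simp)
  finally have chain2: "cmps_amplitude a b B2 Q2 L2 ?selR =
      trace (B2 ** (word_prod (map (\<lambda>\<alpha>. (?h \<alpha>, ?s \<alpha>)) \<alpha>s) xs ** path_exp Q2 a b))" .
  have leg: "leg_matrix kL kR kA \<alpha> = (\<lambda>y. ?f \<alpha> y \<otimes>\<^sub>K ?h \<alpha> y)" for \<alpha>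
    by (cases \<alpha>) (simp_all add: kL_def kR_def kA_def)
  have prod: "word_prod ks xs = word_prod (map (\<lambda>\<alpha>. (?f \<alpha>, ?s \<alpha>)) \<alpha>s) xs \<otimes>\<^sub>K word_prod (map (\<lambda>\<alpha>. (?h \<alpha>, ?s \<alpha>)) \<alpha>s) xs"
    unfolding ks_def leg by (rule word_prod_kron)
  have sort: "sort ?selR = ?selR"
    by (rule sort_key_id_if_sorted) (use R in simp)
  have foldr: "foldr (\<lambda>(\<alpha>, x). leg_map \<alpha> x) (zip \<alpha>s xs) vac_proj \<phi> (sector m (cmps a b B2 Q2 L2)) =
      cnj (complex_of_real (sqrt (fact N)) * \<phi> ?selL) * cmps_amplitude a b B2 Q2 L2 ?selR"
    unfolding foldr_leg_map [OF xs(1) [symmetric]] vac_proj_def fold_ann lenL lenR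
    by (simp add: sector_def cmps_def lenR sort del: length_select)
  show ?thesis
    unfolding foldr chain1 chain2 trace_mult_mat prod selL kron_mult trace_kron by simp
qed

text \<open>A word outside \<open>leg_words N m\<close> evaluates bra or ket in a wrong sector and
  contributes 0. The double sum over lengths and words thus collapses to a finite sum over
  \<open>leg_words N m\<close>.\<close>

lemma cmpo_sector_cmps:
  fixes Q1 L1 R1 T1 :: "real \<Rightarrow> complex^'d1^'d1" and Q2 L2 :: "real \<Rightarrow> complex^'d2^'d2"
  assumes Q1: "regular_on {a..b} Q1" and Q2: "regular_on {a..b} Q2" and "a \<le> b"
    and \<phi>: "\<phi> \<in> fock_sector a b N"
    and K: "leg_kernels a b (\<lambda>y. gauged Q1 a L1 y \<otimes>\<^sub>K mat 1) (\<lambda>y. gauged Q1 a R1 y \<otimes>\<^sub>K gauged Q2 a L2 y)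
      (\<lambda>y. gauged Q1 a T1 y \<otimes>\<^sub>K gauged Q2 a L2 y)" (is "leg_kernels a b ?kL ?kR ?kA")
  shows "cmpo a b B1 Q1 L1 R1 T1 \<phi> (sector m (cmps a b B2 Q2 L2)) =
    trace ((B1 \<otimes>\<^sub>K B2) ** leg_kernels.word_sum a b ?kL ?kR ?kA N m a
      (\<lambda>ys. mat (complex_of_real (sqrt (fact N)) * cnj (\<phi> ys)) ** (path_exp Q1 a b \<otimes>\<^sub>K path_exp Q2 a b)))"
proof -
  interpret leg_kernels a b ?kL ?kR ?kA by (rule K)
  let ?g = "\<lambda>ys. mat (complex_of_real (sqrt (fact N)) * cnj (\<phi> ys)) ** (path_exp Q1 a b \<otimes>\<^sub>K path_exp Q2 a b)"
  let ?f = "\<lambda>\<alpha>s xs. trace (B1 ** path_chain Q1 a (map2 (\<lambda>\<alpha> x. (x, leg_matrix L1 R1 T1 \<alpha> x)) \<alpha>s xs) b) *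
      foldr (\<lambda>(\<alpha>, x). leg_map \<alpha> x) (zip \<alpha>s xs) vac_proj \<phi> (sector m (cmps a b B2 Q2 L2))"
  let ?I = "\<lambda>\<alpha>s. ordered_integral a b (length \<alpha>s) (?f \<alpha>s)"
  have \<phi>0: "\<phi> xs = 0" if "length xs \<noteq> N" for xs
    using \<phi> that unfolding fock_sector_def by blast
  have I0: "?I \<alpha>s = 0" if "\<alpha>s \<notin> leg_words N m" for \<alpha>s
  proof -
    have "?f \<alpha>s xs = 0" if "length xs = length \<alpha>s" for xs
      using \<open>\<alpha>s \<notin> leg_words N m\<close> unfolding foldr_leg_map [OF that [symmetric]]
      by (auto simp: vac_proj_def fold_ann sector_def \<phi>0 leg_words_def filter_map comp_def)
    then have "?I \<alpha>s = ordered_integral a b (length \<alpha>s) (\<lambda>_. 0)"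
      by (rule ordered_integral_cong)
    then show ?thesis
      by (simp add: ordered_integral_def set_lebesgue_integral_def)
  qed
  have I: "?I \<alpha>s = trace ((B1 \<otimes>\<^sub>K B2) ** word_integral a b (leg_word \<alpha>s) a ?g)" if \<alpha>s: "\<alpha>s \<in> leg_words N m" for \<alpha>s
  proof -
    have "list_integrable a b (selected (leg_word \<alpha>s)) ?g"
      using fock_sector_mat_integrable [OF \<phi>] by (simp add: selected_leg_word [OF \<alpha>s])
    then have "ordered_integral a b (length (leg_word \<alpha>s)) (?f \<alpha>s) = trace ((B1 \<otimes>\<^sub>K B2) ** word_integral a b (leg_word \<alpha>s) a ?g)"
      by (rule trace_word_integral [OF regular_leg_word])
         (use cmps_overlap_leg_word [OF Q1 Q2 \<open>a \<le> b\<close> \<alpha>s] in \<open>simp add: leg_word_def\<close>)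
    then show ?thesis
      by (simp add: leg_word_def)
  qed
  have fin: "finite {\<alpha>s :: leg list. length \<alpha>s = n}" for n
  proof -
    have "finite (UNIV :: leg set)"
      by (simp add: UNIV_leg)
    from finite_lists_length_eq [OF this, of n] show ?thesis by simp
  qed
  have inner: "(\<Sum>\<alpha>s | length \<alpha>s = n. ordered_integral a b n (?f \<alpha>s)) = (\<Sum>\<alpha>s\<in>{\<alpha>s \<in> leg_words N m. length \<alpha>s = n}. ?I \<alpha>s)" for n
  proof -
    have "(\<Sum>\<alpha>s | length \<alpha>s = n. ordered_integral a b n (?f \<alpha>s)) = (\<Sum>\<alpha>s | length \<alpha>s = n. ?I \<alpha>s)"
      by (rule sum.cong) auto
    also have "\<dots> = (\<Sum>\<alpha>s\<in>{\<alpha>s \<in> leg_words N m. length \<alpha>s = n}. ?I \<alpha>s)"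
      by (rule sum.mono_neutral_right [OF fin]) (use I0 in auto)
    finally show ?thesis .
  qed
  have "cmpo a b B1 Q1 L1 R1 T1 \<phi> (sector m (cmps a b B2 Q2 L2)) =
      (\<Sum>n. \<Sum>\<alpha>s\<in>{\<alpha>s \<in> leg_words N m. length \<alpha>s = n}. ?I \<alpha>s)"
    unfolding cmpo_def inner ..
  also have "\<dots> = (\<Sum>n\<in>{..N + m}. \<Sum>\<alpha>s\<in>{\<alpha>s \<in> leg_words N m. length \<alpha>s = n}. ?I \<alpha>s)"
  proof (rule suminf_finite)
    fix n assume "n \<notin> {..N + m}"
    then have "{\<alpha>s \<in> leg_words N m. length \<alpha>s = n} = {}"
      using length_leg_words by auto
    then show "(\<Sum>\<alpha>s\<in>{\<alpha>s \<in> leg_words N m. length \<alpha>s = n}. ?I \<alpha>s) = 0"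
      by (simp only: sum.empty)
  qed simp
  also have "\<dots> = (\<Sum>\<alpha>s\<in>leg_words N m. ?I \<alpha>s)"
    by (rule sum.group) (use length_leg_words finite_leg_words in auto)
  also have "\<dots> = (\<Sum>\<alpha>s\<in>leg_words N m. trace ((B1 \<otimes>\<^sub>K B2) ** word_integral a b (leg_word \<alpha>s) a ?g))"
    by (intro sum.cong refl I)
  also have "\<dots> = trace ((B1 \<otimes>\<^sub>K B2) ** word_sum N m a ?g)"
    unfolding word_sum_def matrix_mult.sum_right by (simp add: bounded_linear.linear [OF bounded_linear_trace] linear_sum)
  finally show ?thesis .
qed

theorem mainTheorem2:
  fixes l a b :: real
    and B1 :: "complex^'d1^'d1" and Q1 L1 R1 T1 :: "real \<Rightarrow> complex^'d1^'d1"
    and B2 :: "complex^'d2^'d2" and Q2 L2 :: "real \<Rightarrow> complex^'d2^'d2"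
    and B :: "complex^('d1 \<times> 'd2)^('d1 \<times> 'd2)"
    and Q L :: "real \<Rightarrow> complex^('d1 \<times> 'd2)^('d1 \<times> 'd2)"
  assumes "l > 0" and "a = - l / 2" and "b = l / 2"
    and "regular_on {a..b} Q1" and "regular_on {a..b} L1"
    and "regular_on {a..b} R1" and "regular_on {a..b} T1"
    and "regular_on {a..b} Q2" and "regular_on {a..b} L2"
    and "B = B1 \<otimes>\<^sub>K B2"
    and "\<And>x. L x = L1 x \<otimes>\<^sub>K mat 1 + T1 x \<otimes>\<^sub>K L2 x"
    and "\<And>x. Q x = Q1 x \<otimes>\<^sub>K mat 1 + mat 1 \<otimes>\<^sub>K Q2 x + R1 x \<otimes>\<^sub>K L2 x"
  shows "maps_to a b (cmpo a b B1 Q1 L1 R1 T1) (cmps a b B2 Q2 L2) (cmps a b B Q L)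
    \<and> regular_on {a..b} Q \<and> regular_on {a..b} L
    \<and> CARD('d1 \<times> 'd2) \<le> CARD('d1) * CARD('d2)"
proof -
  have ab: "a \<le> b"
    using assms(1-3) by simp
  note Q1 = assms(4) and L1 = assms(5) and R1 = assms(6) and T1 = assms(7) and Q2 = assms(8) and L2 = assms(9)
  have L_eq: "L = (\<lambda>x. L1 x \<otimes>\<^sub>K mat 1 + T1 x \<otimes>\<^sub>K L2 x)"
    and Q_eq: "Q = (\<lambda>x. Q1 x \<otimes>\<^sub>K mat 1 + mat 1 \<otimes>\<^sub>K Q2 x + R1 x \<otimes>\<^sub>K L2 x)"
    using assms(11,12) by auto
  have L: "regular_on {a..b} L"
    unfolding L_eq by (intro regular_on_add regular_on_kron regular_on_const L1 T1 L2)
  have Q: "regular_on {a..b} Q"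
    unfolding Q_eq by (intro regular_on_add regular_on_kron regular_on_const Q1 Q2 R1 L2)
  define kL where "kL y = gauged Q1 a L1 y \<otimes>\<^sub>K (mat 1 :: complex^'d2^'d2)" for y
  define kR where "kR y = gauged Q1 a R1 y \<otimes>\<^sub>K gauged Q2 a L2 y" for y
  define kA where "kA y = gauged Q1 a T1 y \<otimes>\<^sub>K gauged Q2 a L2 y" for y
  have K: "leg_kernels a b kL kR kA"
    unfolding kL_def [abs_def] kR_def [abs_def] kA_def [abs_def]
    by (intro leg_kernels.intro ab regular_on_kron regular_on_gauged regular_on_const Q1 Q2 L1 R1 T1 L2)
  interpret leg_kernels a b kL kR kA by (rule K)
  define U where "U y = path_exp Q1 a y \<otimes>\<^sub>K path_exp Q2 a y" for y
  define J where "J y = path_exp_inv Q1 a y \<otimes>\<^sub>K path_exp_inv Q2 a y" for y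
  define E where "E y = path_exp Q a y ** J y" for y
  have JU: "J y ** U y = mat 1" if "y \<in> {a..b}" for y
    by (simp add: J_def U_def kron_mult kron_one path_exp_left_inverse [OF Q1 that] path_exp_left_inverse [OF Q2 that])
  have kR_eq: "kR y = U y ** (R1 y \<otimes>\<^sub>K L2 y) ** J y" for y
    by (simp add: kR_def U_def J_def gauged_def kron_mult)
  \<comment> \<open>The second tensor factor of \<open>kL\<close> is the identity; writing it as V2
    times its inverse brings both kernels into the form of a conjugation by
    \<open>U\<close>.\<close>
  have k_eq: "kL y + kA y = U y ** L y ** J y" if y: "y \<in> {a..b}" for y
    by (simp add: kL_def kA_def U_def J_def gauged_def assms(11) kron_mult
        matrix_mult.add_left matrix_mult.add_right path_exp_right_inverse [OF Q2 y])
  \<comment> \<open>\<open>J\<close> is the inverse of \<open>U\<close>, so its derivative involves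
    the generator of the uncoupled product, that is, \<open>Q\<close> without the term
    \<open>R1 \<otimes>\<^sub>K L2\<close>.\<close>
  have J: "primitive_on a b J (\<lambda>y. - ((Q1 y \<otimes>\<^sub>K mat 1 + mat 1 \<otimes>\<^sub>K Q2 y) ** J y))"
  proof (rule primitive_on_cong)
    show "primitive_on a b J (\<lambda>y. (- (Q1 y ** path_exp_inv Q1 a y)) \<otimes>\<^sub>K path_exp_inv Q2 a y +
        path_exp_inv Q1 a y \<otimes>\<^sub>K (- (Q2 y ** path_exp_inv Q2 a y)))"
      unfolding J_def [abs_def]
      by (intro primitive_on_bilinear [OF bounded_bilinear_kron] path_exp_inv_primitive(1) Q1 Q2)
    fix y
    show "(- (Q1 y ** path_exp_inv Q1 a y)) \<otimes>\<^sub>K path_exp_inv Q2 a y +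
        path_exp_inv Q1 a y \<otimes>\<^sub>K (- (Q2 y ** path_exp_inv Q2 a y)) = - ((Q1 y \<otimes>\<^sub>K mat 1 + mat 1 \<otimes>\<^sub>K Q2 y) ** J y)"
      by (simp add: J_def matrix_mult.add_left kron_mult kron.minus_left kron.minus_right)
  qed simp
  \<comment> \<open>The uncoupled generator cancels between the two factors of \<open>E\<close>.
    What is left is V (R1 \<otimes> L2) J, and inserting \<open>J y ** U y\<close> = 1 makes it
    \<open>E y ** kR y\<close>.\<close>
  have E: "primitive_on a b E (\<lambda>y. E y ** kR y)"
  proof (rule primitive_on_cong)
    show "primitive_on a b E (\<lambda>y. (path_exp Q a y ** Q y) ** J y +
        path_exp Q a y ** - ((Q1 y \<otimes>\<^sub>K mat 1 + mat 1 \<otimes>\<^sub>K Q2 y) ** J y))"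
      unfolding E_def [abs_def]
      by (intro primitive_on_bilinear [OF bounded_bilinear_matrix_mult] path_exp_primitive(1) Q J)
    fix y assume y: "y \<in> {a..b}"
    define Q0 where "Q0 = Q1 y \<otimes>\<^sub>K mat 1 + mat 1 \<otimes>\<^sub>K Q2 y"
    have "E y ** kR y = path_exp Q a y ** ((J y ** U y) ** ((R1 y \<otimes>\<^sub>K L2 y) ** J y))"
      by (simp add: E_def kR_eq matrix_mul_assoc)
    then have "E y ** kR y = path_exp Q a y ** ((R1 y \<otimes>\<^sub>K L2 y) ** J y)"
      by (simp add: JU [OF y])
    moreover have "Q y = Q0 + R1 y \<otimes>\<^sub>K L2 y"
      by (simp add: assms(12) Q0_def)
    ultimately show "(path_exp Q a y ** Q y) ** J y + path_exp Q a y ** - ((Q1 y \<otimes>\<^sub>K mat 1 + mat 1 \<otimes>\<^sub>K Q2 y) ** J y) = E y ** kR y"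
      unfolding Q0_def [symmetric]
      by (simp add: matrix_mult.add_left matrix_mult.add_right matrix_mult.minus_right matrix_mul_assoc)
  qed simp
  have Ea: "E a = mat 1"
    by (simp add: E_def J_def path_exp_primitive(2) [OF Q] path_exp_inv_primitive(2) [OF Q1]
        path_exp_inv_primitive(2) [OF Q2] kron_one)
  have lE: "E y ** (kL y + kA y) = gauged Q a L y ** E y" if y: "y \<in> {a..b}" for y
  proof -
    have "E y ** (kL y + kA y) = path_exp Q a y ** ((J y ** U y) ** (L y ** J y))"
      by (simp add: E_def k_eq [OF y] matrix_mul_assoc)
    also have "\<dots> = path_exp Q a y ** (L y ** ((path_exp_inv Q a y ** path_exp Q a y) ** J y))"
      by (simp add: JU [OF y] path_exp_left_inverse [OF Q y])
    also have "\<dots> = gauged Q a L y ** E y"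
      by (simp add: E_def gauged_def matrix_mul_assoc)
    finally show ?thesis .
  qed
  \<comment> \<open>At the right end the factor \<open>U b\<close> carried by g absorbs the inverse
    inside \<open>E b\<close>, leaving the path-ordered exponential of the new
    \<open>Q\<close>.\<close>
  have EU: "E b ** U b = path_exp Q a b"
    using JU [of b] ab by (simp add: E_def flip: matrix_mul_assoc)
  have "maps_to a b (cmpo a b B1 Q1 L1 R1 T1) (cmps a b B2 Q2 L2) (cmps a b B Q L)"
    unfolding maps_to_def
  proof (intro allI conjI ballI)
    fix N
    show "sector N (cmps a b B Q L) \<in> fock_sector a b N"
      by (rule sector_cmps_in_fock_sector [OF Q L ab])
    fix \<phi> assume \<phi>: "\<phi> \<in> fock_sector a b N"
    let ?c = "\<lambda>ys. complex_of_real (sqrt (fact N)) * cnj (\<phi> ys)"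
    have g: "list_integrable a b N (\<lambda>ys. mat (?c ys) ** U b)"
      by (rule fock_sector_mat_integrable [OF \<phi>])
    have "(\<lambda>m. word_sum N m a (\<lambda>ys. mat (?c ys) ** U b)) sums
        word_integral a b (replicate N (gauged Q a L, True)) a (\<lambda>ys. E b ** (mat (?c ys) ** U b))"
      by (rule word_sums_gauge [OF E Ea regular_on_gauged [OF Q L] lE g])
    moreover have "E b ** (mat z ** U b) = mat z ** path_exp Q a b" for z
      by (metis EU mat_mult_commute matrix_mul_assoc)
    ultimately have "(\<lambda>m. trace (B ** word_sum N m a (\<lambda>ys. mat (?c ys) ** U b))) sums
        trace (B ** word_integral a b (replicate N (gauged Q a L, True)) a (\<lambda>ys. mat (?c ys) ** path_exp Q a b))"
      using bounded_linear.sums [OF bounded_linear_compose [OF bounded_linear_trace matrix_mult.bounded_linear_right]]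
      by simp
    then show "(\<lambda>m. cmpo a b B1 Q1 L1 R1 T1 \<phi> (sector m (cmps a b B2 Q2 L2))) sums fock_inner a b \<phi> (cmps a b B Q L)"
      using K cmpo_sector_cmps [OF Q1 Q2 ab \<phi>, of L1 R1 L2 T1 B1 _ B2]
      unfolding fock_inner_cmps_word_integral [OF Q L ab \<phi>] assms(10) U_def kL_def [abs_def] kR_def [abs_def] kA_def [abs_def]
      by simp
  qed
  then show ?thesis
    using Q L by simp
qed

end
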